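(* For $0\le\sigma\le 1$, $$\mathbb{E}[\operatorname{area} K_\sigma]=\frac{\pi}{3}\cdot\frac{\sigma^2+\sigma+1}{\sigma+1}.$$
   Context: Let $B=\{B_t: 0\le t\le 1\}$ be a standard planar ($\mathbb{R}^2$-valued) Brownian bridge from $0$ to $0$ on $[0,1]$, i.e. the continuous centered Gaussian process with covariance $\mathbb{E}[B_sB_t^{T}]=(\min\{s,t\}-st)I$, and let $Z\sim N(0,I)$ be a standard Gaussian vector in $\mathbb{R}^2$ independent of $B$. For $\sigma\in[0,1]$ define $X_\sigma(t)=B_t+\sigma tZ$, $0\le t\le 1$, and let $K_\sigma=\operatorname{hull}\{X_\sigma(t): 0\le t\le 1\}$ be the convex hull of its trajectory. $\operatorname{area}K$ denotes the area (planar Lebesgue measure) of $K$. *)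

theory Defs
  imports "HOL-Probability.Probability"
begin

(* Degenerate (zero variance) laws count as Gaussian; the bridge has them at t = 0 and t = 1. *)
definition gaussian_rv :: "'a measure \<Rightarrow> ('a \<Rightarrow> real) \<Rightarrow> bool" where
  "gaussian_rv M Y \<longleftrightarrow> Y \<in> borel_measurable M \<and>
     (\<exists>\<mu> s. distr M borel Y = return borel \<mu> \<or>
            (s > 0 \<and> distributed M lborel Y (\<lambda>x. ennreal (normal_density \<mu> s x))))"

(* Joint Gaussianity of the finite-dimensional vectors, via all their linear combinations. *)
definition gaussian_process ::
    "'a measure \<Rightarrow> 'i set \<Rightarrow> ('i \<Rightarrow> 'a \<Rightarrow> real ^ 'n) \<Rightarrow> bool" where
  "gaussian_process M I X \<longleftrightarrow>
     (\<forall>t\<in>I. X t \<in> borel_measurable M) \<and>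
     (\<forall>T c. finite T \<and> T \<subseteq> I \<longrightarrow> gaussian_rv M (\<lambda>\<omega>. \<Sum>t\<in>T. c t \<bullet> X t \<omega>))"

(* Every path is continuous, not only almost every one.  Values B t with t outside [0,1]
   are unconstrained. *)
definition brownian_bridge :: "'a measure \<Rightarrow> (real \<Rightarrow> 'a \<Rightarrow> real ^ 'n) \<Rightarrow> bool" where
  "brownian_bridge M B \<longleftrightarrow>
     gaussian_process M {0..1} B \<and>
     (\<forall>\<omega>\<in>space M. continuous_on {0..1} (\<lambda>t. B t \<omega>)) \<and>
     (\<forall>t\<in>{0..1}. (\<integral>\<omega>. B t \<omega> \<partial>M) = 0) \<and>
     (\<forall>s\<in>{0..1}. \<forall>t\<in>{0..1}. \<forall>i j.
        (\<integral>\<omega>. B s \<omega> $ i * B t \<omega> $ j \<partial>M) = (min s t - s * t) * (mat 1 :: real ^ 'n ^ 'n) $ i $ j)"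

definition std_gaussian_vector :: "'a measure \<Rightarrow> ('a \<Rightarrow> real ^ 'n) \<Rightarrow> bool" where
  "std_gaussian_vector M Z \<longleftrightarrow>
     distributed M lborel Z (\<lambda>z. ennreal (\<Prod>i\<in>UNIV. std_normal_density (z $ i)))"

(* Independence of the sigma-algebras generated by the whole family (X t), t in I, and by Z.
   The library's indep_var needs both variables to have the same value type. *)
definition process_indep ::
    "'a measure \<Rightarrow> 'i set \<Rightarrow> ('i \<Rightarrow> 'a \<Rightarrow> real ^ 'n) \<Rightarrow> ('a \<Rightarrow> real ^ 'n) \<Rightarrow> bool" where
  "process_indep M I X Z \<longleftrightarrow>
     prob_space.indep_set M
       (sets (vimage_algebra (space M) (\<lambda>\<omega>. \<lambda>t\<in>I. X t \<omega>) (PiM I (\<lambda>_. borel))))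
       (sets (vimage_algebra (space M) Z borel))"

definition X_process ::
    "(real \<Rightarrow> 'a \<Rightarrow> real ^ 'n) \<Rightarrow> ('a \<Rightarrow> real ^ 'n) \<Rightarrow> real \<Rightarrow> real \<Rightarrow> 'a \<Rightarrow> real ^ 'n" where
  "X_process B Z \<sigma> t \<omega> = B t \<omega> + (\<sigma> * t) *\<^sub>R Z \<omega>"

definition K_hull ::
    "(real \<Rightarrow> 'a \<Rightarrow> real ^ 'n) \<Rightarrow> ('a \<Rightarrow> real ^ 'n) \<Rightarrow> real \<Rightarrow> 'a \<Rightarrow> (real ^ 'n) set" where
  "K_hull B Z \<sigma> \<omega> = convex hull ((\<lambda>t. X_process B Z \<sigma> t \<omega>) ` {0..1})"

definition area :: "(real ^ 2) set \<Rightarrow> real" where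
  "area S = measure lebesgue S"

end

theory Submission
  imports Defs
begin

text \<open>
  Sampling the path at \<open>k / n\<close> gives a planar walk with exchangeable increments.
  The area of its hull is the sum of the triangles spanned by the origin and the edges.
  Fix the number \<open>k\<close> of steps that an edge spans and move these steps to the end of the walk.
  The points of the block lie on the right side of the edge for exactly one of its \<open>k\<close> cyclic shifts,
  and summing over the position of the edge produces the maximum of the remaining walk in the direction normal to the block.
  Spitzer's cyclic argument evaluates the expectation of this maximum, so that the expected area of the hull is
  \<open>\<Sum> E |det (S\<^sub>q, S\<^sub>n - S\<^sub>n\<^sub>-\<^sub>k)| / (2 k q)\<close> over \<open>k, q \<ge> 1\<close> with \<open>k + q \<le> n\<close>
  (a formula of Barndorff-Nielsen and Baxter).
  For the Gaussian increments at hand, with \<open>s = q / n\<close> and \<open>t = k / n\<close>, the expected determinant equals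
  \<open>sqrt (s t (1 - (1 - \<sigma>\<^sup>2) (s + t)))\<close>.
  Since \<open>\<Sum>q=1..<N. 1 / sqrt (q (N - q))\<close> tends to \<open>\<pi>\<close>, the double sum converges to
  \<open>\<pi> / 2\<close> times the integral of \<open>sqrt (1 - (1 - \<sigma>\<^sup>2) u)\<close> over \<open>[0, 1]\<close>.
  Monotone convergence along dyadic samples gives the result.
\<close>

section \<open>Planar convex hulls\<close>

text \<open>The block may be moved because the height of a point over the line through an edge is a
  cross product with the edge vector, to which the block as a whole adds nothing. So being an edge
  splits into a condition on the block alone and a condition on the walk without the block, and
  cyclic shifts of either piece keep the edge vector. This is why exchangeability suffices and no
  independence of the increments is used. In the weight \<open>1 / (2 * k * q)\<close> the factors
  come from the area of a triangle, from the one good shift among \<open>k\<close>, and from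
  Spitzer's average over \<open>q\<close> shifts. The obstacle is degeneracy: for
  \<open>\<sigma> = 0\<close> the sampled walk returns to its start, so general position can only be
  demanded of blocks that leave out at least one step. No constant accompanies the determinant since
  two independent standard Gaussian vectors in the plane have expected absolute determinant 1; what
  remains is the root of the determinant of a 2 by 2 covariance matrix.\<close>

definition cr :: "real ^ 2 \<Rightarrow> real ^ 2 \<Rightarrow> real" where
  "cr a b = a $ 1 * b $ 2 - a $ 2 * b $ 1"

lemma inner_vec2: "(a :: real ^ 2) \<bullet> b = a $ 1 * b $ 1 + a $ 2 * b $ 2"
  by (simp add: inner_vec_def sum_2)

lemma vec2_eq_0_iff: "(a :: real ^ 2) = 0 \<longleftrightarrow> a $ 1 = 0 \<and> a $ 2 = 0"
  by (simp add: vec_eq_iff forall_2)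

lemma cr_add_left: "cr (a + b) c = cr a c + cr b c"
  and cr_diff_left: "cr (a - b) c = cr a c - cr b c"
  and cr_scaleR_left: "cr (r *\<^sub>R a) c = r * cr a c"
  and cr_add_right: "cr c (a + b) = cr c a + cr c b"
  and cr_diff_right: "cr c (a - b) = cr c a - cr c b"
  and cr_scaleR_right: "cr c (r *\<^sub>R a) = r * cr c a"
  by (simp_all add: cr_def algebra_simps)

lemma cr_0_left [simp]: "cr 0 a = 0" and cr_0_right [simp]: "cr a 0 = 0" and cr_self [simp]: "cr a a = 0"
  by (simp_all add: cr_def)

lemma orthogonal_imp_cr_eq_0:
  assumes "a \<bullet> v = 0" "a \<bullet> w = 0" "a \<noteq> 0"
  shows "cr v w = 0"
proof -
  \<comment> \<open>One coordinate is eliminated from the two orthogonality relations, as in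
    Cramer's rule.\<close>
  have "a $ 1 * cr v w = (a \<bullet> v) * w $ 2 - (a \<bullet> w) * v $ 2"
       "a $ 2 * cr v w = (a \<bullet> w) * v $ 1 - (a \<bullet> v) * w $ 1"
    by (simp_all add: cr_def inner_vec2 algebra_simps)
  thus ?thesis using assms by (auto simp: vec2_eq_0_iff)
qed

text \<open>In the plane a vector orthogonal to \<open>d\<close> is a multiple of \<open>d\<close>
  turned by a right angle, and \<open>cr v d\<close> is the inner product of \<open>v\<close> with
  the turned vector. This translates supporting functionals into cross products.\<close>

lemma orthogonal_imp_inner_eq_cr:
  assumes "a \<bullet> d = 0" "d \<noteq> 0"
  obtains k where "\<And>v. a \<bullet> v = k * cr v d"
proof -
  have ex: "\<exists>k. a = k *\<^sub>R vector [d $ 2, - d $ 1]"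
  proof (cases "d $ 2 = 0")
    case True
    hence "d $ 1 \<noteq> 0" using assms by (simp add: vec2_eq_0_iff)
    moreover have "a $ 1 * d $ 1 = 0" using assms(1) True by (simp add: inner_vec2)
    ultimately have "a = (- a $ 2 / d $ 1) *\<^sub>R vector [d $ 2, - d $ 1]"
      using True by (simp add: vec_eq_iff forall_2)
    thus ?thesis ..
  next
    case False
    have "a $ 2 * d $ 2 = - (a $ 1 * d $ 1)" using assms(1) by (simp add: inner_vec2)
    hence "a = (a $ 1 / d $ 2) *\<^sub>R vector [d $ 2, - d $ 1]"
      using False by (simp add: vec_eq_iff forall_2 field_simps)
    thus ?thesis ..
  qed
  then obtain k where "a = k *\<^sub>R vector [d $ 2, - d $ 1]" ..
  hence "a \<bullet> v = k * cr v d" for v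
    by (simp add: inner_vec2 cr_def algebra_simps)
  thus ?thesis by (rule that)
qed

lemma negligible_cr_eq_0:
  assumes "w \<noteq> 0"
  shows "negligible {p. cr p w = 0}"
proof -
  have "{p. cr p w = 0} = {p. (vector [w $ 2, - w $ 1] :: real ^ 2) \<bullet> p = 0}"
    by (auto simp: cr_def inner_vec2 algebra_simps)
  moreover have "(vector [w $ 2, - w $ 1] :: real ^ 2) \<noteq> 0"
    using assms by (auto simp: vec2_eq_0_iff)
  ultimately show ?thesis by (simp add: negligible_hyperplane)
qed

text \<open>A convex combination reaches the bound of a supporting half-space only if all its weight
  sits on points that reach it: the terms \<open>u x * (b - a \<bullet> x)\<close> are nonnegative
  and sum to zero.\<close>

lemma convex_hull_face:
  fixes P :: "'a :: real_inner set"
  assumes "finite P" and le: "\<And>x. x \<in> P \<Longrightarrow> a \<bullet> x \<le> b"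
    and "q \<in> convex hull P" "a \<bullet> q = b"
  shows "q \<in> convex hull {x \<in> P. a \<bullet> x = b}"
proof -
  obtain u where u: "\<And>x. x \<in> P \<Longrightarrow> 0 \<le> u x" "sum u P = 1" "(\<Sum>x\<in>P. u x *\<^sub>R x) = q"
    using assms(1,3) by (auto simp: convex_hull_finite)
  have "(\<Sum>x\<in>P. u x * (b - a \<bullet> x)) = b * sum u P - a \<bullet> (\<Sum>x\<in>P. u x *\<^sub>R x)"
    by (simp add: algebra_simps sum_subtractf sum_distrib_left inner_sum_right)
  also have "\<dots> = 0" using u assms by simp
  finally have "\<forall>x\<in>P. u x * (b - a \<bullet> x) = 0"
    using assms u by (subst (asm) sum_nonneg_eq_0_iff) auto
  hence z: "u x = 0" if "x \<in> P - {x \<in> P. a \<bullet> x = b}" for x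
    using that by auto
  have "sum u {x \<in> P. a \<bullet> x = b} = sum u P"
    using assms z by (intro sum.mono_neutral_left) auto
  moreover have "(\<Sum>x\<in>{x \<in> P. a \<bullet> x = b}. u x *\<^sub>R x) = (\<Sum>x\<in>P. u x *\<^sub>R x)"
    using assms z by (intro sum.mono_neutral_left) auto
  ultimately show ?thesis
    using assms(1) u by (subst convex_hull_finite) (auto intro!: exI[of _ u])
qed

lemma convex_hull_0_insert:
  "p \<in> convex hull {0, v, w} \<longleftrightarrow> (\<exists>a b. 0 \<le> a \<and> 0 \<le> b \<and> a + b \<le> 1 \<and> p = a *\<^sub>R v + b *\<^sub>R w)"
  for p :: "'a :: real_vector"
proof -
  have "(\<exists>u va w'. 0 \<le> u \<and> 0 \<le> va \<and> 0 \<le> w' \<and> u + va + w' = 1 \<and> p = u *\<^sub>R 0 + va *\<^sub>R v + w' *\<^sub>R w) \<longleftrightarrow>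
        (\<exists>a b. 0 \<le> a \<and> 0 \<le> b \<and> a + b \<le> 1 \<and> p = a *\<^sub>R v + b *\<^sub>R w)" (is "?L \<longleftrightarrow> ?R")
  proof
    assume ?R
    then obtain a b where "0 \<le> a" "0 \<le> b" "a + b \<le> 1" "p = a *\<^sub>R v + b *\<^sub>R w" by blast
    thus ?L by (intro exI[of _ "1 - a - b"] exI[of _ a] exI[of _ b]) auto
  next
    assume ?L
    then obtain u a b where "0 \<le> u" "0 \<le> a" "0 \<le> b" "u + a + b = 1" "p = u *\<^sub>R 0 + a *\<^sub>R v + b *\<^sub>R w"
      by blast
    thus ?R by (intro exI[of _ a] exI[of _ b]) auto
  qed
  thus ?thesis unfolding convex_hull_3 by blast
qed

text \<open>Edges at the origin \<open>S 0\<close> span no area and are left out.\<close>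

definition hull_edges :: "nat \<Rightarrow> (nat \<Rightarrow> real ^ 2) \<Rightarrow> (nat \<times> nat) set" where
  "hull_edges n S = {(i, j). 1 \<le> i \<and> i < j \<and> j \<le> n \<and>
     (\<exists>u. u \<bullet> S i = 1 \<and> u \<bullet> S j = 1 \<and> (\<forall>l\<le>n. l \<noteq> i \<longrightarrow> l \<noteq> j \<longrightarrow> u \<bullet> S l < 1))}"

text \<open>The ray from the origin through \<open>p\<close> leaves the hull at a point
  \<open>q\<close>, and a supporting line at \<open>q\<close> carries exactly one edge. General
  position allows at most two samples on that line; the choice of \<open>p\<close> off all lines
  through the origin and a nonzero sample rules out that \<open>q\<close> is a vertex or that the
  line passes through the origin. Collinearity is only excluded for positive indices, since
  \<open>S n = S 0\<close> can happen.\<close>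

lemma exists_hull_edge:
  fixes S :: "nat \<Rightarrow> real ^ 2"
  assumes "S 0 = 0"
    and gen: "\<And>i j l. i < j \<Longrightarrow> j < l \<Longrightarrow> l \<le> n \<Longrightarrow> 0 < i \<Longrightarrow> cr (S j - S i) (S l - S i) \<noteq> 0"
    and p: "p \<in> convex hull (S ` {..n})" "p \<noteq> 0" "\<And>l. l \<le> n \<Longrightarrow> S l \<noteq> 0 \<Longrightarrow> cr p (S l) \<noteq> 0"
  shows "\<exists>(i, j) \<in> hull_edges n S. p \<in> convex hull {0, S i, S j}"
proof -
  define K where "K = convex hull (S ` {..n})"
  have comp: "compact K" and conv: "convex K"
    unfolding K_def by (auto intro!: finite_imp_compact_convex_hull)
  have inK: "S l \<in> K" if "l \<le> n" for l
    unfolding K_def using that by (intro hull_inc) auto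
  have "0 \<in> K" using inK[of 0] assms(1) by simp
  \<comment> \<open>Parameters at which the ray is inside the hull; the largest one marks the exit
    point.\<close>
  define C where "C = (\<lambda>t. t *\<^sub>R p) -` K"
  have "closed C" unfolding C_def
    using compact_imp_closed[OF comp] by (intro closed_vimage continuous_intros)
  moreover have "bounded C"
  proof -
    obtain B where B: "\<And>x. x \<in> K \<Longrightarrow> norm x \<le> B"
      using compact_imp_bounded[OF comp] by (auto simp: bounded_iff)
    have "norm t \<le> B / norm p" if "t \<in> C" for t
      using that B[of "t *\<^sub>R p"] p(2) by (auto simp: C_def field_simps)
    thus ?thesis by (auto simp: bounded_iff)
  qed
  ultimately have "compact C" by (simp add: compact_eq_bounded_closed)
  moreover have "1 \<in> C" using p by (simp add: C_def K_def)
  ultimately obtain t where t: "t \<in> C" "\<And>t'. t' \<in> C \<Longrightarrow> t' \<le> t"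
    using compact_attains_sup[of C] by blast
  have t1: "t \<ge> 1" using t \<open>1 \<in> C\<close> by auto
  define q where "q = t *\<^sub>R p"
  have qK: "q \<in> K" using t by (simp add: q_def C_def)
  have q0: "q \<noteq> 0" using p t1 by (simp add: q_def)
  \<comment> \<open>Separating the hull from the part of the ray beyond \<open>q\<close> gives a
    supporting line. It contains \<open>q\<close>, which is a limit of points from that
    part.\<close>
  have "convex ((\<lambda>t. t *\<^sub>R p) ` {t<..})"
    by (intro convex_linear_image) (auto intro!: linearI simp: algebra_simps)
  moreover have "K \<inter> (\<lambda>t. t *\<^sub>R p) ` {t<..} = {}"
    using t(2) by (force simp: C_def)
  ultimately obtain a b where ab: "a \<noteq> 0" "\<forall>x\<in>K. a \<bullet> x \<le> b" "\<forall>x\<in>(\<lambda>t. t *\<^sub>R p) ` {t<..}. b \<le> a \<bullet> x"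
    using separating_hyperplane_sets[of K "(\<lambda>t. t *\<^sub>R p) ` {t<..}"] conv \<open>0 \<in> K\<close>
    by (metis emptyE gt_ex greaterThan_iff image_is_empty)
  have "b \<le> a \<bullet> q"
  proof (rule tendsto_lowerbound)
    show "((\<lambda>t. a \<bullet> (t *\<^sub>R p)) \<longlongrightarrow> a \<bullet> q) (at_right t)"
      unfolding q_def by (intro tendsto_intros)
    show "\<forall>\<^sub>F x in at_right t. b \<le> a \<bullet> x *\<^sub>R p"
      using ab(3) by (auto simp: eventually_at_filter intro!: always_eventually)
  qed auto
  hence aq: "a \<bullet> q = b" using ab(2) qK by force
  have face: "q \<in> convex hull {x \<in> S ` {..n}. a \<bullet> x = b}"
    using ab(2) inK aq qK by (intro convex_hull_face) (auto simp: K_def)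
  \<comment> \<open>The origin may lie on the boundary of the hull, so \<open>b = 0\<close> needs an
    argument: the supporting line would run through the origin and \<open>p\<close>, and it would
    hold a nonzero sample parallel to \<open>p\<close>.\<close>
  have "b \<noteq> 0"
  proof
    assume "b = 0"
    have "\<exists>l\<le>n. a \<bullet> S l = 0 \<and> S l \<noteq> 0"
    proof (rule ccontr)
      assume "\<not> ?thesis"
      hence "{x \<in> S ` {..n}. a \<bullet> x = b} \<subseteq> {0}" using \<open>b = 0\<close> by auto
      hence "q \<in> convex hull {0}" using face hull_mono by blast
      thus False using q0 by simp
    qed
    then obtain l where l: "l \<le> n" "a \<bullet> S l = 0" "S l \<noteq> 0" by blast
    have "a \<bullet> p = 0" using aq t1 \<open>b = 0\<close> by (simp add: q_def)
    thus False using orthogonal_imp_cr_eq_0[of a p "S l"] p(3) l ab(1) by blast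
  qed
  moreover have "b \<ge> 0" using ab(2) \<open>0 \<in> K\<close> by force
  ultimately have "b > 0" by simp
  define F where "F = {l. l \<le> n \<and> a \<bullet> S l = b}"
  have face': "q \<in> convex hull (S ` F)"
  proof -
    have "{x \<in> S ` {..n}. a \<bullet> x = b} = S ` F" by (auto simp: F_def)
    thus ?thesis using face by simp
  qed
  have "finite F" by (simp add: F_def)
  have "F \<noteq> {}" using face' by auto
  have "0 \<notin> F" using assms(1) \<open>b > 0\<close> by (simp add: F_def)
  define i where "i = Min F"
  define j where "j = Max F"
  have ij: "i \<in> F" "j \<in> F" using \<open>finite F\<close> \<open>F \<noteq> {}\<close> by (auto simp: i_def j_def)
  have between: "i \<le> l" "l \<le> j" if "l \<in> F" for l
    using \<open>finite F\<close> that by (auto simp: i_def j_def)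
  \<comment> \<open>A third sample on the line, with index strictly between the smallest and the
    largest, would violate general position; index 0 is absent because the line misses the
    origin.\<close>
  have F2: "F = {i, j}"
  proof -
    have False if "l \<in> F" "l \<noteq> i" "l \<noteq> j" for l
    proof -
      have "i < l" "l < j" using that between[of l] by auto
      moreover have "cr (S l - S i) (S j - S i) = 0"
        using that ij ab(1) by (intro orthogonal_imp_cr_eq_0[of a]) (auto simp: F_def inner_diff_right)
      moreover have "0 < i" "j \<le> n" using ij \<open>0 \<notin> F\<close> by (auto simp: F_def intro!: Nat.gr0I)
      ultimately show False using gen[of i l j] by auto
    qed
    thus ?thesis using ij by auto
  qed
  have "i \<noteq> j"
  proof
    assume "i = j"
    hence "q = S i" using face' F2 by simp
    moreover have "cr q (S i) \<noteq> 0"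
    proof -
      have "S i \<noteq> 0" "i \<le> n" using ij \<open>b > 0\<close> by (auto simp: F_def)
      thus ?thesis using p(3)[of i] t1 by (simp add: q_def cr_scaleR_left)
    qed
    ultimately show False by simp
  qed
  hence "i < j" using between[of i] ij by (simp add: le_less between)
  have edge: "(i, j) \<in> hull_edges n S"
  proof -
    have "a \<bullet> S l < b" if "l \<le> n" "l \<noteq> i" "l \<noteq> j" for l
      using that F2 ab(2) inK[of l] by (auto simp: F_def order_less_le)
    hence "\<exists>u. u \<bullet> S i = 1 \<and> u \<bullet> S j = 1 \<and> (\<forall>l\<le>n. l \<noteq> i \<longrightarrow> l \<noteq> j \<longrightarrow> u \<bullet> S l < 1)"
      using ij \<open>b > 0\<close> by (intro exI[of _ "(1 / b) *\<^sub>R a"]) (auto simp: F_def)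
    moreover have "1 \<le> i" using ij \<open>0 \<notin> F\<close> by (cases i) auto
    ultimately show ?thesis using ij \<open>i < j\<close> by (auto simp: hull_edges_def F_def)
  qed
  have "p \<in> convex hull {0, S i, S j}"
  proof -
    have "q \<in> convex hull {S i, S j}" using face' F2 by simp
    then obtain u v where uv: "0 \<le> u" "0 \<le> v" "u + v = 1" "q = u *\<^sub>R S i + v *\<^sub>R S j"
      by (auto simp: convex_hull_2)
    \<comment> \<open>Since \<open>1 \<le> t\<close>, the weight \<open>1 - 1 / t\<close> is left
      for the origin.\<close>
    have "p = (1 / t) *\<^sub>R q" using t1 by (simp add: q_def)
    hence "p = (u / t) *\<^sub>R S i + (v / t) *\<^sub>R S j" using uv by (simp add: algebra_simps)
    moreover have "u / t + v / t \<le> 1" using uv t1 by (simp add: add_divide_distrib[symmetric])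
    ultimately show ?thesis using uv t1 unfolding convex_hull_0_insert
      by (intro exI[of _ "u / t"] exI[of _ "v / t"]) auto
  qed
  thus ?thesis using edge by blast
qed

text \<open>The functional \<open>u\<close> of one edge is 1 at its ends and smaller at all other
  samples. Evaluated at \<open>p\<close>, it shows that the coefficients of \<open>p\<close> over
  this edge have a strictly smaller sum than those over any other edge containing \<open>p\<close>
  in its triangle; exchanging the two edges yields a contradiction.\<close>

lemma hull_edge_unique:
  fixes S :: "nat \<Rightarrow> real ^ 2"
  assumes e: "(i, j) \<in> hull_edges n S" "(k, l) \<in> hull_edges n S"
    and p: "p \<in> convex hull {0, S i, S j}" "p \<in> convex hull {0, S k, S l}"
    and p0: "p \<noteq> 0" "\<And>l. l \<le> n \<Longrightarrow> S l \<noteq> 0 \<Longrightarrow> cr p (S l) \<noteq> 0"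
  shows "(i, j) = (k, l)"
proof -
  have aux: "a + b < c + d \<or> {i, j} = {k, l}"
    if e: "(i, j) \<in> hull_edges n S" "(k, l) \<in> hull_edges n S"
      and "p = a *\<^sub>R S i + b *\<^sub>R S j" "p = c *\<^sub>R S k + d *\<^sub>R S l" "0 < c" "0 < d"
    for i j k l a b c d
  proof -
    obtain u where u: "u \<bullet> S i = 1" "u \<bullet> S j = 1" "\<And>l. l \<le> n \<Longrightarrow> l \<noteq> i \<Longrightarrow> l \<noteq> j \<Longrightarrow> u \<bullet> S l < 1"
      using e unfolding hull_edges_def by blast
    have kl: "k \<le> n" "l \<le> n" "k \<noteq> l" "i \<noteq> j" using e by (auto simp: hull_edges_def)
    have le: "u \<bullet> S m \<le> 1" if "m \<le> n" for m using u that by (metis less_eq_real_def order_refl)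
    have "a + b = u \<bullet> p" using that(3) u by (simp add: inner_add_right)
    also have "\<dots> = c * (u \<bullet> S k) + d * (u \<bullet> S l)" using that(4) by (simp add: inner_add_right)
    finally have eq: "a + b = c * (u \<bullet> S k) + d * (u \<bullet> S l)" .
    have 1: "c * (u \<bullet> S k) \<le> c" "d * (u \<bullet> S l) \<le> d"
      using le kl that by (auto simp: mult_left_le)
    show ?thesis
    proof (cases "k \<in> {i, j} \<and> l \<in> {i, j}")
      case True thus ?thesis using kl by auto
    next
      case False
      hence "c * (u \<bullet> S k) < c \<or> d * (u \<bullet> S l) < d"
        using u(3)[of k] u(3)[of l] kl that(5,6) by auto
      thus ?thesis using 1 eq by linarith
    qed
  qed
  \<comment> \<open>Neither coefficient vanishes because \<open>p\<close> is parallel to no nonzero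
    sample.\<close>
  have pos: "\<exists>a b. 0 < a \<and> 0 < b \<and> p = a *\<^sub>R S i + b *\<^sub>R S j"
    if e: "(i, j) \<in> hull_edges n S" and p: "p \<in> convex hull {0, S i, S j}" for i j
  proof -
    obtain a b where ab: "0 \<le> a" "0 \<le> b" "p = a *\<^sub>R S i + b *\<^sub>R S j"
      using p unfolding convex_hull_0_insert by blast
    have ijn: "i \<le> n" "j \<le> n" using e by (auto simp: hull_edges_def)
    have nz: "S i \<noteq> 0" "S j \<noteq> 0" using e by (auto simp: hull_edges_def)
    have "a \<noteq> 0" using p0(2)[OF ijn(2)] nz ab by (auto simp: cr_scaleR_left)
    moreover have "b \<noteq> 0" using p0(2)[OF ijn(1)] nz ab by (auto simp: cr_scaleR_left)
    ultimately show ?thesis using ab by (intro exI[of _ a] exI[of _ b]) auto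
  qed
  obtain a b where ab: "0 < a" "0 < b" "p = a *\<^sub>R S i + b *\<^sub>R S j" using pos[OF e(1) p(1)] by blast
  obtain c d where cd: "0 < c" "0 < d" "p = c *\<^sub>R S k + d *\<^sub>R S l" using pos[OF e(2) p(2)] by blast
  have "{i, j} = {k, l}"
    using aux[OF e ab(3) cd(3) cd(1,2)] aux[OF e(2,1) cd(3) ab(3) ab(1,2)] by auto
  moreover have "i < j" "k < l" using e by (auto simp: hull_edges_def)
  ultimately show ?thesis by (auto simp: doubleton_eq_iff)
qed

text \<open>Off the null set \<open>N\<close>, made of the origin and the lines through it and a
  nonzero sample, every point of the hull lies in exactly one of the triangles.\<close>

theorem measure_convex_hull_eq_sum_edges:
  fixes S :: "nat \<Rightarrow> real ^ 2"
  assumes "S 0 = 0"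
    and gen: "\<And>i j l. i < j \<Longrightarrow> j < l \<Longrightarrow> l \<le> n \<Longrightarrow> 0 < i \<Longrightarrow> cr (S j - S i) (S l - S i) \<noteq> 0"
  shows "measure lebesgue (convex hull (S ` {..n})) = (\<Sum>(i, j) \<in> hull_edges n S. \<bar>cr (S i) (S j)\<bar> / 2)"
proof -
  define N where "N = insert 0 (\<Union>l\<in>{l. l \<le> n \<and> S l \<noteq> 0}. {p. cr p (S l) = 0})"
  define T where "T = (\<lambda>(i, j). convex hull {0, S i, S j})"
  let ?K = "convex hull (S ` {..n})"
  have "negligible N"
    unfolding N_def by (auto intro!: negligible_Union negligible_cr_eq_0 simp: negligible_insert)
  have finE: "finite (hull_edges n S)"
    by (rule finite_subset[of _ "{..n} \<times> {..n}"]) (auto simp: hull_edges_def)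
  have TK: "T e \<subseteq> ?K" if "e \<in> hull_edges n S" for e
    unfolding T_def using that assms(1)
    by (auto simp: hull_edges_def intro!: hull_mono)
  have KT: "?K \<subseteq> (\<Union>e\<in>hull_edges n S. T e) \<union> N"
  proof
    fix p assume "p \<in> ?K"
    show "p \<in> (\<Union>e\<in>hull_edges n S. T e) \<union> N"
    proof (cases "p \<in> N")
      case False
      hence "\<exists>(i, j) \<in> hull_edges n S. p \<in> convex hull {0, S i, S j}"
        using assms \<open>p \<in> ?K\<close> by (intro exists_hull_edge) (auto simp: N_def)
      thus ?thesis by (auto simp: T_def)
    qed auto
  qed
  have Tm: "T e \<in> lmeasurable" for e
    unfolding T_def by (auto split: prod.splits intro!: lmeasurable_compact finite_imp_compact_convex_hull)
  have "measure lebesgue ?K = measure lebesgue (\<Union>e\<in>hull_edges n S. T e)"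
  proof (rule measure_negligible_symdiff[symmetric])
    show "?K \<in> lmeasurable"
      by (auto intro!: lmeasurable_compact finite_imp_compact_convex_hull)
    show "negligible (?K - (\<Union>e\<in>hull_edges n S. T e) \<union> ((\<Union>e\<in>hull_edges n S. T e) - ?K))"
      by (rule negligible_subset[OF \<open>negligible N\<close>]) (use TK KT in auto)
  qed
  also have "\<dots> = (\<Sum>e\<in>hull_edges n S. measure lebesgue (T e))"
  proof (rule measure_negligible_finite_Union_image[OF finE])
    show "pairwise (\<lambda>e e'. negligible (T e \<inter> T e')) (hull_edges n S)"
    proof (rule pairwiseI)
      fix e e' assume ee: "e \<in> hull_edges n S" "e' \<in> hull_edges n S" "e \<noteq> e'"
      have "T e \<inter> T e' \<subseteq> N"
      proof
        fix p assume p: "p \<in> T e \<inter> T e'"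
        obtain i j k l where [simp]: "e = (i, j)" "e' = (k, l)" by (cases e, cases e')
        show "p \<in> N"
        proof (rule ccontr)
          assume "p \<notin> N"
          hence "(i, j) = (k, l)" using ee p
            by (intro hull_edge_unique[of i j n S k l p]) (auto simp: T_def N_def)
          thus False using ee by simp
        qed
      qed
      thus "negligible (T e \<inter> T e')" using \<open>negligible N\<close> negligible_subset by blast
    qed
  qed (use Tm in auto)
  also have "\<dots> = (\<Sum>(i, j) \<in> hull_edges n S. \<bar>cr (S i) (S j)\<bar> / 2)"
  proof (intro sum.cong refl)
    fix e :: "nat \<times> nat"
    obtain i j where [simp]: "e = (i, j)" by (cases e)
    have "measure lebesgue (T e) = measure lborel (convex hull {0, S i, S j})"
      unfolding T_def by (auto intro!: measure_completion finite_imp_compact_convex_hull borel_compact)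
    also have "\<dots> = \<bar>cr (S i) (S j)\<bar> / 2"
      unfolding content_triangle cr_def by (simp add: algebra_simps abs_minus_commute)
    finally show "measure lebesgue (T e) = (case e of (i, j) \<Rightarrow> \<bar>cr (S i) (S j)\<bar> / 2)" by simp
  qed
  finally show ?thesis .
qed

section \<open>Maxima and cyclic shifts\<close>

text \<open>The empty partial sum at \<open>l = 0\<close> takes part, so the maximum is never
  negative.\<close>

definition pmax :: "(nat \<Rightarrow> real) \<Rightarrow> nat \<Rightarrow> real" where
  "pmax a m = Max ((\<lambda>l. sum a {..<l}) ` {..m})"

text \<open>The rise of the running maximum at step \<open>q\<close>, zero unless a new record is
  set.\<close>

definition rec_inc :: "(nat \<Rightarrow> real) \<Rightarrow> nat \<Rightarrow> real" where
  "rec_inc a q = max 0 (sum a {..<q} - pmax a (q - 1))"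

lemma pmax_0 [simp]: "pmax a 0 = 0"
  by (simp add: pmax_def)

lemma pmax_Suc: "pmax a (Suc q) = pmax a q + rec_inc a (Suc q)"
proof -
  have "pmax a (Suc q) = max (sum a {..<Suc q}) (pmax a q)"
    unfolding pmax_def by (subst atMost_Suc, subst image_insert, subst Max_insert) auto
  thus ?thesis by (simp add: rec_inc_def max_def)
qed

lemma pmax_eq_sum_rec_inc: "pmax a m = (\<Sum>q=1..m. rec_inc a q)"
  by (induction m) (auto simp: pmax_Suc)

lemma rec_inc_nonneg [simp]: "0 \<le> rec_inc a q"
  by (simp add: rec_inc_def)

lemma rec_inc_cong:
  assumes "\<And>i. i < q \<Longrightarrow> a i = b i"
  shows "rec_inc a q = rec_inc b q"
proof -
  have "sum a {..<l} = sum b {..<l}" if "l \<le> q" for l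
    using that assms by (intro sum.cong) auto
  hence "(\<lambda>l. sum a {..<l}) ` {..q-1} = (\<lambda>l. sum b {..<l}) ` {..q-1}" "sum a {..<q} = sum b {..<q}"
    by (auto intro!: image_cong)
  thus ?thesis by (simp add: rec_inc_def pmax_def)
qed

lemma pmax_cong:
  assumes "\<And>i. i < m \<Longrightarrow> a i = b i"
  shows "pmax a m = pmax b m"
  unfolding pmax_eq_sum_rec_inc using assms by (intro sum.cong rec_inc_cong) auto

text \<open>A shift by the period \<open>q\<close> does not decrease \<open>T\<close>, so every
  earlier value is dominated by one in the last window of length \<open>q\<close>.\<close>

lemma Max_initial_eq_Max_window:
  fixes T :: "nat \<Rightarrow> real"
  assumes "q > 0" and mono: "\<And>k. T k \<le> T (k + q)"
  shows "Max (T ` {..<r + q}) = Max (T ` {r..<r + q})"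
proof (rule antisym)
  have "\<exists>k\<in>{r..<r+q}. T j \<le> T k" if "j < r + q" for j
    using that
  proof (induction "r - j" arbitrary: j rule: less_induct)
    case less
    show ?case
    proof (cases "r \<le> j")
      case True thus ?thesis using less.prems by auto
    next
      case False
      hence "\<exists>k\<in>{r..<r+q}. T (j + q) \<le> T k"
        using \<open>q > 0\<close> by (intro less.hyps) auto
      thus ?thesis using mono[of j] order_trans by blast
    qed
  qed
  hence "\<exists>k\<in>T ` {r..<r+q}. x \<le> k" if "x \<in> T ` {..<r + q}" for x
    using that by auto
  thus "Max (T ` {..<r + q}) \<le> Max (T ` {r..<r + q})"
    using \<open>q > 0\<close> by (intro Max.boundedI) (auto simp: Max_ge_iff)
  show "Max (T ` {r..<r + q}) \<le> Max (T ` {..<r + q})"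
    using \<open>q > 0\<close> by (intro Max_mono) auto
qed

text \<open>Spitzer's cyclic argument in its deterministic form. Along the periodic continuation
  \<open>T\<close> of the walk, and for a nonnegative total \<open>S\<close>, the record increment
  of the shift by \<open>r\<close> is the growth of the maximum over an initial segment when the
  time \<open>r + q\<close> is added. These growths telescope over one period, in which the maximum
  rises by \<open>S\<close>. If \<open>S\<close> is negative, every shift ends below its start and
  sets no record.\<close>

lemma sum_rec_inc_cyclic_shifts:
  assumes "q > 0"
  shows "(\<Sum>r<q. rec_inc (\<lambda>i. a ((i + r) mod q)) q) = max 0 (sum a {..<q})"
proof -
  define T where "T k = (\<Sum>i<k. a (i mod q))" for k
  define S where "S = sum a {..<q}"
  have shift: "(\<Sum>i<l. a ((i + r) mod q)) = T (r + l) - T r" for r l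
    unfolding T_def by (induction l) (auto simp: add.commute)
  have Tq: "T q = S" unfolding T_def S_def by (intro sum.cong) auto
  have per: "T (k + q) = T k + S" for k
  proof (induction k)
    case 0 show ?case using Tq by (simp add: T_def)
  next
    case (Suc k) thus ?case by (simp add: T_def)
  qed
  have R: "rec_inc (\<lambda>i. a ((i + r) mod q)) q = max 0 (T (r + q) - Max (T ` {r..<r+q}))" for r
  proof -
    have "pmax (\<lambda>i. a ((i + r) mod q)) (q - 1) = Max ((\<lambda>l. T (r + l) - T r) ` {..q-1})"
      unfolding pmax_def shift ..
    also have "\<dots> = Max ((\<lambda>x. x - T r) ` (T ` {r..<r+q}))"
    proof -
      have "(\<lambda>l. T (r + l) - T r) ` {..q-1} = (\<lambda>x. x - T r) ` T ` ((+) r ` {..<q})"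
        using assms by (auto simp: image_image)
      also have "(+) r ` {..<q} = {r..<r+q}"
        by (simp add: lessThan_atLeast0 add.commute)
      finally show ?thesis by simp
    qed
    also have "\<dots> = Max (T ` {r..<r+q}) - T r"
      using assms mono_Max_commute[of "\<lambda>x. x - T r" "T ` {r..<r+q}"] by (simp add: mono_def)
    finally show ?thesis unfolding rec_inc_def shift by simp
  qed
  show ?thesis
  proof (cases "S \<ge> 0")
    case False
    have "T (r + q) - Max (T ` {r..<r+q}) \<le> 0" for r
    proof -
      have "T r \<le> Max (T ` {r..<r+q})" using assms by (intro Max_ge) auto
      thus ?thesis using per[of r] False by simp
    qed
    hence "max 0 (T (r + q) - Max (T ` {r..<r+q})) = 0" for r
      using max_absorb1 by blast
    thus ?thesis unfolding R using False by (simp add: S_def)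
  next
    case True
    \<comment> \<open>The maximum over all times before \<open>k + q\<close>; as a shift by the
      period does not lower \<open>T\<close>, it equals the maximum over the window that the shift
      by \<open>k\<close> sees.\<close>
    define m where "m k = Max (T ` {..<k + q})" for k
    have W: "Max (T ` {r..<r+q}) = m r" for r
      unfolding m_def using assms per True by (intro Max_initial_eq_Max_window[symmetric]) auto
    have "m (Suc r) = max (T (r + q)) (m r)" for r
      unfolding m_def using assms
      by (subst add_Suc, subst lessThan_Suc, subst image_insert, subst Max_insert) (auto simp: lessThan_empty_iff)
    hence "(\<Sum>r<q. rec_inc (\<lambda>i. a ((i + r) mod q)) q) = (\<Sum>r<q. m (Suc r) - m r)"
      unfolding R W by (intro sum.cong) (auto simp: max_def)
    also have "\<dots> = m q - m 0" by (rule sum_lessThan_telescope)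
    also have "m q = Max ((\<lambda>x. x + S) ` T ` {0..<q})"
    proof -
      have "T ` {q..<q+q} = T ` ((\<lambda>k. k + q) ` {0..<q})" by simp
      also have "\<dots> = (\<lambda>x. x + S) ` T ` {0..<q}" by (simp only: image_image per)
      finally show ?thesis by (simp add: W[symmetric])
    qed
    also have "\<dots> = m 0 + S"
      using assms mono_Max_commute[of "\<lambda>x. x + S" "T ` {0..<q}"] by (simp add: W[of 0, symmetric] mono_def)
    finally show ?thesis using True by (simp add: S_def)
  qed
qed

section \<open>Increments in general position and oriented edges\<close>

lemma cr_sum_left: "cr (sum f A) c = (\<Sum>i\<in>A. cr (f i) c)"
  by (induction A rule: infinite_finite_induct) (auto simp: cr_add_left)

text \<open>The case \<open>I \<union> J = {..<n}\<close> is left out because it degenerates for \<open>\<sigma> = 0\<close>: the walk is then closed.\<close>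

definition generic :: "nat \<Rightarrow> (nat \<Rightarrow> real ^ 2) \<Rightarrow> bool" where
  "generic n x \<longleftrightarrow> (\<forall>I J. I \<subseteq> {..<n} \<longrightarrow> J \<subseteq> {..<n} \<longrightarrow> I \<inter> J = {} \<longrightarrow> I \<noteq> {} \<longrightarrow> J \<noteq> {} \<longrightarrow>
     I \<union> J \<noteq> {..<n} \<longrightarrow> cr (sum x I) (sum x J) \<noteq> 0)"

lemma genericD:
  "generic n x \<Longrightarrow> I \<subseteq> {..<n} \<Longrightarrow> J \<subseteq> {..<n} \<Longrightarrow> I \<inter> J = {} \<Longrightarrow> I \<noteq> {} \<Longrightarrow> J \<noteq> {} \<Longrightarrow>
     I \<union> J \<noteq> {..<n} \<Longrightarrow> cr (sum x I) (sum x J) \<noteq> 0"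
  by (auto simp: generic_def)

lemma sum_lessThan_diff:
  fixes x :: "nat \<Rightarrow> 'a :: ab_group_add"
  assumes "i \<le> j"
  shows "sum x {..<j} - sum x {..<i} = sum x {i..<j}"
proof -
  have "{..<j} = {..<i} \<union> {i..<j}" using assms by auto
  hence "sum x {..<j} = sum x {..<i} + sum x {i..<j}"
    by (simp add: sum.union_disjoint ivl_disj_int)
  thus ?thesis by simp
qed

lemma generic_not_collinear:
  assumes "generic n x" "i < j" "j < l" "l \<le> n" "0 < i"
  shows "cr (sum x {..<j} - sum x {..<i}) (sum x {..<l} - sum x {..<i}) \<noteq> 0"
proof -
  have "sum x {..<l} - sum x {..<i} = sum x {i..<j} + sum x {j..<l}"
    using assms by (simp add: sum_lessThan_diff sum.atLeastLessThan_concat)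
  hence "cr (sum x {..<j} - sum x {..<i}) (sum x {..<l} - sum x {..<i}) = cr (sum x {i..<j}) (sum x {j..<l})"
    using assms by (simp add: sum_lessThan_diff cr_add_right)
  moreover have "cr (sum x {i..<j}) (sum x {j..<l}) \<noteq> 0"
  proof (rule genericD[OF assms(1)])
    \<comment> \<open>Step 0 is in neither block because \<open>0 < i\<close>, so the two blocks do
      not exhaust the walk.\<close>
    have "0 \<notin> {i..<j} \<union> {j..<l}" "0 \<in> {..<n}" using assms by auto
    thus "{i..<j} \<union> {j..<l} \<noteq> {..<n}" by blast
  qed (use assms in auto)
  ultimately show ?thesis by simp
qed

text \<open>A vanishing sum would split into two opposite, hence parallel, partial sums, against
  genericity. A single vanishing increment is paired with an increment outside \<open>I\<close>;
  \<open>3 \<le> n\<close> keeps this pair from being the whole walk. The lemma ensures that every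
  edge has a direction.\<close>

lemma generic_sum_neq_0:
  assumes gen: "generic n x" and I: "I \<subset> {..<n}" "I \<noteq> {}" and "3 \<le> n"
  shows "sum x I \<noteq> 0"
proof
  assume 0: "sum x I = 0"
  have "finite I" using I finite_subset by blast
  obtain i where i: "i \<in> I" using I by blast
  show False
  proof (cases "I = {i}")
    case True
    obtain j where j: "j < n" "j \<notin> I" using I by blast
    have C: "card ({i} \<union> {j}) \<noteq> card {..<n}" using \<open>3 \<le> n\<close> by (simp add: card_insert_if)
    have "{i} \<union> {j} \<noteq> {..<n}"
    proof
      assume "{i} \<union> {j} = {..<n}"
      with C show False by (simp only:)
    qed
    hence "cr (sum x {i}) (sum x {j}) \<noteq> 0"
      using i I(1) j by (intro genericD[OF gen]) auto
    thus False using 0 True by simp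
  next
    case False
    have "sum x I = x i + sum x (I - {i})"
      by (rule sum.remove[OF \<open>finite I\<close> i])
    hence "sum x (I - {i}) = (-1) *\<^sub>R sum x {i}" using 0 by (simp add: add_eq_0_iff)
    hence "cr (sum x {i}) (sum x (I - {i})) = 0"
      by (simp only: cr_scaleR_right cr_self mult_zero_right)
    moreover have "cr (sum x {i}) (sum x (I - {i})) \<noteq> 0"
    proof (rule genericD[OF gen])
      have "{i} \<union> (I - {i}) = I" using i by auto
      thus "{i} \<union> (I - {i}) \<noteq> {..<n}" using I(1) by simp
      show "{i} \<subseteq> {..<n}" "I - {i} \<subseteq> {..<n}" using i I(1) by auto
      show "I - {i} \<noteq> {}" using False i by auto
    qed auto
    ultimately show False by contradiction
  qed
qed

text \<open>The sign \<open>s\<close> names the side of the edge on which the walk lies. For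
  \<open>1 \<le> i\<close> and \<open>i < j\<close> the condition at \<open>l = 0\<close> concerns
  the origin and makes \<open>s\<close> times the determinant positive, so the triangle area appears
  without an absolute value.\<close>

definition edge_area :: "nat \<Rightarrow> nat \<Rightarrow> nat \<Rightarrow> real \<Rightarrow> (nat \<Rightarrow> real ^ 2) \<Rightarrow> real" where
  "edge_area n i j s x =
    (if \<forall>l\<le>n. l \<noteq> i \<longrightarrow> l \<noteq> j \<longrightarrow> s * cr (sum x {..<l} - sum x {..<i}) (sum x {i..<j}) < 0
     then s * cr (sum x {..<i}) (sum x {i..<j}) / 2 else 0)"

text \<open>An edge functional \<open>u\<close> is a multiple of the normal to the edge, and the
  sign of the factor is \<open>s\<close>. Conversely the normal, divided by twice the triangle area,
  is such a functional. Both signs cannot occur at once, since each forces its own sign on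
  \<open>cr (S i) (S j)\<close>.\<close>

lemma sum_hull_edges_eq_edge_area:
  assumes gen: "generic n x" and n: "n \<ge> 3"
  shows "(\<Sum>(i, j) \<in> hull_edges n (\<lambda>l. sum x {..<l}). \<bar>cr (sum x {..<i}) (sum x {..<j})\<bar> / 2) =
    (\<Sum>s\<in>{1,-1}. \<Sum>i=1..n. \<Sum>j=i+1..n. edge_area n i j s x)"
proof -
  define S where "S l = sum x {..<l}" for l
  let ?H = "hull_edges n S"
  let ?P = "SIGMA i:{1..n}. {i+1..n}"
  define cond where "cond s i j \<longleftrightarrow> (\<forall>l\<le>n. l \<noteq> i \<longrightarrow> l \<noteq> j \<longrightarrow> s * cr (S l - S i) (S j - S i) < 0)" for s i j
  have S0: "S 0 = 0" by (simp add: S_def)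
  have ea: "edge_area n i j s x = (if cond s i j then s * cr (S i) (S j) / 2 else 0)" if "i < j" for i j s
  proof -
    have "sum x {i..<j} = S j - S i" using that by (simp add: S_def sum_lessThan_diff)
    moreover have "cr (S i) (S j - S i) = cr (S i) (S j)" by (simp add: cr_diff_right)
    ultimately show ?thesis unfolding edge_area_def cond_def by (auto simp: S_def[symmetric])
  qed
  have eq: "(if (i, j) \<in> ?H then \<bar>cr (S i) (S j)\<bar> / 2 else 0) = (\<Sum>s\<in>{1,-1}. edge_area n i j s x)"
    if ij: "1 \<le> i" "i < j" "j \<le> n" for i j
  proof -
    define d where "d = S j - S i"
    have d0: "d \<noteq> 0"
      using ij n unfolding d_def S_def sum_lessThan_diff[OF less_imp_le[OF ij(2)]]
    proof (intro generic_sum_neq_0[OF gen])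
      have "0 \<notin> {i..<j}" "0 \<in> {..<n}" "{i..<j} \<subseteq> {..<n}" using ij by auto
      thus "{i..<j} \<subset> {..<n}" by blast
    qed (use ij n in auto)
    have pos: "s * cr (S i) (S j) > 0" if "cond s i j" for s
    proof -
      have "s * cr (S 0 - S i) (S j - S i) < 0" using that ij by (auto simp: cond_def)
      thus ?thesis unfolding S0 cr_diff_left cr_diff_right by simp
    qed
    have "(i, j) \<in> ?H \<longleftrightarrow> cond 1 i j \<or> cond (-1) i j"
    proof
      assume "(i, j) \<in> ?H"
      then obtain u where u: "u \<bullet> S i = 1" "u \<bullet> S j = 1" "\<And>l. l \<le> n \<Longrightarrow> l \<noteq> i \<Longrightarrow> l \<noteq> j \<Longrightarrow> u \<bullet> S l < 1"
        unfolding hull_edges_def by blast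
      have "u \<bullet> d = 0" using u by (simp add: d_def inner_diff_right)
      then obtain k where k: "\<And>v. u \<bullet> v = k * cr v d"
        using orthogonal_imp_inner_eq_cr d0 by blast
      have neg: "k * cr (S l - S i) d < 0" if "l \<le> n" "l \<noteq> i" "l \<noteq> j" for l
        using u(1) u(3)[OF that] unfolding k[symmetric] by (simp add: inner_diff_right)
      have "k \<noteq> 0" using k[of "S i"] u(1) by auto
      thus "cond 1 i j \<or> cond (-1) i j"
        using neg unfolding cond_def d_def by (cases "k > 0") (auto simp: mult_less_0_iff)
    next
      assume "cond 1 i j \<or> cond (-1) i j"
      then obtain s where s: "cond s i j" by blast
      define h where "h = s * cr (S i) (S j)"
      have h: "h > 0" using pos[OF s] by (simp add: h_def)
      define u :: "real ^ 2" where "u = (s / h) *\<^sub>R vector [d $ 2, - d $ 1]"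
      have u: "u \<bullet> v = s * cr v d / h" for v
        by (simp add: u_def inner_vec2 cr_def algebra_simps diff_divide_distrib)
      have "s * cr (S i) d = h" "s * cr (S j) d = h"
        by (simp_all add: d_def h_def cr_def algebra_simps)
      hence 1: "u \<bullet> S i = 1" and 2: "u \<bullet> S j = 1" using h by (simp_all add: u)
      have "u \<bullet> S l < 1" if "l \<le> n" "l \<noteq> i" "l \<noteq> j" for l
      proof -
        have "s * cr (S l - S i) d < 0" using that s by (auto simp: cond_def d_def)
        hence "u \<bullet> (S l - S i) < 0" unfolding u using h by (simp add: divide_neg_pos)
        thus ?thesis using 1 by (simp add: inner_diff_right)
      qed
      thus "(i, j) \<in> ?H" using 1 2 ij by (auto simp: hull_edges_def)
    qed
    thus ?thesis using pos[of 1] pos[of "-1"] ij by (auto simp: ea)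
  qed
  have "?H \<subseteq> ?P" by (auto simp: hull_edges_def)
  hence "(\<Sum>(i, j) \<in> ?H. \<bar>cr (S i) (S j)\<bar> / 2) = (\<Sum>(i, j) \<in> ?P. if (i, j) \<in> ?H then \<bar>cr (S i) (S j)\<bar> / 2 else 0)"
    by (intro sum.mono_neutral_cong_left) auto
  also have "\<dots> = (\<Sum>(i, j) \<in> ?P. \<Sum>s\<in>{1,-1}. edge_area n i j s x)"
    by (intro sum.cong refl) (use eq in auto)
  also have "\<dots> = (\<Sum>i=1..n. \<Sum>j=i+1..n. \<Sum>s\<in>{1,-1}. edge_area n i j s x)"
    by (rule sum.Sigma[symmetric]) auto
  also have "\<dots> = (\<Sum>s\<in>{1,-1}. \<Sum>i=1..n. \<Sum>j=i+1..n. edge_area n i j s x)"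
    by (simp add: sum.distrib)
  finally show ?thesis by (simp add: S_def[abs_def])
qed

section \<open>Moving the block of an edge to the end of the walk\<close>

lemma sum_pairs_by_difference:
  fixes f :: "nat \<Rightarrow> nat \<Rightarrow> 'a :: comm_monoid_add"
  shows "(\<Sum>i=1..n. \<Sum>j=i+1..n. f i j) = (\<Sum>k=1..<n. \<Sum>i=1..n-k. f i (i + k))"
proof -
  have "(\<Sum>i=1..n. \<Sum>j=i+1..n. f i j) = (\<Sum>(i, j)\<in>(SIGMA i:{1..n}. {i+1..n}). f i j)"
    by (rule sum.Sigma) auto
  also have "\<dots> = (\<Sum>(k, i)\<in>(SIGMA k:{1..<n}. {1..n-k}). f i (i + k))"
    by (rule sum.reindex_bij_witness[of _ "\<lambda>(k, i). (i, i + k)" "\<lambda>(i, j). (j - i, i)"]) auto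
  also have "\<dots> = (\<Sum>k=1..<n. \<Sum>i=1..n-k. f i (i + k))"
    by (rule sum.Sigma[symmetric]) auto
  finally show ?thesis .
qed

text \<open>The permutation that moves the block of positions \<open>{i..<i+k}\<close> to the end \<open>{m..<m+k}\<close>.\<close>

definition block_move :: "nat \<Rightarrow> nat \<Rightarrow> nat \<Rightarrow> nat \<Rightarrow> nat" where
  "block_move m k i l = (if l < i then l else if l < i + k then m + (l - i) else if l < m + k then l - k else l)"

lemma block_move_permutes:
  assumes "i \<le> m"
  shows "block_move m k i permutes {..<m+k}"
proof (rule bij_imp_permutes)
  show "bij_betw (block_move m k i) {..<m+k} {..<m+k}"
    by (rule bij_betwI[where g = "\<lambda>l. if l < i then l else if l < m then l + k else i + (l - m)"])
       (use assms in \<open>auto simp: block_move_def\<close>)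
qed (use assms in \<open>auto simp: block_move_def\<close>)

text \<open>Composing \<open>y\<close> with \<open>block_move\<close> inserts the steps
  \<open>{m..<m+k}\<close> of \<open>y\<close> at position \<open>i\<close>: the new walk follows
  \<open>y\<close> up to \<open>i\<close>, runs through the block, and then continues
  \<open>y\<close> from \<open>i\<close> to \<open>m\<close>.\<close>

lemma sum_block_move:
  fixes y :: "nat \<Rightarrow> 'a :: ab_group_add"
  assumes "i \<le> m"
  shows "l \<le> i \<Longrightarrow> sum (\<lambda>l. y (block_move m k i l)) {..<l} = sum y {..<l}"
    and "r \<le> k \<Longrightarrow> sum (\<lambda>l. y (block_move m k i l)) {i..<i+r} = sum y {m..<m+r}"
    and "i \<le> l \<Longrightarrow> l \<le> m \<Longrightarrow> sum (\<lambda>l. y (block_move m k i l)) {i+k..<l+k} = sum y {i..<l}"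
proof -
  show "l \<le> i \<Longrightarrow> sum (\<lambda>l. y (block_move m k i l)) {..<l} = sum y {..<l}"
    by (intro sum.cong) (auto simp: block_move_def)
  show "r \<le> k \<Longrightarrow> sum (\<lambda>l. y (block_move m k i l)) {i..<i+r} = sum y {m..<m+r}"
    by (rule sum.reindex_bij_witness[of _ "\<lambda>l. l - m + i" "\<lambda>l. l - i + m"]) (auto simp: block_move_def add.commute)
  show "i \<le> l \<Longrightarrow> l \<le> m \<Longrightarrow> sum (\<lambda>l. y (block_move m k i l)) {i+k..<l+k} = sum y {i..<l}"
    by (rule sum.reindex_bij_witness[of _ "\<lambda>l. l + k" "\<lambda>l. l - k"]) (auto simp: block_move_def)
qed

text \<open>A scalar walk of heights: the cross product with the sum of the final block is, up to
  scale, the component normal to the edge that this block forms, and \<open>s\<close> selects the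
  side.\<close>

definition proj :: "real \<Rightarrow> nat \<Rightarrow> nat \<Rightarrow> (nat \<Rightarrow> real ^ 2) \<Rightarrow> nat \<Rightarrow> real" where
  "proj s m k y i = s * cr (y i) (sum y {m..<m+k})"

text \<open>Both ends of the block are excluded, as they lie on the edge itself.\<close>

definition below :: "(nat \<Rightarrow> real) \<Rightarrow> nat \<Rightarrow> nat \<Rightarrow> bool" where
  "below a m k \<longleftrightarrow> (\<forall>r. 0 < r \<longrightarrow> r < k \<longrightarrow> sum a {m..<m+r} < 0)"

lemma sum_proj: "sum (proj s m k y) A = s * cr (sum y A) (sum y {m..<m+k})"
  by (simp add: proj_def cr_sum_left sum_distrib_left)

text \<open>The edge condition decouples. Points before the block and after it have the heights of
  the walk without the block, since the block as a whole has height zero; they require a strict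
  maximum at \<open>i\<close>. Points inside the block involve nothing but the block.\<close>

lemma edge_area_block_move:
  fixes y :: "nat \<Rightarrow> real ^ 2" and s :: real
  assumes i: "i \<le> m" and k: "0 < k"
  defines "a \<equiv> proj s m k y"
  shows "edge_area (m + k) i (i + k) s (\<lambda>l. y (block_move m k i l)) =
    (if (\<forall>l\<le>m. l \<noteq> i \<longrightarrow> sum a {..<l} < sum a {..<i}) \<and> below a m k then sum a {..<i} / 2 else 0)"
proof -
  define x where "x = (\<lambda>l. y (block_move m k i l))"
  have d: "sum x {i..<i+k} = sum y {m..<m+k}"
    unfolding x_def by (rule sum_block_move(2)[OF i]) simp
  have 0: "sum x {..<i} = sum y {..<i}" unfolding x_def by (intro sum_block_move(1) i) simp
  have before: "s * cr (sum x {..<l} - sum x {..<i}) (sum x {i..<i+k}) = sum a {..<l} - sum a {..<i}" if "l \<le> i" for l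
  proof -
    have "sum x {..<l} = sum y {..<l}" using that unfolding x_def by (intro sum_block_move(1) i) simp
    thus ?thesis by (simp add: 0 d a_def sum_proj cr_diff_left algebra_simps)
  qed
  have inside: "s * cr (sum x {..<i + r} - sum x {..<i}) (sum x {i..<i+k}) = sum a {m..<m+r}" if "r \<le> k" for r
  proof -
    have "sum x {i..<i+r} = sum y {m..<m+r}" using that unfolding x_def by (intro sum_block_move(2) i) simp
    thus ?thesis by (simp add: sum_lessThan_diff d a_def sum_proj)
  qed
  have after: "s * cr (sum x {..<l + k} - sum x {..<i}) (sum x {i..<i+k}) = sum a {..<l} - sum a {..<i}"
    if "i \<le> l" "l \<le> m" for l
  proof -
    have "sum x {i+k..<l+k} = sum y {i..<l}" using that unfolding x_def by (intro sum_block_move(3) i) auto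
    moreover have "sum x {..<l+k} - sum x {..<i} = sum x {i..<i+k} + sum x {i+k..<l+k}"
      using that by (simp add: sum_lessThan_diff sum.atLeastLessThan_concat)
    ultimately have "s * cr (sum x {..<l + k} - sum x {..<i}) (sum x {i..<i+k}) = sum a {i..<l}"
      by (simp add: d a_def sum_proj cr_add_left)
    thus ?thesis using that by (simp add: sum_lessThan_diff)
  qed
  have "(\<forall>l\<le>m+k. l \<noteq> i \<longrightarrow> l \<noteq> i + k \<longrightarrow> s * cr (sum x {..<l} - sum x {..<i}) (sum x {i..<i+k}) < 0) \<longleftrightarrow>
        (\<forall>l\<le>m. l \<noteq> i \<longrightarrow> sum a {..<l} < sum a {..<i}) \<and> below a m k" (is "?L \<longleftrightarrow> ?R")
  proof
    assume L: ?L
    have "sum a {..<l} < sum a {..<i}" if "l \<le> m" "l \<noteq> i" for l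
    proof (cases "l < i")
      case True
      hence "s * cr (sum x {..<l} - sum x {..<i}) (sum x {i..<i+k}) < 0"
        using L that i by auto
      thus ?thesis using before[of l] True by linarith
    next
      case False
      hence "s * cr (sum x {..<l + k} - sum x {..<i}) (sum x {i..<i+k}) < 0"
        using L that k by auto
      moreover have "s * cr (sum x {..<l + k} - sum x {..<i}) (sum x {i..<i+k}) = sum a {..<l} - sum a {..<i}"
        using False that by (intro after) auto
      ultimately show ?thesis by linarith
    qed
    moreover have "sum a {m..<m+r} < 0" if "0 < r" "r < k" for r
    proof -
      have "s * cr (sum x {..<i+r} - sum x {..<i}) (sum x {i..<i+k}) < 0"
        using L that i by auto
      thus ?thesis using inside[of r] that by linarith
    qed
    ultimately show ?R by (auto simp: below_def)
  next
    assume R: ?R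
    show ?L
    proof (intro allI impI)
      fix l assume l: "l \<le> m + k" "l \<noteq> i" "l \<noteq> i + k"
      consider "l < i" | "i < l" "l < i + k" | "i + k < l" using l by linarith
      thus "s * cr (sum x {..<l} - sum x {..<i}) (sum x {i..<i+k}) < 0"
      proof cases
        case 1
        hence "sum a {..<l} < sum a {..<i}" using R l i by auto
        thus ?thesis using before[of l] 1 by linarith
      next
        case 2
        then obtain r where r: "0 < r" "r < k" "l = i + r"
          using less_imp_add_positive by (metis add_less_cancel_left)
        hence "sum a {m..<m+r} < 0" using R by (auto simp: below_def)
        thus ?thesis using inside[of r] r by simp
      next
        case 3
        hence "sum a {..<l-k} < sum a {..<i}" using R l by auto
        moreover have "s * cr (sum x {..<l - k + k} - sum x {..<i}) (sum x {i..<i+k}) = sum a {..<l - k} - sum a {..<i}"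
          using 3 l by (intro after) auto
        moreover have "l - k + k = l" using 3 by auto
        ultimately show ?thesis by simp
      qed
    qed
  qed
  moreover have "s * cr (sum x {..<i}) (sum x {i..<i+k}) = sum a {..<i}"
    by (simp add: 0 d a_def sum_proj)
  ultimately show ?thesis unfolding edge_area_def x_def[symmetric] by auto
qed

text \<open>Only a strict maximizer contributes, and it contributes the maximum. The index 0 is
  missing from the sum, which is harmless because its partial sum is 0. A tie is permitted just
  between 0 and \<open>m\<close>, where the common value is again 0; this is the case of two
  complementary blocks.\<close>

lemma sum_strict_argmax:
  fixes a :: "nat \<Rightarrow> real"
  assumes inj: "\<And>i j. i < j \<Longrightarrow> j \<le> m \<Longrightarrow> i \<noteq> 0 \<or> j \<noteq> m \<Longrightarrow> sum a {..<i} \<noteq> sum a {..<j}"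
  shows "(\<Sum>i=1..m. if \<forall>l\<le>m. l \<noteq> i \<longrightarrow> sum a {..<l} < sum a {..<i} then sum a {..<i} else 0) = pmax a m"
proof -
  define T where "T l = sum a {..<l}" for l
  have pm: "pmax a m = Max (T ` {..m})" by (simp add: pmax_def T_def[abs_def])
  define good where "good i \<longleftrightarrow> (\<forall>l\<le>m. l \<noteq> i \<longrightarrow> T l < T i)" for i
  obtain j where j: "j \<le> m" "T j = Max (T ` {..m})"
    using Max_in[of "T ` {..m}"] by fastforce
  have jm: "T l \<le> T j" if "l \<le> m" for l using that j by auto
  have goal: ?thesis if "(\<Sum>i=1..m. if good i then T i else 0) = Max (T ` {..m})"
    using that unfolding pm good_def T_def[abs_def] by simp
  show ?thesis
  proof (cases "\<exists>i\<in>{1..m}. good i")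
    case True
    then obtain i where i: "i \<in> {1..m}" "good i" by blast
    have "i = j" using i jm[of i] j(1) unfolding good_def by fastforce
    have "(\<Sum>i=1..m. if good i then T i else 0) = (\<Sum>i\<in>{j}. T i)"
    proof (intro sum.mono_neutral_cong_right ballI)
      fix l assume "l \<in> {1..m} - {j}"
      hence "\<not> good l" using jm[of l] j(1) by (auto simp: good_def not_less intro!: exI[of _ j])
      thus "(if good l then T l else 0) = 0" by simp
    qed (use i \<open>i = j\<close> in auto)
    thus ?thesis using j by (intro goal) simp
  next
    case False
    \<comment> \<open>The maximizer \<open>j\<close> fails to be strict only through a tie, and the
      one admissible tie involves index 0.\<close>
    have "T j = 0"
    proof (rule ccontr)
      assume "T j \<noteq> 0"
      hence "j \<noteq> 0" by (intro notI) (simp add: T_def)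
      hence "\<not> good j" using False j by auto
      then obtain l where l: "l \<le> m" "l \<noteq> j" "\<not> T l < T j" unfolding good_def by auto
      hence eq: "T l = T j" using jm[of l] by auto
      have "l = 0 \<and> j = m \<or> j = 0 \<and> l = m"
        using inj[of l j] inj[of j l] l j eq unfolding T_def by (metis nat_neq_iff)
      hence "l = 0" using \<open>j \<noteq> 0\<close> by simp
      thus False using eq \<open>T j \<noteq> 0\<close> by (simp add: T_def)
    qed
    moreover have "(\<Sum>i=1..m. if good i then T i else 0) = 0" using False by (intro sum.neutral) auto
    ultimately show ?thesis using j by (intro goal) simp
  qed
qed

text \<open>A closed scalar walk with pairwise different heights has one highest point, and a shift
  stays below its start exactly when it starts there.\<close>

lemma card_cyclic_shifts_below:
  fixes a :: "nat \<Rightarrow> real"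
  assumes "k > 0" "sum a {..<k} = 0"
    and inj: "\<And>i j. i < j \<Longrightarrow> j < k \<Longrightarrow> sum a {..<i} \<noteq> sum a {..<j}"
  shows "card {r. r < k \<and> below (\<lambda>i. a ((i + r) mod k)) 0 k} = 1"
proof -
  define T where "T l = (\<Sum>i<l. a (i mod k))" for l
  have shift: "(\<Sum>i<l. a ((i + r) mod k)) = T (r + l) - T r" for r l
    unfolding T_def by (induction l) (auto simp: add.commute)
  have T_le: "T l = sum a {..<l}" if "l \<le> k" for l
    unfolding T_def using that by (intro sum.cong) auto
  have per: "T (l + k) = T l" for l
  proof (induction l)
    case 0 show ?case using T_le[of k] assms by (simp add: T_def)
  next
    case (Suc l) thus ?case by (simp add: T_def)
  qed
  have below: "below (\<lambda>i. a ((i + r) mod k)) 0 k \<longleftrightarrow> (\<forall>j<k. j \<noteq> r \<longrightarrow> T j < T r)" if "r < k" for r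
  proof -
    have "below (\<lambda>i. a ((i + r) mod k)) 0 k \<longleftrightarrow> (\<forall>l. 0 < l \<longrightarrow> l < k \<longrightarrow> T (r + l) < T r)"
      unfolding below_def by (simp add: atLeast0LessThan shift)
    also have "\<dots> \<longleftrightarrow> (\<forall>j<k. j \<noteq> r \<longrightarrow> T j < T r)"
    proof safe
      fix j assume H: "\<forall>l. 0 < l \<longrightarrow> l < k \<longrightarrow> T (r + l) < T r" and j: "j < k" "j \<noteq> r"
      show "T j < T r"
      proof (cases "r < j")
        case True thus ?thesis using H[rule_format, of "j - r"] j by auto
      next
        case False
        hence "T (r + (j + k - r)) < T r" using j that by (intro H[rule_format]) auto
        moreover have "r + (j + k - r) = j + k" using False that by auto
        ultimately show ?thesis using per by simp
      qed
    next
      fix l assume H: "\<forall>j<k. j \<noteq> r \<longrightarrow> T j < T r" and l: "0 < l" "l < k"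
      show "T (r + l) < T r"
      proof (cases "r + l < k")
        case True thus ?thesis using H l by auto
      next
        case False
        hence "T (r + l) = T (r + l - k)" using per[of "r + l - k"] by simp
        thus ?thesis using H[rule_format, of "r + l - k"] False l that by auto
      qed
    qed
    finally show ?thesis .
  qed
  obtain j where j: "j < k" "T j = Max (T ` {..<k})"
    using Max_in[of "T ` {..<k}"] assms(1) by (fastforce simp: lessThan_empty_iff)
  have jm: "T l \<le> T j" if "l < k" for l using that j by auto
  have "T l \<noteq> T j" if "l < k" "l \<noteq> j" for l
    using inj[of l j] inj[of j l] T_le that j(1) by (metis nat_neq_iff less_imp_le)
  hence less: "T l < T j" if "l < k" "l \<noteq> j" for l using jm that by (simp add: less_le)
  have "{r. r < k \<and> (\<forall>j<k. j \<noteq> r \<longrightarrow> T j < T r)} = {j}"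
  proof (intro equalityI subsetI)
    fix r assume "r \<in> {r. r < k \<and> (\<forall>j<k. j \<noteq> r \<longrightarrow> T j < T r)}"
    hence "\<not> T r < T j" "r < k" using j(1) by (auto dest: spec[of _ j])
    thus "r \<in> {j}" using less[of r] by blast
  qed (use less j(1) in auto)
  moreover have "{r. r < k \<and> below (\<lambda>i. a ((i + r) mod k)) 0 k} = {r. r < k \<and> (\<forall>j<k. j \<noteq> r \<longrightarrow> T j < T r)}"
    using below by blast
  ultimately show ?thesis by simp
qed

section \<open>Exchangeable walks\<close>

lemma borel_measurable_vec_nth:
  fixes f :: "'a \<Rightarrow> real ^ 'n"
  assumes [measurable]: "f \<in> borel_measurable M"
  shows "(\<lambda>x. f x $ i) \<in> borel_measurable M"
proof -
  have "(\<lambda>x. f x \<bullet> axis i 1) \<in> borel_measurable M" by measurable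
  thus ?thesis by (simp add: inner_axis)
qed

lemma borel_measurable_cr [measurable]:
  assumes "f \<in> borel_measurable M" "g \<in> borel_measurable M"
  shows "(\<lambda>x. cr (f x) (g x)) \<in> borel_measurable M"
  unfolding cr_def by (intro borel_measurable_diff borel_measurable_times borel_measurable_vec_nth assms)

definition block_shift :: "nat \<Rightarrow> nat \<Rightarrow> nat \<Rightarrow> nat \<Rightarrow> nat" where
  "block_shift m k r i = (if m \<le> i \<and> i < m + k then m + (i - m + r) mod k else i)"

lemma bij_betw_add_mod:
  fixes k r :: nat
  assumes "0 < k"
  shows "bij_betw (\<lambda>i. (i + r) mod k) {..<k} {..<k}"
proof -
  have inj: "inj_on (\<lambda>i. (i + r) mod k) {..<k}"
  proof (rule linorder_inj_onI)
    fix i j assume ij: "i < j" "i \<in> {..<k}" "j \<in> {..<k}"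
    show "(i + r) mod k \<noteq> (j + r) mod k"
    proof
      assume "(i + r) mod k = (j + r) mod k"
      hence "k dvd j - i" using ij mod_eq_dvd_iff_nat[of "i + r" "j + r" k] by simp
      thus False using ij by (auto dest: dvd_imp_le)
    qed
  qed auto
  moreover have "(\<lambda>i. (i + r) mod k) ` {..<k} = {..<k}"
    using assms inj by (intro endo_inj_surj) auto
  ultimately show ?thesis by (simp add: bij_betw_def)
qed

lemma bij_betw_block_shift:
  assumes "0 < k"
  shows "bij_betw (block_shift m k r) {m..<m+k} {m..<m+k}"
proof -
  have "bij_betw ((\<lambda>i. m + i) \<circ> (\<lambda>i. (i + r) mod k) \<circ> (\<lambda>i. i - m)) {m..<m+k} {m..<m+k}"
  proof (intro bij_betw_trans)
    show "bij_betw (\<lambda>i. i - m) {m..<m+k} {..<k}"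
      by (rule bij_betwI[where g = "\<lambda>i. i + m"]) auto
    show "bij_betw (\<lambda>i. (i + r) mod k) {..<k} {..<k}" by (rule bij_betw_add_mod[OF assms])
    show "bij_betw (\<lambda>i. m + i) {..<k} {m..<m+k}"
      by (rule bij_betwI[where g = "\<lambda>i. i - m"]) auto
  qed
  thus ?thesis by (rule bij_betw_cong[THEN iffD1, rotated]) (auto simp: block_shift_def)
qed

lemma block_shift_permutes:
  assumes "0 < k" "m + k \<le> n"
  shows "block_shift m k r permutes {..<n}"
proof (rule permutes_subset)
  show "block_shift m k r permutes {m..<m+k}"
    by (rule bij_imp_permutes[OF bij_betw_block_shift[OF assms(1)]]) (auto simp: block_shift_def)
qed (use assms in auto)

lemma sum_block_shift:
  assumes "0 < k"
  shows "(\<Sum>i\<in>{m..<m+k}. f (block_shift m k r i)) = sum f {m..<m+k}"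
  by (rule sum.reindex_bij_betw[OF bij_betw_block_shift[OF assms]])

lemma ennreal_div_of_mult_eq:
  assumes "0 < c" "ennreal c * A = B"
  shows "A = ennreal (1 / c) * B"
proof -
  have "ennreal (1 / c) * B = ennreal (1 / c) * ennreal c * A"
    using assms(2) by (simp add: mult.assoc)
  also have "ennreal (1 / c) * ennreal c = 1"
    using assms(1) by (simp add: ennreal_mult[symmetric])
  finally show ?thesis by simp
qed

text \<open>The combinatorial formula is proved at this level, for the canonical increments
  \<open>x\<close>. The Gaussian law enters later, through these properties and through the expected
  determinants.\<close>

locale exchangeable_walk =
  fixes n :: nat and P :: "(nat \<Rightarrow> real ^ 2) measure"
  assumes sets_P: "sets P = sets (Pi\<^sub>M {..<n} (\<lambda>_. borel))"
    and exch: "\<And>\<pi>. \<pi> permutes {..<n} \<Longrightarrow> distr P P (\<lambda>x i. x (\<pi> i)) = P"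
    and AE_generic: "AE x in P. generic n x"
begin

lemma measurable_sum_P [measurable]:
  assumes "I \<subseteq> {..<n}"
  shows "(\<lambda>x. sum x I) \<in> borel_measurable P"
proof (rule borel_measurable_sum)
  fix i assume "i \<in> I"
  thus "(\<lambda>x. x i) \<in> borel_measurable P"
    unfolding measurable_cong_sets[OF sets_P refl] using assms
    by (intro measurable_component_singleton) auto
qed

lemma measurable_permute:
  assumes "\<pi> permutes {..<n}"
  shows "(\<lambda>x i. x (\<pi> i)) \<in> P \<rightarrow>\<^sub>M P"
  unfolding measurable_cong_sets[OF sets_P sets_P]
proof (rule measurable_PiM_single')
  fix i assume "i \<in> {..<n}"
  thus "(\<lambda>x. x (\<pi> i)) \<in> borel_measurable (Pi\<^sub>M {..<n} (\<lambda>_. borel))"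
    using permutes_in_image[OF assms, of i] by (intro measurable_component_singleton) simp
next
  show "(\<lambda>x i. x (\<pi> i)) \<in> space (Pi\<^sub>M {..<n} (\<lambda>_. borel)) \<rightarrow> {..<n} \<rightarrow>\<^sub>E space borel"
    using permutes_not_in[OF assms] by (auto simp: space_PiM PiE_def extensional_def)
qed

lemma nn_integral_permute:
  assumes "\<pi> permutes {..<n}" "F \<in> borel_measurable P"
  shows "(\<integral>\<^sup>+x. F (\<lambda>i. x (\<pi> i)) \<partial>P) = (\<integral>\<^sup>+x. F x \<partial>P)"
proof -
  have "(\<integral>\<^sup>+x. F x \<partial>P) = (\<integral>\<^sup>+x. F x \<partial>distr P P (\<lambda>x i. x (\<pi> i)))"
    using exch[OF assms(1)] by simp
  also have "\<dots> = (\<integral>\<^sup>+x. F (\<lambda>i. x (\<pi> i)) \<partial>P)"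
    using assms by (intro nn_integral_distr measurable_permute) auto
  finally show ?thesis ..
qed

lemma measurable_edge_area [measurable]:
  assumes "i \<le> n" "j \<le> n"
  shows "edge_area n i j s \<in> borel_measurable P"
proof -
  have "Measurable.pred P (\<lambda>x. \<forall>l\<in>{..n}. l \<noteq> i \<longrightarrow> l \<noteq> j \<longrightarrow>
      s * cr (sum x {..<l} - sum x {..<i}) (sum x {i..<j}) < 0)"
  proof (intro pred_intros_finite)
    fix l assume "l \<in> {..n}"
    hence [measurable]: "(\<lambda>x. sum x {..<l}) \<in> borel_measurable P" "(\<lambda>x. sum x {..<i}) \<in> borel_measurable P"
      "(\<lambda>x. sum x {i..<j}) \<in> borel_measurable P"
      using assms by (auto intro!: measurable_sum_P)
    show "Measurable.pred P (\<lambda>x. l \<noteq> i \<longrightarrow> l \<noteq> j \<longrightarrow>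
      s * cr (sum x {..<l} - sum x {..<i}) (sum x {i..<j}) < 0)" by measurable
  qed auto
  moreover have [measurable]: "(\<lambda>x. sum x {..<i}) \<in> borel_measurable P"
      "(\<lambda>x. sum x {i..<j}) \<in> borel_measurable P"
      using assms by (auto intro!: measurable_sum_P)
  ultimately show ?thesis unfolding edge_area_def[abs_def] Ball_def atMost_iff by measurable
qed

lemma measurable_sum_proj:
  assumes "m + k \<le> n" "A \<subseteq> {..<n}"
  shows "(\<lambda>x. sum (proj s m k x) A) \<in> borel_measurable P"
proof -
  have [measurable]: "(\<lambda>x. sum x A) \<in> borel_measurable P" "(\<lambda>x. sum x {m..<m+k}) \<in> borel_measurable P"
    using assms by (auto intro!: measurable_sum_P)
  show ?thesis unfolding sum_proj by measurable
qed

lemma measurable_pmax: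
  assumes "m + k \<le> n" "q \<le> n"
  shows "(\<lambda>x. pmax (proj s m k x) q) \<in> borel_measurable P"
  unfolding pmax_def using assms by (intro borel_measurable_Max measurable_sum_proj) auto

lemma measurable_rec_inc:
  assumes "m + k \<le> n" "q \<le> n"
  shows "(\<lambda>x. rec_inc (proj s m k x) q) \<in> borel_measurable P"
  unfolding rec_inc_def using assms
  by (intro borel_measurable_max borel_measurable_diff measurable_pmax measurable_sum_proj) auto

lemma measurable_below:
  assumes "m + k \<le> n"
  shows "Measurable.pred P (\<lambda>x. below (proj s m k x) m k)"
proof -
  have "Measurable.pred P (\<lambda>x. \<forall>r\<in>{0<..<k}. sum (proj s m k x) {m..<m+r} < 0)"
  proof (intro pred_intros_finite)
    fix r assume "r \<in> {0<..<k}"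
    hence [measurable]: "(\<lambda>x. sum (proj s m k x) {m..<m+r}) \<in> borel_measurable P"
      using assms by (intro measurable_sum_proj) auto
    show "Measurable.pred P (\<lambda>x. sum (proj s m k x) {m..<m+r} < 0)" by measurable
  qed auto
  moreover have "below (proj s m k x) m k \<longleftrightarrow> (\<forall>r\<in>{0<..<k}. sum (proj s m k x) {m..<m+r} < 0)" for x
    by (auto simp: below_def)
  ultimately show ?thesis by simp
qed

text \<open>For each \<open>i\<close> a different permutation brings the block of the edge to
  \<open>{m..<m+k}\<close>. Afterwards all \<open>m\<close> integrands refer to the same block, so
  their sum can be evaluated pointwise as a sum over strict maximizers.\<close>

lemma sum_edge_area_eq_pmax:
  assumes k: "0 < k" "m + k = n" and s: "s \<noteq> 0"
  shows "(\<Sum>i=1..m. \<integral>\<^sup>+x. edge_area n i (i + k) s x \<partial>P) =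
    (\<integral>\<^sup>+x. (if below (proj s m k x) m k then ennreal (pmax (proj s m k x) m / 2) else 0) \<partial>P)"
proof -
  let ?mv = "\<lambda>i y l. y (block_move m k i l) :: real ^ 2"
  have "(\<Sum>i=1..m. \<integral>\<^sup>+x. edge_area n i (i + k) s x \<partial>P) =
        (\<Sum>i=1..m. \<integral>\<^sup>+x. edge_area n i (i + k) s (?mv i x) \<partial>P)"
  proof (intro sum.cong refl)
    fix i assume i: "i \<in> {1..m}"
    have "block_move m k i permutes {..<n}" using block_move_permutes[of i m k] i k by simp
    moreover have "(\<lambda>x. ennreal (edge_area n i (i + k) s x)) \<in> borel_measurable P"
      using i k by (intro measurable_compose[OF measurable_edge_area measurable_ennreal]) auto
    ultimately show "(\<integral>\<^sup>+x. edge_area n i (i + k) s x \<partial>P) = (\<integral>\<^sup>+x. edge_area n i (i + k) s (?mv i x) \<partial>P)"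
      by (rule nn_integral_permute[symmetric])
  qed
  also have "\<dots> = (\<integral>\<^sup>+x. (\<Sum>i=1..m. ennreal (edge_area n i (i + k) s (?mv i x))) \<partial>P)"
  proof (rule nn_integral_sum[symmetric])
    fix i assume "i \<in> {1..m}"
    thus "(\<lambda>x. ennreal (edge_area n i (i + k) s (?mv i x))) \<in> borel_measurable P"
      using k block_move_permutes[of i m k]
      by (intro measurable_compose[OF measurable_permute measurable_compose[OF measurable_edge_area measurable_ennreal]]) auto
  qed
  also have "\<dots> = (\<integral>\<^sup>+x. (if below (proj s m k x) m k then ennreal (pmax (proj s m k x) m / 2) else 0) \<partial>P)"
  proof (rule nn_integral_cong_AE, use AE_generic in eventually_elim)
    fix x assume gen: "generic n x"
    define a where "a = proj s m k x"
    define best where "best i \<longleftrightarrow> (\<forall>l\<le>m. l \<noteq> i \<longrightarrow> sum a {..<l} < sum a {..<i})" for i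
    \<comment> \<open>Comparison with the empty sum at \<open>l = 0\<close>; it lets the sum pass
      through \<open>ennreal\<close>.\<close>
    have nonneg: "0 \<le> sum a {..<i}" if "best i" for i
      using that unfolding best_def by (cases "i = 0") (auto dest: spec[of _ 0])
    have e: "edge_area n i (i + k) s (?mv i x) = (if best i \<and> below a m k then sum a {..<i} / 2 else 0)"
      if "i \<in> {1..m}" for i
      unfolding k(2)[symmetric] a_def best_def by (rule edge_area_block_move) (use that k in auto)
    have "(\<Sum>i=1..m. ennreal (edge_area n i (i + k) s (?mv i x))) =
          ennreal (\<Sum>i=1..m. edge_area n i (i + k) s (?mv i x))"
      by (intro sum_ennreal) (auto simp: e nonneg)
    also have "(\<Sum>i=1..m. edge_area n i (i + k) s (?mv i x)) =
          (if below a m k then (\<Sum>i=1..m. if best i then sum a {..<i} else 0) / 2 else 0)"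
      unfolding sum_divide_distrib by (auto simp: e intro!: sum.cong)
    also have "(\<Sum>i=1..m. if best i then sum a {..<i} else 0) = pmax a m"
      unfolding best_def
    proof (rule sum_strict_argmax)
      fix i j assume ij: "i < j" "j \<le> m" "i \<noteq> 0 \<or> j \<noteq> m"
      have "sum a {..<j} - sum a {..<i} = s * cr (sum x {i..<j}) (sum x {m..<m+k})"
        using ij sum_lessThan_diff[of i j a] by (simp only: less_imp_le a_def sum_proj)
      moreover have "cr (sum x {i..<j}) (sum x {m..<m+k}) \<noteq> 0"
      proof (rule genericD[OF gen])
        \<comment> \<open>The first block is a proper part of \<open>{..<m}\<close>: it misses
          \<open>j\<close> if \<open>i = 0\<close>, and 0 otherwise. This is where the tie between 0
          and \<open>m\<close> has to be left out.\<close>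
        show "{i..<j} \<union> {m..<m+k} \<noteq> {..<n}"
        proof (cases "i = 0")
          case True
          hence "j \<notin> {i..<j} \<union> {m..<m+k}" "j \<in> {..<n}" using ij k by auto
          thus ?thesis by blast
        next
          case False
          hence "0 \<notin> {i..<j} \<union> {m..<m+k}" "0 \<in> {..<n}" using ij k by auto
          thus ?thesis by blast
        qed
      qed (use ij k in auto)
      ultimately show "sum a {..<i} \<noteq> sum a {..<j}" using s by auto
    qed
    finally show "(\<Sum>i=1..m. ennreal (edge_area n i (i + k) s (?mv i x))) =
        (if below (proj s m k x) m k then ennreal (pmax (proj s m k x) m / 2) else 0)"
      by (simp add: a_def)
  qed
  finally show ?thesis .
qed

text \<open>Average over the \<open>k\<close> rotations of the final block. They change neither its
  sum, hence not the direction of projection, nor the first \<open>m\<close> steps, and exactly one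
  of them keeps the block below its chord.\<close>

lemma nn_integral_below_pmax:
  assumes k: "0 < k" "m + k = n" "0 < m" and s: "s \<noteq> 0"
  shows "ennreal (real k) * (\<integral>\<^sup>+x. (if below (proj s m k x) m k then ennreal (pmax (proj s m k x) m / 2) else 0) \<partial>P) =
    (\<integral>\<^sup>+x. ennreal (pmax (proj s m k x) m / 2) \<partial>P)"
proof -
  define F where "F x = (if below (proj s m k x) m k then ennreal (pmax (proj s m k x) m / 2) else 0)" for x
  have [measurable]: "Measurable.pred P (\<lambda>x. below (proj s m k x) m k)"
    "(\<lambda>x. pmax (proj s m k x) m) \<in> borel_measurable P"
    using k by (auto intro!: measurable_below measurable_pmax)
  have [measurable]: "F \<in> borel_measurable P"
    unfolding F_def by measurable
  have perm: "block_shift m k r permutes {..<n}" for r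
    using k by (intro block_shift_permutes) auto
  have "ennreal (real k) * (\<integral>\<^sup>+x. F x \<partial>P) = (\<Sum>r<k. \<integral>\<^sup>+x. F x \<partial>P)"
    by (simp add: ennreal_of_nat_eq_real_of_nat)
  also have "\<dots> = (\<Sum>r<k. \<integral>\<^sup>+x. F (\<lambda>i. x (block_shift m k r i)) \<partial>P)"
    by (intro sum.cong refl nn_integral_permute[symmetric, OF perm, where F = F]) auto
  also have "\<dots> = (\<integral>\<^sup>+x. (\<Sum>r<k. F (\<lambda>i. x (block_shift m k r i))) \<partial>P)"
    by (intro nn_integral_sum[symmetric] measurable_compose[OF measurable_permute[OF perm], of F]) auto
  also have "\<dots> = (\<integral>\<^sup>+x. ennreal (pmax (proj s m k x) m / 2) \<partial>P)"
  proof (rule nn_integral_cong_AE, use AE_generic in eventually_elim)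
    fix x assume gen: "generic n x"
    define a where "a i = proj s m k x (m + i)" for i
    let ?sh = "\<lambda>r i. x (block_shift m k r i)"
    have proj: "proj s m k (?sh r) i = proj s m k x (block_shift m k r i)" for r i
      unfolding proj_def using k sum_block_shift[of k x m r] by simp
    have pm: "pmax (proj s m k (?sh r)) m = pmax (proj s m k x) m" for r
      by (intro pmax_cong, unfold proj) (simp add: block_shift_def)
    have bl: "below (proj s m k (?sh r)) m k \<longleftrightarrow> below (\<lambda>i. a ((i + r) mod k)) 0 k" for r
    proof -
      have "sum (proj s m k (?sh r)) {m..<m+l} = (\<Sum>i<l. a ((i + r) mod k))" if "l < k" for l
      proof -
        have "sum (proj s m k (?sh r)) {m..<m+l} = (\<Sum>i\<in>{m..<m+l}. a ((i - m + r) mod k))"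
          using that by (intro sum.cong refl, unfold proj) (auto simp: block_shift_def a_def)
        also have "\<dots> = (\<Sum>i<l. a ((i + r) mod k))"
          by (rule sum.reindex_bij_witness[of _ "\<lambda>i. i + m" "\<lambda>i. i - m"]) auto
        finally show ?thesis .
      qed
      thus ?thesis unfolding below_def by (auto simp: atLeast0LessThan)
    qed
    have a_sum: "sum a {i..<j} = s * cr (sum x {m+i..<m+j}) (sum x {m..<m+k})" for i j
    proof -
      have "sum a {i..<j} = sum (proj s m k x) {m+i..<m+j}"
        unfolding a_def by (rule sum.reindex_bij_witness[of _ "\<lambda>i. i - m" "\<lambda>i. m + i"]) auto
      thus ?thesis by (simp add: sum_proj)
    qed
    have "card {r. r < k \<and> below (\<lambda>i. a ((i + r) mod k)) 0 k} = 1"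
    proof (rule card_cyclic_shifts_below)
      show "sum a {..<k} = 0" using a_sum[of 0 k] by (simp add: atLeast0LessThan)
      fix i j assume ij: "i < j" "j < k"
      \<comment> \<open>A piece of the block is compared with the rest of the block; both leave out
        step 0 because \<open>0 < m\<close>.\<close>
      let ?I = "{m+i..<m+j}" and ?J = "{m..<m+i} \<union> {m+j..<m+k}"
      have "sum x {m..<m+k} = sum x (?I \<union> ?J)"
        using ij by (intro arg_cong[of _ _ "sum x"]) auto
      also have "\<dots> = sum x ?I + sum x ?J" by (intro sum.union_disjoint) auto
      finally have "cr (sum x ?I) (sum x {m..<m+k}) = cr (sum x ?I) (sum x ?J)"
        by (simp add: cr_add_right)
      moreover have "cr (sum x ?I) (sum x ?J) \<noteq> 0"
      proof (rule genericD[OF gen])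
        have "0 \<notin> ?I \<union> ?J" "0 \<in> {..<n}" using k by auto
        thus "?I \<union> ?J \<noteq> {..<n}" by blast
        have "m + j \<in> ?J" using ij by auto
        thus "?J \<noteq> {}" by blast
      qed (use ij k in auto)
      moreover have "sum a {..<j} - sum a {..<i} = s * cr (sum x ?I) (sum x {m..<m+k})"
        using ij by (simp add: sum_lessThan_diff a_sum)
      ultimately show "sum a {..<i} \<noteq> sum a {..<j}" using s by auto
    qed (use k in auto)
    moreover have "(\<Sum>r<k. F (?sh r)) =
        of_nat (card {r. r < k \<and> below (\<lambda>i. a ((i + r) mod k)) 0 k}) * ennreal (pmax (proj s m k x) m / 2)"
    proof -
      have "(\<Sum>r<k. F (?sh r)) =
          (\<Sum>r\<in>{r\<in>{..<k}. below (\<lambda>i. a ((i + r) mod k)) 0 k}. ennreal (pmax (proj s m k x) m / 2))"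
        by (subst sum.inter_filter) (auto simp: F_def pm bl intro!: sum.cong)
      thus ?thesis by simp
    qed
    ultimately show "(\<Sum>r<k. F (?sh r)) = ennreal (pmax (proj s m k x) m / 2)" by simp
  qed
  finally show ?thesis by (simp add: F_def)
qed

text \<open>Average over the \<open>q\<close> rotations of the first \<open>q\<close> steps. They do
  not touch the final block because \<open>q \<le> m\<close>, so the heights are merely rotated and
  Spitzer's identity applies. The positive part on the right is hidden in \<open>ennreal\<close>,
  which sends negative numbers to 0.\<close>

lemma nn_integral_rec_inc:
  assumes k: "m + k = n" and q: "0 < q" "q \<le> m"
  shows "ennreal (real q) * (\<integral>\<^sup>+x. ennreal (rec_inc (proj s m k x) q) \<partial>P) =
    (\<integral>\<^sup>+x. ennreal (s * cr (sum x {..<q}) (sum x {m..<n})) \<partial>P)"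
proof -
  define F where "F x = ennreal (rec_inc (proj s m k x) q)" for x
  have [measurable]: "F \<in> borel_measurable P"
    unfolding F_def using q k by (intro measurable_compose[OF measurable_rec_inc measurable_ennreal]) auto
  have perm: "block_shift 0 q r permutes {..<n}" for r
    using q k by (intro block_shift_permutes) auto
  have "ennreal (real q) * (\<integral>\<^sup>+x. F x \<partial>P) = (\<Sum>r<q. \<integral>\<^sup>+x. F x \<partial>P)"
    by (simp add: ennreal_of_nat_eq_real_of_nat)
  also have "\<dots> = (\<Sum>r<q. \<integral>\<^sup>+x. F (\<lambda>i. x (block_shift 0 q r i)) \<partial>P)"
    by (intro sum.cong refl nn_integral_permute[symmetric, OF perm, where F = F]) auto
  also have "\<dots> = (\<integral>\<^sup>+x. (\<Sum>r<q. F (\<lambda>i. x (block_shift 0 q r i))) \<partial>P)"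
    by (intro nn_integral_sum[symmetric] measurable_compose[OF measurable_permute[OF perm], of F]) auto
  also have "\<dots> = (\<integral>\<^sup>+x. ennreal (s * cr (sum x {..<q}) (sum x {m..<n})) \<partial>P)"
  proof (rule nn_integral_cong)
    fix x
    let ?a = "proj s m k x"
    let ?sh = "\<lambda>r i. x (block_shift 0 q r i)"
    have "sum (?sh r) {m..<m+k} = sum x {m..<m+k}" for r
      using q by (intro sum.cong) (auto simp: block_shift_def)
    hence "proj s m k (?sh r) i = ?a ((i + r) mod q)" if "i < q" for r i
      using that by (simp add: proj_def block_shift_def)
    hence "F (?sh r) = ennreal (rec_inc (\<lambda>i. ?a ((i + r) mod q)) q)" for r
      unfolding F_def by (intro arg_cong[of _ _ ennreal] rec_inc_cong)
    hence "(\<Sum>r<q. F (?sh r)) = ennreal (\<Sum>r<q. rec_inc (\<lambda>i. ?a ((i + r) mod q)) q)"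
      by (simp add: sum_ennreal)
    also have "\<dots> = ennreal (max 0 (sum ?a {..<q}))"
      using q by (simp add: sum_rec_inc_cyclic_shifts)
    also have "\<dots> = ennreal (s * cr (sum x {..<q}) (sum x {m..<n}))"
      using k by (simp add: sum_proj max_def ennreal_neg)
    finally show "(\<Sum>r<q. F (?sh r)) = ennreal (s * cr (sum x {..<q}) (sum x {m..<n}))" .
  qed
  finally show ?thesis by (simp add: F_def)
qed

text \<open>For each orientation the edges spanning \<open>k\<close> steps give \<open>1 / k\<close>
  times half the expected maximum, and the maximum is a sum of record increments, each worth
  \<open>1 / q\<close> times the positive part of a determinant. The two orientations supply the
  positive and the negative part.\<close>

theorem nn_integral_area_convex_hull:
  assumes n: "3 \<le> n"
  shows "(\<integral>\<^sup>+x. ennreal (measure lebesgue (convex hull ((\<lambda>l. sum x {..<l}) ` {..n}))) \<partial>P) =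
    (\<Sum>k=1..<n. \<Sum>q=1..n-k. ennreal (1 / (2 * real k * real q)) *
       (\<integral>\<^sup>+x. ennreal \<bar>cr (sum x {..<q}) (sum x {n-k..<n})\<bar> \<partial>P))"
proof -
  have nonneg: "0 \<le> edge_area n i j s x" if "1 \<le> i" "i < j" for i j s x
  proof -
    have "0 \<le> s * cr (sum x {..<i}) (sum x {i..<j})"
      if "\<forall>l\<le>n. l \<noteq> i \<longrightarrow> l \<noteq> j \<longrightarrow> s * cr (sum x {..<l} - sum x {..<i}) (sum x {i..<j}) < 0"
      using that[rule_format, of 0] \<open>1 \<le> i\<close> \<open>i < j\<close> unfolding cr_diff_left by simp
    thus ?thesis by (auto simp: edge_area_def)
  qed
  have meas: "(\<lambda>x. ennreal (edge_area n i (i + k) s x)) \<in> borel_measurable P"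
    if "k \<in> {1..<n}" "i \<in> {1..n-k}" for i k s
    using that by (intro measurable_compose[OF measurable_edge_area measurable_ennreal]) auto
  have "(\<integral>\<^sup>+x. ennreal (measure lebesgue (convex hull ((\<lambda>l. sum x {..<l}) ` {..n}))) \<partial>P) =
    (\<integral>\<^sup>+x. (\<Sum>s\<in>{1,-1}. \<Sum>k=1..<n. \<Sum>i=1..n-k. ennreal (edge_area n i (i + k) s x)) \<partial>P)"
  proof (rule nn_integral_cong_AE, use AE_generic in eventually_elim)
    fix x assume gen: "generic n x"
    have "measure lebesgue (convex hull ((\<lambda>l. sum x {..<l}) ` {..n})) =
      (\<Sum>(i, j) \<in> hull_edges n (\<lambda>l. sum x {..<l}). \<bar>cr (sum x {..<i}) (sum x {..<j})\<bar> / 2)"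
      by (rule measure_convex_hull_eq_sum_edges) (simp, rule generic_not_collinear[OF gen])
    also have "\<dots> = (\<Sum>s\<in>{1,-1}. \<Sum>k=1..<n. \<Sum>i=1..n-k. edge_area n i (i + k) s x)"
      unfolding sum_hull_edges_eq_edge_area[OF gen n] sum_pairs_by_difference ..
    also have "ennreal \<dots> = (\<Sum>s\<in>{1,-1}. ennreal (\<Sum>k=1..<n. \<Sum>i=1..n-k. edge_area n i (i + k) s x))"
      by (intro sum_ennreal[symmetric] sum_nonneg nonneg) auto
    also have "\<dots> = (\<Sum>s\<in>{1,-1}. \<Sum>k=1..<n. ennreal (\<Sum>i=1..n-k. edge_area n i (i + k) s x))"
      by (intro sum.cong refl sum_ennreal[symmetric] sum_nonneg nonneg) auto
    also have "\<dots> = (\<Sum>s\<in>{1,-1}. \<Sum>k=1..<n. \<Sum>i=1..n-k. ennreal (edge_area n i (i + k) s x))"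
      by (intro sum.cong refl sum_ennreal[symmetric] nonneg) auto
    finally show "ennreal (measure lebesgue (convex hull ((\<lambda>l. sum x {..<l}) ` {..n}))) =
      (\<Sum>s\<in>{1,-1}. \<Sum>k=1..<n. \<Sum>i=1..n-k. ennreal (edge_area n i (i + k) s x))" .
  qed
  also have "\<dots> = (\<Sum>s\<in>{1,-1}. \<integral>\<^sup>+x. (\<Sum>k=1..<n. \<Sum>i=1..n-k. ennreal (edge_area n i (i + k) s x)) \<partial>P)"
    by (intro nn_integral_sum borel_measurable_sum meas)
  also have "\<dots> = (\<Sum>s\<in>{1,-1}. \<Sum>k=1..<n. \<integral>\<^sup>+x. (\<Sum>i=1..n-k. ennreal (edge_area n i (i + k) s x)) \<partial>P)"
    by (intro sum.cong[OF refl] nn_integral_sum borel_measurable_sum meas)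
  also have "\<dots> = (\<Sum>s\<in>{1,-1}. \<Sum>k=1..<n. \<Sum>i=1..n-k. \<integral>\<^sup>+x. ennreal (edge_area n i (i + k) s x) \<partial>P)"
    by (intro sum.cong[OF refl] nn_integral_sum meas)
  also have "\<dots> = (\<Sum>s\<in>{1,-1}. \<Sum>k=1..<n. \<Sum>q=1..n-k. ennreal (1 / (2 * real k * real q)) *
      (\<integral>\<^sup>+x. ennreal (s * cr (sum x {..<q}) (sum x {n-k..<n})) \<partial>P))"
  proof (rule sum.cong[OF refl], rule sum.cong[OF refl])
    fix s :: real and k assume "s \<in> {1,-1}" and k: "k \<in> {1..<n}"
    hence s: "s \<noteq> 0" by auto
    define m where "m = n - k"
    have mk: "m + k = n" "0 < m" "0 < k" using k by (auto simp: m_def)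
    have "(\<Sum>i=1..n-k. \<integral>\<^sup>+x. ennreal (edge_area n i (i + k) s x) \<partial>P) =
      (\<integral>\<^sup>+x. (if below (proj s m k x) m k then ennreal (pmax (proj s m k x) m / 2) else 0) \<partial>P)"
      using sum_edge_area_eq_pmax[OF mk(3,1) s] by (simp add: m_def)
    also have "\<dots> = ennreal (1 / real k) * (\<integral>\<^sup>+x. ennreal (pmax (proj s m k x) m / 2) \<partial>P)"
      using nn_integral_below_pmax[OF mk(3,1,2) s] mk by (intro ennreal_div_of_mult_eq) auto
    also have "(\<integral>\<^sup>+x. ennreal (pmax (proj s m k x) m / 2) \<partial>P) =
      (\<integral>\<^sup>+x. (\<Sum>q=1..m. ennreal (1/2) * ennreal (rec_inc (proj s m k x) q)) \<partial>P)"
    proof (rule nn_integral_cong)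
      fix x
      let ?f = "rec_inc (proj s m k x)"
      have "ennreal (pmax (proj s m k x) m / 2) = ennreal (\<Sum>q=1..m. 1/2 * ?f q)"
        by (simp add: pmax_eq_sum_rec_inc sum_divide_distrib)
      also have "\<dots> = (\<Sum>q=1..m. ennreal (1/2 * ?f q))"
        by (intro sum_ennreal[symmetric]) auto
      also have "\<dots> = (\<Sum>q=1..m. ennreal (1/2) * ennreal (?f q))"
        by (intro sum.cong refl ennreal_mult) auto
      finally show "ennreal (pmax (proj s m k x) m / 2) = (\<Sum>q=1..m. ennreal (1/2) * ennreal (?f q))" .
    qed
    also have "\<dots> = (\<Sum>q=1..m. ennreal (1/2) * (\<integral>\<^sup>+x. ennreal (rec_inc (proj s m k x) q) \<partial>P))"
    proof (subst nn_integral_sum)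
      show "(\<lambda>x. ennreal (1/2) * ennreal (rec_inc (proj s m k x) q)) \<in> borel_measurable P" if "q \<in> {1..m}" for q
        using that mk by (intro borel_measurable_times_ennreal measurable_compose[OF measurable_rec_inc measurable_ennreal]) auto
      show "(\<Sum>q=1..m. \<integral>\<^sup>+x. ennreal (1/2) * ennreal (rec_inc (proj s m k x) q) \<partial>P) =
        (\<Sum>q=1..m. ennreal (1/2) * (\<integral>\<^sup>+x. ennreal (rec_inc (proj s m k x) q) \<partial>P))"
      proof (intro sum.cong refl nn_integral_cmult)
        fix q assume "q \<in> {1..m}"
        thus "(\<lambda>x. ennreal (rec_inc (proj s m k x) q)) \<in> borel_measurable P"
          using mk by (intro measurable_compose[OF measurable_rec_inc measurable_ennreal]) auto
      qed
    qed
    also have "\<dots> = (\<Sum>q=1..m. ennreal (1/2) * (ennreal (1 / real q) *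
      (\<integral>\<^sup>+x. ennreal (s * cr (sum x {..<q}) (sum x {m..<n})) \<partial>P)))"
    proof (intro sum.cong refl arg_cong[of _ _ "(*) (ennreal (1/2))"])
      fix q assume "q \<in> {1..m}"
      thus "(\<integral>\<^sup>+x. ennreal (rec_inc (proj s m k x) q) \<partial>P) =
        ennreal (1 / real q) * (\<integral>\<^sup>+x. ennreal (s * cr (sum x {..<q}) (sum x {m..<n})) \<partial>P)"
        by (intro ennreal_div_of_mult_eq nn_integral_rec_inc mk) auto
    qed
    also have "ennreal (1 / real k) * \<dots> = (\<Sum>q=1..m. ennreal (1 / (2 * real k * real q)) *
      (\<integral>\<^sup>+x. ennreal (s * cr (sum x {..<q}) (sum x {n-k..<n})) \<partial>P))"
    proof -
      have "ennreal (1 / (2 * real k * real q)) = ennreal (1 / real k) * (ennreal (1/2) * ennreal (1 / real q))" for q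
      proof -
        have "1 / (2 * real k * real q) = 1 / real k * (1/2 * (1 / real q))" by simp
        thus ?thesis
          by (simp only: ennreal_mult mult_nonneg_nonneg zero_le_divide_1_iff of_nat_0_le_iff zero_le_numeral)
      qed
      thus ?thesis unfolding sum_distrib_left by (simp only: mult.assoc m_def)
    qed
    finally show "(\<Sum>i=1..n-k. \<integral>\<^sup>+x. ennreal (edge_area n i (i + k) s x) \<partial>P) = 
      (\<Sum>q=1..n-k. ennreal (1 / (2 * real k * real q)) *
      (\<integral>\<^sup>+x. ennreal (s * cr (sum x {..<q}) (sum x {n-k..<n})) \<partial>P))"
      by (simp add: m_def)
  qed
  also have "\<dots> = (\<Sum>k=1..<n. \<Sum>q=1..n-k. ennreal (1 / (2 * real k * real q)) *
       (\<integral>\<^sup>+x. ennreal \<bar>cr (sum x {..<q}) (sum x {n-k..<n})\<bar> \<partial>P))"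
  proof -
    have abs: "(\<integral>\<^sup>+x. ennreal \<bar>cr (sum x {..<q}) (sum x {n-k..<n})\<bar> \<partial>P) =
      (\<Sum>s\<in>{1,-1}. \<integral>\<^sup>+x. ennreal (s * cr (sum x {..<q}) (sum x {n-k..<n})) \<partial>P)"
      if "k \<in> {1..<n}" "q \<in> {1..n-k}" for k q
    proof -
      have [measurable]: "(\<lambda>x. sum x {..<q}) \<in> borel_measurable P"
        "(\<lambda>x. sum x {n-k..<n}) \<in> borel_measurable P"
        using that by (auto intro!: measurable_sum_P)
      have "(\<integral>\<^sup>+x. ennreal \<bar>cr (sum x {..<q}) (sum x {n-k..<n})\<bar> \<partial>P) =
        (\<integral>\<^sup>+x. (\<Sum>s\<in>{1,-1}. ennreal (s * cr (sum x {..<q}) (sum x {n-k..<n}))) \<partial>P)"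
        by (intro nn_integral_cong) (auto simp: abs_if ennreal_neg)
      also have "\<dots> = (\<Sum>s\<in>{1,-1}. \<integral>\<^sup>+x. ennreal (s * cr (sum x {..<q}) (sum x {n-k..<n})) \<partial>P)"
        by (rule nn_integral_sum) measurable
      finally show ?thesis .
    qed
    have "(\<Sum>k=1..<n. \<Sum>q=1..n-k. ennreal (1 / (2 * real k * real q)) *
       (\<integral>\<^sup>+x. ennreal \<bar>cr (sum x {..<q}) (sum x {n-k..<n})\<bar> \<partial>P)) =
      (\<Sum>k=1..<n. \<Sum>q=1..n-k. ennreal (1 / (2 * real k * real q)) *
       (\<Sum>s\<in>{1,-1}. \<integral>\<^sup>+x. ennreal (s * cr (sum x {..<q}) (sum x {n-k..<n})) \<partial>P))"
      by (intro sum.cong[OF refl]) (simp only: abs)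
    thus ?thesis by (simp add: sum.distrib distrib_left)
  qed
  finally show ?thesis .
qed

end

section \<open>Characteristic functions and joint laws\<close>

lemma (in prob_space) integral_bounded_mult:
  fixes f :: "'a \<Rightarrow> complex" and g :: "'a \<Rightarrow> real"
  assumes "g \<in> borel_measurable M" "\<And>x. \<bar>g x\<bar> \<le> C" "f \<in> borel_measurable M" "\<And>x. norm (f x) \<le> 1"
  shows "integrable M (\<lambda>x. complex_of_real (g x) * f x)"
proof (rule integrable_const_bound[where B = C])
  show "AE x in M. norm (complex_of_real (g x) * f x) \<le> C"
  proof (intro AE_I2)
    fix x
    have "\<bar>g x\<bar> * norm (f x) \<le> \<bar>g x\<bar> * 1" by (intro mult_left_mono assms) simp
    thus "norm (complex_of_real (g x) * f x) \<le> C" using assms(2)[of x] by (simp add: norm_mult)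
  qed
qed (use assms in measurable)

text \<open>Normalizing a nonnegative weight to a density turns a weighted Fourier integral into the
  characteristic function of a probability law, to which uniqueness applies.\<close>

lemma char_distr_density:
  fixes W :: "'a \<Rightarrow> real" and f :: "'a \<Rightarrow> real"
  assumes "prob_space K" and c: "c > 0" "c = (\<integral>x. f x \<partial>K)"
    and f: "integrable K f" "\<And>x. 0 \<le> f x"
    and W [measurable]: "W \<in> borel_measurable K"
  shows "real_distribution (distr (density K (\<lambda>x. ennreal (f x / c))) borel W)"
    and "char (distr (density K (\<lambda>x. ennreal (f x / c))) borel W) s = (\<integral>x. complex_of_real (f x) * iexp (s * W x) \<partial>K) / c"
    and "B \<in> sets borel \<Longrightarrow> measure (distr (density K (\<lambda>x. ennreal (f x / c))) borel W) B = (\<integral>x. f x * indicator B (W x) \<partial>K) / c"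
proof -
  interpret K: prob_space K by fact
  let ?D = "density K (\<lambda>x. ennreal (f x / c))"
  have [measurable]: "f \<in> borel_measurable K" using f by auto
  have "(\<integral>\<^sup>+x. ennreal (f x / c) \<partial>K) = ennreal (\<integral>x. f x / c \<partial>K)"
    using f c(1) by (intro nn_integral_eq_integral) auto
  also have "(\<integral>x. f x / c \<partial>K) = 1" using c by simp
  finally have p: "prob_space ?D"
    by (intro prob_spaceI) (simp add: emeasure_density cong: nn_integral_cong)
  then interpret D: prob_space ?D .
  show "measure (distr ?D borel W) B = (\<integral>x. f x * indicator B (W x) \<partial>K) / c" if [measurable]: "B \<in> sets borel"
  proof -
    have "measure (distr ?D borel W) B = (\<integral>x. indicator B x \<partial>distr ?D borel W)"
      by simp
    also have "\<dots> = (\<integral>x. indicator B (W x) \<partial>?D)"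
      by (rule integral_distr) measurable
    also have "\<dots> = (\<integral>x. (f x / c) *\<^sub>R indicator B (W x) \<partial>K)"
      using f c(1) by (intro integral_density) auto
    finally show ?thesis by simp
  qed
  have "char (distr ?D borel W) s = (\<integral>x. iexp (s * W x) \<partial>?D)"
    unfolding char_def by (rule integral_distr) measurable
  also have "\<dots> = (\<integral>x. (f x / c) *\<^sub>R iexp (s * W x) \<partial>K)"
    using f c(1) by (intro integral_density) auto
  also have "\<dots> = (\<integral>x. complex_of_real (f x) * iexp (s * W x) / c \<partial>K)"
    by (simp add: scaleR_conv_of_real)
  also have "\<dots> = (\<integral>x. complex_of_real (f x) * iexp (s * W x) \<partial>K) / c"
    by (rule integral_divide_zero)
  finally show "char (distr ?D borel W) s = (\<integral>x. complex_of_real (f x) * iexp (s * W x) \<partial>K) / c" .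
  show "real_distribution (distr ?D borel W)"
    by (intro D.real_distribution_distr) measurable
qed

text \<open>At \<open>s = 0\<close> the hypothesis says that both weights have the same mass
  \<open>c\<close>. If \<open>c\<close> is positive, Levy's uniqueness theorem is applied to the
  normalized laws; otherwise both weights vanish almost everywhere.\<close>

lemma weighted_char_unique:
  fixes X :: "'a \<Rightarrow> real" and Y :: "'b \<Rightarrow> real" and g :: "'a \<Rightarrow> real" and h :: "'b \<Rightarrow> real"
  assumes "prob_space M" "prob_space N"
    and X [measurable]: "X \<in> borel_measurable M" and Y [measurable]: "Y \<in> borel_measurable N"
    and g [measurable]: "g \<in> borel_measurable M" and h [measurable]: "h \<in> borel_measurable N"
    and gb: "\<And>x. 0 \<le> g x" "\<And>x. g x \<le> C" and hb: "\<And>x. 0 \<le> h x" "\<And>x. h x \<le> C"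
    and eq: "\<And>s. (\<integral>x. complex_of_real (g x) * iexp (s * X x) \<partial>M) = (\<integral>x. complex_of_real (h x) * iexp (s * Y x) \<partial>N)"
    and B [measurable]: "B \<in> sets borel"
  shows "(\<integral>x. g x * indicator B (X x) \<partial>M) = (\<integral>x. h x * indicator B (Y x) \<partial>N)"
proof -
  interpret M: prob_space M by fact
  interpret N: prob_space N by fact
  have intg: "integrable M g" using gb by (intro M.integrable_const_bound[where B = C]) auto
  have inth: "integrable N h" using hb by (intro N.integrable_const_bound[where B = C]) auto
  define c where "c = (\<integral>x. g x \<partial>M)"
  have c': "c = (\<integral>x. h x \<partial>N)"
    using eq[of 0] by (simp add: c_def)
  have "c \<ge> 0" unfolding c_def using gb by (intro integral_nonneg_AE) auto
  show ?thesis
  proof (cases "c = 0")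
    case True
    have "AE x in M. g x = 0" using True intg gb integral_nonneg_eq_0_iff_AE[of M g] by (simp add: c_def)
    moreover have "AE x in N. h x = 0" using True inth hb integral_nonneg_eq_0_iff_AE[of N h] by (simp add: c')
    ultimately show ?thesis by (subst (1 2) integral_cong_AE[where g = "\<lambda>_. 0"]) auto
  next
    case False
    hence "c > 0" using \<open>c \<ge> 0\<close> by simp
    note 1 = char_distr_density[OF \<open>prob_space M\<close> \<open>c > 0\<close> c_def intg gb(1) X]
    note 2 = char_distr_density[OF \<open>prob_space N\<close> \<open>c > 0\<close> c' inth hb(1) Y]
    have "distr (density M (\<lambda>x. ennreal (g x / c))) borel X = distr (density N (\<lambda>x. ennreal (h x / c))) borel Y"
      by (rule Levy_uniqueness[OF 1(1) 2(1)]) (simp only: fun_eq_iff 1(2) 2(2) eq simp_thms)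
    hence "(\<integral>x. g x * indicator B (X x) \<partial>M) / c = (\<integral>x. h x * indicator B (Y x) \<partial>N) / c"
      unfolding 1(3)[OF B, symmetric] 2(3)[OF B, symmetric] by simp
    thus ?thesis using \<open>c > 0\<close> by simp
  qed
qed

lemma integral_lincomb3:
  fixes F G H :: "'a \<Rightarrow> complex"
  assumes "integrable M F" "integrable M G" "integrable M H"
  shows "(\<integral>x. a * F x + b * G x + c * H x \<partial>M) = a * (\<integral>x. F x \<partial>M) + b * (\<integral>x. G x \<partial>M) + c * (\<integral>x. H x \<partial>M)"
  using assms by simp

lemma integral_of_real_Re_Im:
  fixes F G :: "'a \<Rightarrow> real"
  assumes "integrable M F" "integrable M G"
  shows "(\<integral>x. complex_of_real (F x) + \<i> * complex_of_real (G x) \<partial>M) =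
    complex_of_real (\<integral>x. F x \<partial>M) + \<i> * complex_of_real (\<integral>x. G x \<partial>M)"
  using assms by simp

definition box_indicator :: "'i set \<Rightarrow> ('i \<Rightarrow> real set) \<Rightarrow> ('i \<Rightarrow> 'a \<Rightarrow> real) \<Rightarrow> 'a \<Rightarrow> real" where
  "box_indicator J A X \<omega> = (\<Prod>j\<in>J. indicator (A j) (X j \<omega>))"

lemma box_indicator_bounds: "0 \<le> box_indicator J A X \<omega>" "box_indicator J A X \<omega> \<le> 1"
  unfolding box_indicator_def by (auto intro!: prod_nonneg prod_le_1)

lemma measurable_box_indicator:
  assumes "\<And>j. j \<in> J \<Longrightarrow> A j \<in> sets borel" "\<And>j. j \<in> J \<Longrightarrow> X j \<in> borel_measurable M"
  shows "box_indicator J A X \<in> borel_measurable M"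
  unfolding box_indicator_def[abs_def] using assms
  by (intro borel_measurable_prod measurable_compose[OF _ borel_measurable_indicator]) auto

lemma emeasure_distr_box:
  assumes "prob_space M" "finite I"
    and Z: "\<And>i. i \<in> I \<Longrightarrow> Z i \<in> borel_measurable M" and A: "\<And>i. i \<in> I \<Longrightarrow> A i \<in> sets borel"
  shows "emeasure (distr M (Pi\<^sub>M I (\<lambda>_. borel)) (\<lambda>\<omega>. \<lambda>i\<in>I. Z i \<omega>)) (Pi\<^sub>E I A) = ennreal (\<integral>\<omega>. box_indicator I A Z \<omega> \<partial>M)"
proof -
  interpret M: prob_space M by fact
  have m: "(\<lambda>\<omega>. \<lambda>i\<in>I. Z i \<omega>) \<in> M \<rightarrow>\<^sub>M Pi\<^sub>M I (\<lambda>_. borel)"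
    by (intro measurable_restrict Z)
  have s: "Pi\<^sub>E I A \<in> sets (Pi\<^sub>M I (\<lambda>_. borel))"
    using A \<open>finite I\<close> by (intro sets_PiM_I_finite) auto
  define D where "D = (\<lambda>\<omega>. \<lambda>i\<in>I. Z i \<omega>) -` Pi\<^sub>E I A \<inter> space M"
  have [measurable]: "D \<in> sets M" unfolding D_def using m s by (rule measurable_sets)
  have "emeasure (distr M (Pi\<^sub>M I (\<lambda>_. borel)) (\<lambda>\<omega>. \<lambda>i\<in>I. Z i \<omega>)) (Pi\<^sub>E I A) = emeasure M D"
    unfolding D_def using m s by (rule emeasure_distr)
  also have "\<dots> = ennreal (\<integral>\<omega>. indicator D \<omega> \<partial>M)" by (simp add: M.emeasure_eq_measure)
  also have "(\<integral>\<omega>. indicator D \<omega> \<partial>M) = (\<integral>\<omega>. box_indicator I A Z \<omega> \<partial>M)"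
  proof (rule Bochner_Integration.integral_cong[OF refl])
    fix \<omega> assume "\<omega> \<in> space M"
    hence "\<omega> \<in> D \<longleftrightarrow> (\<forall>i\<in>I. Z i \<omega> \<in> A i)" by (auto simp: D_def PiE_iff)
    thus "indicator D \<omega> = box_indicator I A Z \<omega>"
      using \<open>finite I\<close> by (auto simp: box_indicator_def indicator_def)
  qed
  finally show ?thesis .
qed

text \<open>Uniqueness of multivariate characteristic functions, derived from the one-dimensional
  theorem. Coordinates are treated one after another: those in \<open>J\<close> have already been
  replaced by indicators, the others still occur in the exponential. For the next coordinate the
  rest of the integrand acts as a weight. A weight must be nonnegative, so the remaining exponential
  is reached through \<open>1 + cos\<close> and \<open>1 + sin\<close>.\<close>

theorem distr_PiM_eqI_char:
  fixes X :: "'i \<Rightarrow> 'a \<Rightarrow> real" and Y :: "'i \<Rightarrow> 'b \<Rightarrow> real"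
  assumes "finite I" "prob_space M" "prob_space N"
    and X: "\<And>i. i \<in> I \<Longrightarrow> X i \<in> borel_measurable M"
    and Y: "\<And>i. i \<in> I \<Longrightarrow> Y i \<in> borel_measurable N"
    and eq: "\<And>t. (\<integral>\<omega>. iexp (\<Sum>i\<in>I. t i * X i \<omega>) \<partial>M) = (\<integral>\<omega>. iexp (\<Sum>i\<in>I. t i * Y i \<omega>) \<partial>N)"
  shows "distr M (Pi\<^sub>M I (\<lambda>_. borel)) (\<lambda>\<omega>. \<lambda>i\<in>I. X i \<omega>) = distr N (Pi\<^sub>M I (\<lambda>_. borel)) (\<lambda>\<omega>. \<lambda>i\<in>I. Y i \<omega>)"
proof -
  interpret M: prob_space M by fact
  interpret N: prob_space N by fact
  have main: "(\<integral>\<omega>. complex_of_real (box_indicator J A X \<omega>) * iexp (\<Sum>i\<in>I-J. t i * X i \<omega>) \<partial>M) =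
              (\<integral>\<omega>. complex_of_real (box_indicator J A Y \<omega>) * iexp (\<Sum>i\<in>I-J. t i * Y i \<omega>) \<partial>N)"
    if "finite J" "J \<subseteq> I" "\<And>j. j \<in> J \<Longrightarrow> A j \<in> sets borel" for J A t
    using that
  proof (induction J arbitrary: t rule: finite_induct)
    case empty
    show ?case using eq[of t] by (simp add: box_indicator_def)
  next
    case (insert j J)
    have j: "j \<in> I" "j \<notin> J" and JI: "J \<subseteq> I" using insert by auto
    note IH = insert.IH[OF JI insert.prems(2)[OF insertI2]]
    have [measurable]: "X i \<in> borel_measurable M" "Y i \<in> borel_measurable N" if "i \<in> I" for i
      using that X Y by auto
    have Am [measurable]: "A i \<in> sets borel" if "i \<in> insert j J" for i using insert.prems(2) that by blast
    let ?T = "\<lambda>X t \<omega>. \<Sum>i\<in>I - insert j J. t i * X i \<omega>"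
    have UX [measurable]: "box_indicator J A X \<in> borel_measurable M" and UY [measurable]: "box_indicator J A Y \<in> borel_measurable N"
      using JI by (auto intro!: measurable_box_indicator X Y Am)
    have TX [measurable]: "?T X t \<in> borel_measurable M" and TY [measurable]: "?T Y t \<in> borel_measurable N" for t
      by (auto intro!: borel_measurable_sum borel_measurable_times X Y)
    have IH': "(\<integral>\<omega>. complex_of_real (box_indicator J A X \<omega>) * iexp (s * X j \<omega> + ?T X t \<omega>) \<partial>M) =
               (\<integral>\<omega>. complex_of_real (box_indicator J A Y \<omega>) * iexp (s * Y j \<omega> + ?T Y t \<omega>) \<partial>N)" for s t
    proof -
      have "(\<Sum>i\<in>I-J. (t(j := s)) i * W i) = s * W j + (\<Sum>i\<in>I - insert j J. t i * W i)" for W :: "'i \<Rightarrow> real"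
      proof -
        have "I - J - {j} = I - insert j J" by auto
        hence "(\<Sum>i\<in>I-J. (t(j := s)) i * W i) = s * W j + (\<Sum>i\<in>I - insert j J. (t(j := s)) i * W i)"
          using sum.remove[of "I - J" j "\<lambda>i. (t(j := s)) i * W i"] j \<open>finite I\<close> by auto
        also have "(\<Sum>i\<in>I - insert j J. (t(j := s)) i * W i) = (\<Sum>i\<in>I - insert j J. t i * W i)"
          by (intro sum.cong) auto
        finally show ?thesis .
      qed
      thus ?thesis using IH[of "t(j := s)"] by simp
    qed
    \<comment> \<open>The weight \<open>f\<close> is a combination of exponentials in the remaining
      sum, so the induction hypothesis covers it with the frequency vectors 0, \<open>t\<close> and
      \<open>- t\<close>.\<close>
    have W: "(\<integral>\<omega>. box_indicator J A X \<omega> * f (?T X t \<omega>) * indicator (A j) (X j \<omega>) \<partial>M) =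
             (\<integral>\<omega>. box_indicator J A Y \<omega> * f (?T Y t \<omega>) * indicator (A j) (Y j \<omega>) \<partial>N)"
      if f: "f \<in> borel_measurable borel" "\<And>x. 0 \<le> f x" "\<And>x. f x \<le> 2"
        and rep: "\<And>x. complex_of_real (f x) = a + b * iexp x + c * iexp (- x)"
      for f :: "real \<Rightarrow> real" and a b c :: complex
    proof (rule weighted_char_unique[where C = 2, OF \<open>prob_space M\<close> \<open>prob_space N\<close>])
      note [measurable] = f(1)
      show "(\<lambda>\<omega>. box_indicator J A X \<omega> * f (?T X t \<omega>)) \<in> borel_measurable M" by measurable
      show "(\<lambda>\<omega>. box_indicator J A Y \<omega> * f (?T Y t \<omega>)) \<in> borel_measurable N" by measurable
      have b: "u * f x \<le> 2" if "0 \<le> u" "u \<le> 1" for u x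
        using mult_mono[of u 1 "f x" 2] that f by auto
      thus "box_indicator J A X \<omega> * f (?T X t \<omega>) \<le> 2" "box_indicator J A Y \<omega>' * f (?T Y t \<omega>') \<le> 2" for \<omega> \<omega>'
        by (simp_all add: b box_indicator_bounds)
      show "0 \<le> box_indicator J A X \<omega> * f (?T X t \<omega>)" "0 \<le> box_indicator J A Y \<omega>' * f (?T Y t \<omega>')" for \<omega> \<omega>'
        by (simp_all add: box_indicator_bounds f)
      fix s
      have e: "complex_of_real (u * f x) * iexp (s * w) = a * (of_real u * iexp (s * w)) +
          b * (of_real u * iexp (s * w + x)) + c * (of_real u * iexp (s * w + - x))" for u x w
        by (simp add: rep distrib_left distrib_right exp_add exp_diff exp_minus field_simps)
      have neg: "- ?T X t \<omega> = ?T X (\<lambda>i. - t i) \<omega>" "- ?T Y t \<omega>' = ?T Y (\<lambda>i. - t i) \<omega>'" for \<omega> \<omega>'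
        by (simp_all add: sum_negf)
      have IH0: "(\<integral>\<omega>. complex_of_real (box_indicator J A X \<omega>) * iexp (s * X j \<omega>) \<partial>M) =
               (\<integral>\<omega>. complex_of_real (box_indicator J A Y \<omega>) * iexp (s * Y j \<omega>) \<partial>N)"
        using IH'[of s "\<lambda>_. 0"] by simp
      have iX: "integrable M (\<lambda>\<omega>. complex_of_real (box_indicator J A X \<omega>) * iexp (s * X j \<omega> + ?T X t \<omega>))" for t
        using j by (intro M.integral_bounded_mult[where C = 1]) (auto simp: box_indicator_bounds)
      have iY: "integrable N (\<lambda>\<omega>. complex_of_real (box_indicator J A Y \<omega>) * iexp (s * Y j \<omega> + ?T Y t \<omega>))" for t
        using j by (intro N.integral_bounded_mult[where C = 1]) (auto simp: box_indicator_bounds)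
      have iX0: "integrable M (\<lambda>\<omega>. complex_of_real (box_indicator J A X \<omega>) * iexp (s * X j \<omega>))"
        using iX[of "\<lambda>_. 0"] by simp
      have iY0: "integrable N (\<lambda>\<omega>. complex_of_real (box_indicator J A Y \<omega>) * iexp (s * Y j \<omega>))"
        using iY[of "\<lambda>_. 0"] by simp
      have "(\<integral>\<omega>. complex_of_real (box_indicator J A X \<omega> * f (?T X t \<omega>)) * iexp (s * X j \<omega>) \<partial>M) =
        a * (\<integral>\<omega>. complex_of_real (box_indicator J A X \<omega>) * iexp (s * X j \<omega>) \<partial>M) +
        b * (\<integral>\<omega>. complex_of_real (box_indicator J A X \<omega>) * iexp (s * X j \<omega> + ?T X t \<omega>) \<partial>M) +
        c * (\<integral>\<omega>. complex_of_real (box_indicator J A X \<omega>) * iexp (s * X j \<omega> + ?T X (\<lambda>i. - t i) \<omega>) \<partial>M)"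
        unfolding e neg
        by (rule integral_lincomb3[OF iX0 iX iX])
      also have "\<dots> = a * (\<integral>\<omega>. complex_of_real (box_indicator J A Y \<omega>) * iexp (s * Y j \<omega>) \<partial>N) +
        b * (\<integral>\<omega>. complex_of_real (box_indicator J A Y \<omega>) * iexp (s * Y j \<omega> + ?T Y t \<omega>) \<partial>N) +
        c * (\<integral>\<omega>. complex_of_real (box_indicator J A Y \<omega>) * iexp (s * Y j \<omega> + ?T Y (\<lambda>i. - t i) \<omega>) \<partial>N)"
        by (simp only: IH0 IH')
      also have "\<dots> = (\<integral>\<omega>. complex_of_real (box_indicator J A Y \<omega> * f (?T Y t \<omega>)) * iexp (s * Y j \<omega>) \<partial>N)"
        unfolding e neg
        by (rule integral_lincomb3[OF iY0 iY iY, symmetric])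
      finally show "(\<integral>\<omega>. complex_of_real (box_indicator J A X \<omega> * f (?T X t \<omega>)) * iexp (s * X j \<omega>) \<partial>M) =
        (\<integral>\<omega>. complex_of_real (box_indicator J A Y \<omega> * f (?T Y t \<omega>)) * iexp (s * Y j \<omega>) \<partial>N)" .
    qed (use j X Y Am in auto)
    have insX: "box_indicator (insert j J) A X \<omega> = box_indicator J A X \<omega> * indicator (A j) (X j \<omega>)" for \<omega>
      using insert.hyps by (simp add: box_indicator_def)
    have insY: "box_indicator (insert j J) A Y \<omega> = box_indicator J A Y \<omega> * indicator (A j) (Y j \<omega>)" for \<omega>
      using insert.hyps by (simp add: box_indicator_def)
    define g where "g = box_indicator (insert j J) A X"
    define h where "h = box_indicator (insert j J) A Y"
    have gm [measurable]: "g \<in> borel_measurable M" and hm [measurable]: "h \<in> borel_measurable N"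
      unfolding g_def h_def using JI j by (auto intro!: measurable_box_indicator X Y Am)
    have gi: "integrable M (\<lambda>\<omega>. g \<omega> * f (?T X t \<omega>))" "integrable N (\<lambda>\<omega>. h \<omega> * f (?T Y t \<omega>))"
      if [measurable]: "f \<in> borel_measurable borel" and "\<And>x. \<bar>f x\<bar> \<le> 1" for f :: "real \<Rightarrow> real"
    proof -
      have b: "\<bar>u * f x\<bar> \<le> 1" if "0 \<le> u" "u \<le> 1" for u x
        using mult_mono[of "\<bar>u\<bar>" 1 "\<bar>f x\<bar>" 1] that \<open>\<And>x. \<bar>f x\<bar> \<le> 1\<close> by (auto simp: abs_mult)
      show "integrable M (\<lambda>\<omega>. g \<omega> * f (?T X t \<omega>))"
      proof (rule M.integrable_const_bound[where B = 1])
        show "(\<lambda>\<omega>. g \<omega> * f (?T X t \<omega>)) \<in> borel_measurable M" by measurable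
      qed (auto simp: g_def box_indicator_bounds intro!: b)
      show "integrable N (\<lambda>\<omega>. h \<omega> * f (?T Y t \<omega>))"
      proof (rule N.integrable_const_bound[where B = 1])
        show "(\<lambda>\<omega>. h \<omega> * f (?T Y t \<omega>)) \<in> borel_measurable N" by measurable
      qed (auto simp: h_def box_indicator_bounds intro!: b)
    qed
    \<comment> \<open>The constant weight gives the equality that is subtracted to get from
      \<open>1 + f\<close> to \<open>f\<close>.\<close>
    have 0: "(\<integral>\<omega>. g \<omega> \<partial>M) = (\<integral>\<omega>. h \<omega> \<partial>N)"
      using W[of "\<lambda>_. 1" 1 0 0] by (simp add: g_def h_def insX insY)
    have W': "(\<integral>\<omega>. g \<omega> * f (?T X t \<omega>) \<partial>M) = (\<integral>\<omega>. h \<omega> * f (?T Y t \<omega>) \<partial>N)"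
      if [measurable]: "f \<in> borel_measurable borel" and fb: "\<And>x. \<bar>f x\<bar> \<le> 1"
        and rep: "\<And>x. complex_of_real (f x) = b * iexp x + c * iexp (- x)" for f b c
    proof -
      have 1: "-1 \<le> f x \<and> f x \<le> 1" for x using fb[of x] by auto
      have "(\<integral>\<omega>. g \<omega> + g \<omega> * f (?T X t \<omega>) \<partial>M) = (\<integral>\<omega>. h \<omega> + h \<omega> * f (?T Y t \<omega>) \<partial>N)"
      proof -
        have "0 \<le> 1 + f x" "1 + f x \<le> 2" for x using 1[of x] by auto
        thus ?thesis
        using W[of "\<lambda>x. 1 + f x" 1 b c]
        by (simp add: rep g_def h_def insX insY algebra_simps)
      qed
      moreover have "integrable M g" "integrable N h" using gi[of "\<lambda>_. 1"] by auto
      ultimately show ?thesis using gi[OF that(1) fb] 0 by simp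
    qed
    have cos: "(\<integral>\<omega>. g \<omega> * cos (?T X t \<omega>) \<partial>M) = (\<integral>\<omega>. h \<omega> * cos (?T Y t \<omega>) \<partial>N)"
      by (rule W'[of cos "1/2" "1/2"]) (auto simp: complex_eq_iff Re_exp Im_exp)
    have sin: "(\<integral>\<omega>. g \<omega> * sin (?T X t \<omega>) \<partial>M) = (\<integral>\<omega>. h \<omega> * sin (?T Y t \<omega>) \<partial>N)"
      by (rule W'[of sin "-\<i>/2" "\<i>/2"]) (auto simp: complex_eq_iff Re_exp Im_exp)
    have split: "of_real u * iexp x = complex_of_real (u * cos x) + \<i> * complex_of_real (u * sin x)" for u x :: real
      by (simp add: complex_eq_iff Re_exp Im_exp)
    have "(\<integral>\<omega>. complex_of_real (g \<omega>) * iexp (?T X t \<omega>) \<partial>M) =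
        complex_of_real (\<integral>\<omega>. g \<omega> * cos (?T X t \<omega>) \<partial>M) + \<i> * complex_of_real (\<integral>\<omega>. g \<omega> * sin (?T X t \<omega>) \<partial>M)"
      unfolding split by (intro integral_of_real_Re_Im gi) auto
    also have "\<dots> = (\<integral>\<omega>. complex_of_real (h \<omega>) * iexp (?T Y t \<omega>) \<partial>N)"
      unfolding split cos sin by (intro integral_of_real_Re_Im[symmetric] gi) auto
    finally show ?case by (simp add: g_def h_def)
  qed
  show ?thesis
  proof (rule measure_eqI_PiM_finite[OF \<open>finite I\<close>])
    fix A assume A: "\<And>i. i \<in> I \<Longrightarrow> A i \<in> sets (borel :: real measure)"
    have "complex_of_real (\<integral>\<omega>. box_indicator I A X \<omega> \<partial>M) = complex_of_real (\<integral>\<omega>. box_indicator I A Y \<omega> \<partial>N)"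
      using main[of I A "\<lambda>_. 0"] \<open>finite I\<close> A by simp
    hence "(\<integral>\<omega>. box_indicator I A X \<omega> \<partial>M) = (\<integral>\<omega>. box_indicator I A Y \<omega> \<partial>N)" by (simp only: of_real_eq_iff)
    thus "emeasure (distr M (Pi\<^sub>M I (\<lambda>_. borel)) (\<lambda>\<omega>. \<lambda>i\<in>I. X i \<omega>)) (Pi\<^sub>E I A) =
      emeasure (distr N (Pi\<^sub>M I (\<lambda>_. borel)) (\<lambda>\<omega>. \<lambda>i\<in>I. Y i \<omega>)) (Pi\<^sub>E I A)"
      using emeasure_distr_box[OF \<open>prob_space M\<close> \<open>finite I\<close> X A] emeasure_distr_box[OF \<open>prob_space N\<close> \<open>finite I\<close> Y A]
      by simp
  next
    show "range (\<lambda>_::nat. Pi\<^sub>E I (\<lambda>_. UNIV)) \<subseteq> prod_algebra I (\<lambda>_. borel :: real measure)"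
      using \<open>finite I\<close> by (auto intro!: prod_algebraI_finite)
    have "finite_measure (distr M (Pi\<^sub>M I (\<lambda>_. borel)) (\<lambda>\<omega>. \<lambda>i\<in>I. X i \<omega>))"
      by (intro M.finite_measure_distr measurable_restrict X)
    thus "emeasure (distr M (Pi\<^sub>M I (\<lambda>_. borel)) (\<lambda>\<omega>. \<lambda>i\<in>I. X i \<omega>)) (Pi\<^sub>E I (\<lambda>_. UNIV)) \<noteq> \<infinity>"
      by (simp add: finite_measure.emeasure_eq_measure)
  qed (auto simp: space_PiM)
qed

section \<open>Laws of families of random vectors\<close>

lemma borel_measurable_vec_lambda:
  fixes f :: "'n :: finite \<Rightarrow> 'a \<Rightarrow> real"
  assumes "\<And>a. f a \<in> borel_measurable M"
  shows "(\<lambda>x. \<chi> a. f a x) \<in> borel_measurable M"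
proof -
  have "(\<lambda>x. \<chi> a. f a x) = (\<lambda>x. \<Sum>a\<in>UNIV. f a x *\<^sub>R axis a 1)"
    by (auto simp: vec_eq_iff axis_def if_distrib cong: if_cong)
  also have "\<dots> \<in> borel_measurable M"
    using assms by (intro borel_measurable_sum borel_measurable_scaleR) auto
  finally show ?thesis .
qed

text \<open>Flattening the index set to \<open>I \<times> UNIV\<close> reduces vectors to scalar
  coordinates; the measurable map \<open>G\<close> reassembles them.\<close>

theorem distr_PiM_vec_eqI_char:
  fixes X :: "'i \<Rightarrow> 'a \<Rightarrow> real ^ 'n" and Y :: "'i \<Rightarrow> 'b \<Rightarrow> real ^ 'n"
  assumes "finite I" "prob_space M" "prob_space N"
    and X: "\<And>i. i \<in> I \<Longrightarrow> X i \<in> borel_measurable M"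
    and Y: "\<And>i. i \<in> I \<Longrightarrow> Y i \<in> borel_measurable N"
    and eq: "\<And>c. (\<integral>\<omega>. iexp (\<Sum>i\<in>I. c i \<bullet> X i \<omega>) \<partial>M) = (\<integral>\<omega>. iexp (\<Sum>i\<in>I. c i \<bullet> Y i \<omega>) \<partial>N)"
  shows "distr M (Pi\<^sub>M I (\<lambda>_. borel)) (\<lambda>\<omega>. \<lambda>i\<in>I. X i \<omega>) = distr N (Pi\<^sub>M I (\<lambda>_. borel)) (\<lambda>\<omega>. \<lambda>i\<in>I. Y i \<omega>)"
proof -
  let ?J = "I \<times> (UNIV :: 'n set)"
  let ?PJ = "Pi\<^sub>M ?J (\<lambda>_. borel :: real measure)" and ?PI = "Pi\<^sub>M I (\<lambda>_. borel :: (real ^ 'n) measure)"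
  define G where "G = (\<lambda>y :: 'i \<times> 'n \<Rightarrow> real. \<lambda>i\<in>I. \<chi> a. y (i, a))"
  have G: "G \<in> ?PJ \<rightarrow>\<^sub>M ?PI"
    unfolding G_def by (intro measurable_restrict borel_measurable_vec_lambda measurable_component_singleton) auto
  have dG: "distr M ?PI (\<lambda>\<omega>. \<lambda>i\<in>I. W i \<omega>) = distr (distr M ?PJ (\<lambda>\<omega>. \<lambda>p\<in>?J. W (fst p) \<omega> $ snd p)) ?PI G"
    if W: "\<And>i. i \<in> I \<Longrightarrow> W i \<in> borel_measurable M" for M :: "'c measure" and W :: "'i \<Rightarrow> 'c \<Rightarrow> real ^ 'n"
  proof -
    have "(\<lambda>\<omega>. \<lambda>p\<in>?J. W (fst p) \<omega> $ snd p) \<in> M \<rightarrow>\<^sub>M ?PJ"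
      by (intro measurable_restrict borel_measurable_vec_nth W) auto
    hence "distr (distr M ?PJ (\<lambda>\<omega>. \<lambda>p\<in>?J. W (fst p) \<omega> $ snd p)) ?PI G =
      distr M ?PI (G \<circ> (\<lambda>\<omega>. \<lambda>p\<in>?J. W (fst p) \<omega> $ snd p))"
      by (rule distr_distr[OF G])
    also have "G \<circ> (\<lambda>\<omega>. \<lambda>p\<in>?J. W (fst p) \<omega> $ snd p) = (\<lambda>\<omega>. \<lambda>i\<in>I. W i \<omega>)"
      by (auto simp: G_def fun_eq_iff vec_eq_iff)
    finally show ?thesis ..
  qed
  have s: "(\<Sum>p\<in>?J. t p * w (fst p) $ snd p) = (\<Sum>i\<in>I. (\<chi> a. t (i, a)) \<bullet> w i)"
    for t and w :: "'i \<Rightarrow> real ^ 'n"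
    using \<open>finite I\<close> by (simp add: sum.cartesian_product' inner_vec_def)
  have "distr M ?PJ (\<lambda>\<omega>. \<lambda>p\<in>?J. X (fst p) \<omega> $ snd p) = distr N ?PJ (\<lambda>\<omega>. \<lambda>p\<in>?J. Y (fst p) \<omega> $ snd p)"
  proof (rule distr_PiM_eqI_char)
    fix t :: "'i \<times> 'n \<Rightarrow> real"
    show "(\<integral>\<omega>. iexp (\<Sum>p\<in>?J. t p * X (fst p) \<omega> $ snd p) \<partial>M) = (\<integral>\<omega>. iexp (\<Sum>p\<in>?J. t p * Y (fst p) \<omega> $ snd p) \<partial>N)"
      unfolding s[of t "\<lambda>i. X i \<omega>" for \<omega>] s[of t "\<lambda>i. Y i \<omega>" for \<omega>] by (rule eq)
  qed (use assms in \<open>auto intro!: borel_measurable_vec_nth\<close>)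
  thus ?thesis using dG[OF X] dG[OF Y] by simp
qed

section \<open>Gaussian vectors\<close>

lemma (in pair_prob_space) integral_prod_mult:
  fixes f :: "'a \<Rightarrow> complex" and g :: "'b \<Rightarrow> complex"
  assumes [measurable]: "f \<in> borel_measurable M1" "g \<in> borel_measurable M2"
    and b: "\<And>x. norm (f x) \<le> 1" "\<And>y. norm (g y) \<le> 1"
  shows "(\<integral>z. f (fst z) * g (snd z) \<partial>(M1 \<Otimes>\<^sub>M M2)) = (\<integral>x. f x \<partial>M1) * (\<integral>y. g y \<partial>M2)"
proof -
  have "norm (f x * g y) \<le> 1" for x y
    using mult_mono[OF b(1)[of x] b(2)[of y]] by (simp add: norm_mult)
  hence "integrable (M1 \<Otimes>\<^sub>M M2) (\<lambda>z. f (fst z) * g (snd z))"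
    by (intro P.integrable_const_bound[where B = 1]) auto
  from integral_fst'[OF this] show ?thesis by simp
qed

section \<open>Determinants of standard Gaussian vectors\<close>

abbreviation "std_normal \<equiv> std_normal_distribution"
abbreviation "std_normal2 \<equiv> std_normal \<Otimes>\<^sub>M std_normal"

lemma prob_space_std_normal: "prob_space std_normal"
  using real_dist_normal_dist by (simp add: real_distribution_def)

lemma pair_prob_space_std_normal: "pair_prob_space std_normal std_normal"
  by (simp add: pair_prob_space_def pair_sigma_finite_def prob_space_std_normal prob_space_imp_sigma_finite)

lemma integral_iexp_std_normal: "(\<integral>x. iexp (t * x) \<partial>std_normal) = exp (- (t\<^sup>2) / 2)"
  using fun_cong[OF char_std_normal_distribution, of t] by (simp add: char_def exp_of_real)

lemma integral_iexp_std_normal_pair: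
  "(\<integral>z. iexp (a * fst z + b * snd z) \<partial>std_normal2) = exp (- (a\<^sup>2 + b\<^sup>2) / 2)"
proof -
  interpret pair_prob_space std_normal std_normal by (rule pair_prob_space_std_normal)
  have "(\<integral>z. iexp (a * fst z + b * snd z) \<partial>std_normal2) =
    (\<integral>z. iexp (a * fst z) * iexp (b * snd z) \<partial>std_normal2)"
    by (simp add: exp_add distrib_left)
  also have "\<dots> = (\<integral>x. iexp (a * x) \<partial>std_normal) * (\<integral>x. iexp (b * x) \<partial>std_normal)"
    by (rule integral_prod_mult) auto
  also have "\<dots> = exp (- (a\<^sup>2 + b\<^sup>2) / 2)"
    by (simp add: integral_iexp_std_normal exp_add[symmetric] add_divide_distrib del: of_real_exp flip: of_real_mult)
  finally show ?thesis .
qed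

lemma nn_integral_abs_std_normal: "(\<integral>\<^sup>+x. ennreal \<bar>x\<bar> \<partial>std_normal) = ennreal (sqrt (2 / pi))"
proof -
  have "has_bochner_integral lborel (\<lambda>x. std_normal_density x * \<bar>x\<bar>) (sqrt (2 / pi))"
    using std_normal_moment_abs_odd[of 0] by simp
  hence "(\<integral>\<^sup>+x. ennreal (std_normal_density x * \<bar>x\<bar>) \<partial>lborel) = ennreal (sqrt (2 / pi))"
    by (intro nn_integral_eq_integrable[THEN iffD2]) (auto simp: has_bochner_integral_iff)
  thus ?thesis by (subst nn_integral_density) (auto simp: ennreal_mult)
qed

text \<open>Both laws have the same characteristic function, which, unlike a density, also covers
  \<open>a = b = 0\<close>.\<close>

lemma distr_lincomb_std_normal:
  "distr std_normal2 borel (\<lambda>z. a * fst z + b * snd z) =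
   distr std_normal borel (\<lambda>w. sqrt (a\<^sup>2 + b\<^sup>2) * w)"
proof (rule Levy_uniqueness)
  interpret pair_prob_space std_normal std_normal by (rule pair_prob_space_std_normal)
  show "real_distribution (distr std_normal2 borel (\<lambda>z. a * fst z + b * snd z))"
    by (rule P.real_distribution_distr) measurable
  show "real_distribution (distr std_normal borel (\<lambda>w. sqrt (a\<^sup>2 + b\<^sup>2) * w))"
    by (rule M1.real_distribution_distr) measurable
  show "char (distr std_normal2 borel (\<lambda>z. a * fst z + b * snd z)) =
    char (distr std_normal borel (\<lambda>w. sqrt (a\<^sup>2 + b\<^sup>2) * w))"
  proof
    fix t
    have "char (distr std_normal2 borel (\<lambda>z. a * fst z + b * snd z)) t =
      (\<integral>z. iexp ((t * a) * fst z + (t * b) * snd z) \<partial>std_normal2)"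
      unfolding char_def by (subst integral_distr) (auto simp: algebra_simps)
    also have "\<dots> = (\<integral>w. iexp ((t * sqrt (a\<^sup>2 + b\<^sup>2)) * w) \<partial>std_normal)"
      unfolding integral_iexp_std_normal_pair integral_iexp_std_normal
      by (simp add: power_mult_distrib distrib_left)
    also have "\<dots> = char (distr std_normal borel (\<lambda>w. sqrt (a\<^sup>2 + b\<^sup>2) * w)) t"
      unfolding char_def by (subst integral_distr) (auto simp: algebra_simps)
    finally show "char (distr std_normal2 borel (\<lambda>z. a * fst z + b * snd z)) t =
      char (distr std_normal borel (\<lambda>w. sqrt (a\<^sup>2 + b\<^sup>2) * w)) t" .
  qed
qed

lemma nn_integral_abs_lincomb_std_normal:
  "(\<integral>\<^sup>+z. ennreal \<bar>a * fst z + b * snd z\<bar> \<partial>std_normal2) =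
   ennreal (sqrt (a\<^sup>2 + b\<^sup>2)) * ennreal (sqrt (2 / pi))"
proof -
  have "(\<integral>\<^sup>+z. ennreal \<bar>a * fst z + b * snd z\<bar> \<partial>std_normal2) =
    (\<integral>\<^sup>+x. ennreal \<bar>x\<bar> \<partial>distr std_normal2 borel (\<lambda>z. a * fst z + b * snd z))"
    by (subst nn_integral_distr) auto
  also have "\<dots> = (\<integral>\<^sup>+x. ennreal (sqrt (a\<^sup>2 + b\<^sup>2)) * ennreal \<bar>x\<bar> \<partial>std_normal)"
    unfolding distr_lincomb_std_normal by (subst nn_integral_distr) (auto simp: abs_mult ennreal_mult)
  also have "\<dots> = ennreal (sqrt (a\<^sup>2 + b\<^sup>2)) * ennreal (sqrt (2 / pi))"
    by (subst nn_integral_cmult) (auto simp: nn_integral_abs_std_normal)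
  finally show ?thesis .
qed

lemma nn_integral_inverse_1_plus_square: "(\<integral>\<^sup>+s. ennreal (inverse (1 + s\<^sup>2)) \<partial>lborel) = ennreal pi"
proof -
  have "integrable lborel (\<lambda>x::real. inverse (1 + x\<^sup>2))"
    using integrable_inverse_1_plus_square by (simp add: set_integrable_def)
  moreover have "(LBINT x. inverse (1 + x\<^sup>2 :: real)) = pi"
    using LBINT_inverse_1_plus_square by (simp add: interval_lebesgue_integral_def set_lebesgue_integral_def)
  ultimately show ?thesis
    by (subst nn_integral_eq_integral) auto
qed

text \<open>Polar coordinates are avoided by the substitution \<open>y = x s\<close>, which turns the double integral into one over \<open>1 / (1 + s\<^sup>2)\<close>.\<close>

lemma nn_integral_norm_std_normal_pair:
  "(\<integral>\<^sup>+z. ennreal (sqrt ((fst z)\<^sup>2 + (snd z)\<^sup>2)) \<partial>std_normal2) = ennreal (sqrt (pi / 2))"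
proof -
  interpret pair_prob_space std_normal std_normal by (rule pair_prob_space_std_normal)
  define h where "h x y = ennreal (std_normal_density x * (std_normal_density y * sqrt (x\<^sup>2 + y\<^sup>2)))" for x y
  have "(\<integral>\<^sup>+z. ennreal (sqrt ((fst z)\<^sup>2 + (snd z)\<^sup>2)) \<partial>std_normal2) =
     (\<integral>\<^sup>+x. \<integral>\<^sup>+y. ennreal (sqrt (x\<^sup>2 + y\<^sup>2)) \<partial>std_normal \<partial>std_normal)"
    by (subst M1.nn_integral_fst[symmetric]) auto
  also have "\<dots> = (\<integral>\<^sup>+x. (\<integral>\<^sup>+y. h x y \<partial>lborel) \<partial>lborel)"
    unfolding h_def
    by (simp add: nn_integral_density nn_integral_cmult[symmetric] ennreal_mult)
  also have "\<dots> = (\<integral>\<^sup>+x. (\<integral>\<^sup>+s. ennreal \<bar>x\<bar> * h x (x * s) \<partial>lborel) \<partial>lborel)"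
  proof (rule nn_integral_cong_AE)
    \<comment> \<open>The substitution is invertible only for \<open>x \<noteq> 0\<close>.\<close>
    have "AE x in lborel. x \<noteq> (0::real)" by (rule AE_lborel_singleton)
    thus "AE x in lborel. (\<integral>\<^sup>+y. h x y \<partial>lborel) = (\<integral>\<^sup>+s. ennreal \<bar>x\<bar> * h x (x * s) \<partial>lborel)"
    proof eventually_elim
      case (elim x)
      have "(\<integral>\<^sup>+y. h x y \<partial>lborel) = ennreal \<bar>x\<bar> * (\<integral>\<^sup>+s. h x (0 + x * s) \<partial>lborel)"
        using elim unfolding h_def by (intro nn_integral_real_affine) auto
      also have "\<dots> = (\<integral>\<^sup>+s. ennreal \<bar>x\<bar> * h x (x * s) \<partial>lborel)"
        unfolding h_def by (subst nn_integral_cmult) auto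
      finally show ?case .
    qed
  qed
  also have "\<dots> = (\<integral>\<^sup>+s. (\<integral>\<^sup>+x. ennreal \<bar>x\<bar> * h x (x * s) \<partial>lborel) \<partial>lborel)"
    unfolding h_def by (intro lborel_pair.Fubini') measurable
  also have "\<dots> = (\<integral>\<^sup>+s. ennreal (1 / sqrt (2 * pi)) * ennreal (inverse (1 + s\<^sup>2)) \<partial>lborel)"
  proof (rule nn_integral_cong)
    fix s :: real
    define r where "r = sqrt (1 + s\<^sup>2)"
    have r: "r > 0" "r\<^sup>2 = 1 + s\<^sup>2" unfolding r_def by (auto simp: add_pos_nonneg)
    \<comment> \<open>For fixed \<open>s\<close> the product of the two densities is, up to a
      factor, a centered Gaussian density in \<open>x\<close> with variance
      \<open>1 / (1 + s\<^sup>2)\<close>, so the inner integral is a second moment.\<close>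
    have "ennreal \<bar>x\<bar> * h x (x * s) = ennreal (1 / sqrt (2 * pi)) * ennreal (normal_density 0 (1 / r) x * x\<^sup>2)" for x
    proof -
      define E F c where "E = exp (- x\<^sup>2 / 2)" and "F = exp (- (x * s)\<^sup>2 / 2)" and "c = sqrt (2 * pi)"
      have sq: "sqrt (x\<^sup>2 + (x * s)\<^sup>2) = \<bar>x\<bar> * r"
        unfolding r_def by (simp add: power_mult_distrib real_sqrt_mult[symmetric] flip: real_sqrt_abs) (simp add: algebra_simps)
      have "E * F = exp (- x\<^sup>2 / (2 * (1 / r)\<^sup>2))"
        unfolding E_def F_def
        by (simp add: exp_add[symmetric] power_divide r power_mult_distrib algebra_simps add_divide_distrib)
      moreover have "sqrt (2 * pi * (1 / r)\<^sup>2) = c / r"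
        unfolding c_def using r(1) by (simp add: real_sqrt_mult)
      ultimately have n: "normal_density 0 (1 / r) x = r * (E * F) / c"
        unfolding normal_density_def by simp
      have m: "std_normal_density x = E / c" "std_normal_density (x * s) = F / c"
        by (simp_all add: std_normal_density_def E_def F_def c_def)
      have "\<bar>x\<bar> * (std_normal_density x * (std_normal_density (x * s) * sqrt (x\<^sup>2 + (x * s)\<^sup>2))) =
        (\<bar>x\<bar> * \<bar>x\<bar>) * r * E * F / (c * c)"
        unfolding sq m by simp
      also have "\<dots> = 1 / c * (normal_density 0 (1 / r) x * x\<^sup>2)"
        unfolding n by (simp add: power2_eq_square)
      finally have "\<bar>x\<bar> * (std_normal_density x * (std_normal_density (x * s) * sqrt (x\<^sup>2 + (x * s)\<^sup>2))) =
        1 / sqrt (2 * pi) * (normal_density 0 (1 / r) x * x\<^sup>2)" by (simp add: c_def)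
      thus ?thesis unfolding h_def by (simp only: ennreal_mult[symmetric] abs_ge_zero normal_density_nonneg mult_nonneg_nonneg real_sqrt_ge_zero sum_power2_ge_zero zero_le_power2 zero_le_divide_1_iff)
         (simp add: ennreal_mult[symmetric])
    qed
    hence "(\<integral>\<^sup>+x. ennreal \<bar>x\<bar> * h x (x * s) \<partial>lborel) =
      ennreal (1 / sqrt (2 * pi)) * (\<integral>\<^sup>+x. ennreal (normal_density 0 (1 / r) x * x\<^sup>2) \<partial>lborel)"
      by (simp add: nn_integral_cmult)
    also have "(\<integral>\<^sup>+x. ennreal (normal_density 0 (1 / r) x * x\<^sup>2) \<partial>lborel) = ennreal (inverse (1 + s\<^sup>2))"
    proof -
      have "has_bochner_integral lborel (\<lambda>x. normal_density 0 (1 / r) x * (x - 0) ^ (2 * 1)) (fact (2 * 1) / ((2 / (1 / r)\<^sup>2) ^ 1 * fact 1))"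
        using r by (intro normal_moment_even) auto
      hence "has_bochner_integral lborel (\<lambda>x. normal_density 0 (1 / r) x * x\<^sup>2) (inverse (1 + s\<^sup>2))"
      proof -
        have "fact (2 * 1) / ((2 / (1 / r)\<^sup>2) ^ 1 * fact 1) = inverse (r\<^sup>2)"
          using r(1) by (simp add: power_divide field_simps)
        thus ?thesis using \<open>has_bochner_integral _ _ _\<close> by (simp only: r(2) diff_0_right mult_1_right)
      qed
      thus ?thesis
        by (intro nn_integral_eq_integrable[THEN iffD2]) (auto simp: has_bochner_integral_iff)
    qed
    finally show "(\<integral>\<^sup>+x. ennreal \<bar>x\<bar> * h x (x * s) \<partial>lborel) =
      ennreal (1 / sqrt (2 * pi)) * ennreal (inverse (1 + s\<^sup>2))" .
  qed
  also have "\<dots> = ennreal (1 / sqrt (2 * pi)) * ennreal pi"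
    by (subst nn_integral_cmult) (auto simp: nn_integral_inverse_1_plus_square)
  also have "\<dots> = ennreal (sqrt (pi / 2))"
  proof -
    have "pi = sqrt pi * sqrt pi" by simp
    hence "1 / sqrt (2 * pi) * pi = sqrt (pi / 2)"
      by (simp add: real_sqrt_mult real_sqrt_divide field_simps)
    thus ?thesis by (simp add: ennreal_mult[symmetric])
  qed
  finally show ?thesis .
qed

abbreviation "std_normal4 \<equiv> std_normal2 \<Otimes>\<^sub>M std_normal2"

lemma pair_prob_space_std_normal4:
  "pair_prob_space std_normal2 std_normal2"
proof -
  interpret pair_prob_space std_normal std_normal by (rule pair_prob_space_std_normal)
  show ?thesis by (simp add: pair_prob_space_def pair_sigma_finite_def P.prob_space_axioms P.sigma_finite_measure_axioms)
qed

text \<open>Given the first vector, the determinant is a centered Gaussian whose standard deviation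
  is the norm of that vector. The factors \<open>sqrt (2 / pi)\<close> and
  \<open>sqrt (pi / 2)\<close>, from the mean absolute value and the mean norm, cancel.\<close>

lemma nn_integral_abs_det_std_normal:
  "(\<integral>\<^sup>+z. ennreal \<bar>fst (fst z) * snd (snd z) - snd (fst z) * fst (snd z)\<bar> \<partial>std_normal4) = 1"
proof -
  interpret pair_prob_space "std_normal2" "std_normal2"
    by (rule pair_prob_space_std_normal4)
  have "(\<integral>\<^sup>+z. ennreal \<bar>fst (fst z) * snd (snd z) - snd (fst z) * fst (snd z)\<bar> \<partial>std_normal4) =
    (\<integral>\<^sup>+x. \<integral>\<^sup>+y. ennreal \<bar>- snd x * fst y + fst x * snd y\<bar> \<partial>std_normal2 \<partial>std_normal2)"
    by (subst M1.nn_integral_fst[symmetric]) (auto simp: algebra_simps)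
  also have "\<dots> = (\<integral>\<^sup>+x. ennreal (sqrt ((fst x)\<^sup>2 + (snd x)\<^sup>2)) * ennreal (sqrt (2 / pi)) \<partial>std_normal2)"
    unfolding nn_integral_abs_lincomb_std_normal by (simp add: add.commute)
  also have "\<dots> = ennreal (sqrt (pi / 2)) * ennreal (sqrt (2 / pi))"
    by (subst nn_integral_multc) (auto simp: nn_integral_norm_std_normal_pair)
  also have "\<dots> = 1"
    by (simp add: ennreal_mult[symmetric] real_sqrt_mult[symmetric])
  finally show ?thesis .
qed

text \<open>If the first vector has a nonzero first coordinate, then for each value of the third
  coordinate the determinant vanishes at just one value of the fourth, and single points are null
  sets.\<close>

lemma AE_det_std_normal_neq_0:
  "AE z in std_normal4. fst (fst z) * snd (snd z) - snd (fst z) * fst (snd z) \<noteq> 0"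
proof -
  interpret S: pair_prob_space std_normal std_normal by (rule pair_prob_space_std_normal)
  interpret pair_prob_space "std_normal2" "std_normal2"
    by (rule pair_prob_space_std_normal4)
  have point: "AE y in std_normal. y \<noteq> c" for c
    by (subst AE_density) (auto intro: AE_lborel_singleton[THEN AE_mp])
  have "AE x in std_normal2. fst x \<noteq> 0"
  proof (rule S.AE_pair_measure)
    show "{x \<in> space std_normal2. fst x \<noteq> 0} \<in> sets std_normal2"
      by measurable
    show "AE a in std_normal. AE b in std_normal. fst (a, b) \<noteq> 0"
      using point[of 0] by eventually_elim simp
  qed
  hence "AE x in std_normal2. AE y in std_normal2. fst x * snd y - snd x * fst y \<noteq> 0"
  proof eventually_elim
    case (elim x)
    show ?case
    proof (rule S.AE_pair_measure)
      show "{y \<in> space std_normal2. fst x * snd y - snd x * fst y \<noteq> 0} \<in> sets std_normal2"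
        by measurable
      show "AE a in std_normal. AE b in std_normal. fst x * snd (a, b) - snd x * fst (a, b) \<noteq> 0"
      proof (rule AE_I2)
        fix a
        show "AE b in std_normal. fst x * snd (a, b) - snd x * fst (a, b) \<noteq> 0"
          using point[of "snd x * a / fst x"] by eventually_elim (use elim in \<open>auto simp: field_simps\<close>)
      qed
    qed
  qed
  moreover have "{z \<in> space std_normal4. fst (fst z) * snd (snd z) - snd (fst z) * fst (snd z) \<noteq> 0} \<in> sets std_normal4"
    by measurable
  ultimately show ?thesis
    by (intro AE_pair_measure) auto
qed

section \<open>Gaussian variables and characteristic functions of the bridge\<close>

lemma (in prob_space) gaussian_rv_cases:
  assumes "gaussian_rv M Y"
  obtains \<mu> where "distr M borel Y = return borel \<mu>"
  | \<mu> s where "s > 0" "distr M borel Y = distr std_normal borel (\<lambda>x. \<mu> + s * x)"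
proof -
  have [measurable]: "Y \<in> borel_measurable M" using assms by (simp add: gaussian_rv_def)
  obtain \<mu> s where ms: "distr M borel Y = return borel \<mu> \<or>
      (s > 0 \<and> distributed M lborel Y (\<lambda>x. ennreal (normal_density \<mu> s x)))"
    using assms unfolding gaussian_rv_def by blast
  show ?thesis
  proof (cases "distr M borel Y = return borel \<mu>")
    case True thus ?thesis by (rule that(1))
  next
    case False
    hence s: "s > 0" "distributed M lborel Y (\<lambda>x. ennreal (normal_density \<mu> s x))" using ms by auto
    hence "distributed M lborel (\<lambda>x. (Y x - \<mu>) / s) (\<lambda>x. ennreal (std_normal_density x))"
      using normal_standard_normal_convert[OF s(1)] by simp
    hence "distr M lborel (\<lambda>x. (Y x - \<mu>) / s) = std_normal"
      by (simp add: distributed_def)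
    hence "distr std_normal borel (\<lambda>x. \<mu> + s * x) = distr (distr M lborel (\<lambda>x. (Y x - \<mu>) / s)) borel (\<lambda>x. \<mu> + s * x)"
      by simp
    also have "\<dots> = distr M borel ((\<lambda>x. \<mu> + s * x) \<circ> (\<lambda>x. (Y x - \<mu>) / s))"
      by (rule distr_distr) auto
    also have "(\<lambda>x. \<mu> + s * x) \<circ> (\<lambda>x. (Y x - \<mu>) / s) = Y" using s(1) by (auto simp: fun_eq_iff)
    finally show ?thesis using that(2) s(1) by metis
  qed
qed

lemma integrable_std_normal: "integrable std_normal (\<lambda>x. x)" "integrable std_normal (\<lambda>x. x\<^sup>2)"
  and integral_std_normal: "(\<integral>x. x \<partial>std_normal) = 0" "(\<integral>x. x\<^sup>2 \<partial>std_normal) = 1"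
  using integrable_std_normal_distribution_moment[of 1] integrable_std_normal_distribution_moment[of 2]
    integral_std_normal_distribution_moment_odd[of 1] std_normal_distribution_even_moments(1)[of 1]
  by auto

lemma (in prob_space) gaussian_rv_integrable:
  assumes "gaussian_rv M Y"
  shows "integrable M Y" "integrable M (\<lambda>\<omega>. (Y \<omega>)\<^sup>2)"
proof -
  have [measurable]: "Y \<in> borel_measurable M" using assms by (simp add: gaussian_rv_def)
  have "integrable (distr M borel Y) (\<lambda>x. x) \<and> integrable (distr M borel Y) (\<lambda>x. x\<^sup>2)"
    using assms
  proof (cases rule: gaussian_rv_cases)
    case (1 \<mu>)
    thus ?thesis by (simp add: integrable_iff_bounded nn_integral_return)
  next
    case (2 \<mu> s)
    interpret S: prob_space std_normal by (rule prob_space_std_normal)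
    have "(\<mu> + s * x)\<^sup>2 = \<mu>\<^sup>2 + (2 * \<mu> * s) * x + s\<^sup>2 * x\<^sup>2" for x :: real
      by (simp add: power2_eq_square algebra_simps)
    moreover have "integrable std_normal (\<lambda>x. \<mu>\<^sup>2 + (2 * \<mu> * s) * x + s\<^sup>2 * x\<^sup>2)"
      using integrable_std_normal
      by (intro Bochner_Integration.integrable_add integrable_mult_right) auto
    moreover have "integrable std_normal (\<lambda>x. \<mu> + s * x)"
      using integrable_std_normal
      by (intro Bochner_Integration.integrable_add integrable_mult_right) auto
    ultimately show ?thesis unfolding 2 by (simp add: integrable_distr_eq)
  qed
  thus "integrable M Y" "integrable M (\<lambda>\<omega>. (Y \<omega>)\<^sup>2)" by (simp_all add: integrable_distr_eq)
qed

text \<open>A degenerate law must be the point mass at 0 and fits the formula with variance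
  0.\<close>

lemma (in prob_space) gaussian_rv_char:
  assumes g: "gaussian_rv M Y" and 0: "(\<integral>\<omega>. Y \<omega> \<partial>M) = 0"
  shows "(\<integral>\<omega>. iexp (Y \<omega>) \<partial>M) = exp (- (\<integral>\<omega>. (Y \<omega>)\<^sup>2 \<partial>M) / 2)"
proof -
  have [measurable]: "Y \<in> borel_measurable M" using assms by (simp add: gaussian_rv_def)
  have tr: "(\<integral>\<omega>. f (Y \<omega>) \<partial>M) = (\<integral>x. f x \<partial>distr M borel Y)" if "f \<in> borel_measurable borel" for f :: "real \<Rightarrow> 'b :: {banach, second_countable_topology}"
    using that by (subst integral_distr) auto
  have sq: "(\<integral>\<omega>. (Y \<omega>)\<^sup>2 \<partial>M) = (\<integral>x. x\<^sup>2 \<partial>distr M borel Y)" by (rule tr) auto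
  have ie: "(\<integral>\<omega>. iexp (Y \<omega>) \<partial>M) = (\<integral>x. iexp x \<partial>distr M borel Y)" by (rule tr) auto
  have m: "(\<integral>x. x \<partial>distr M borel Y) = 0" using 0 by (subst integral_distr) auto
  show ?thesis using g
  proof (cases rule: gaussian_rv_cases)
    case (1 \<mu>)
    hence "\<mu> = 0" using m by (simp add: integral_return)
    thus ?thesis unfolding sq ie 1 by (simp add: integral_return)
  next
    case (2 \<mu> s)
    interpret S: prob_space std_normal by (rule prob_space_std_normal)
    have "(\<integral>x. x \<partial>distr M borel Y) = (\<integral>x. \<mu> + s * x \<partial>std_normal)"
      unfolding 2 by (rule integral_distr) measurable
    also have "\<dots> = (\<integral>x. \<mu> \<partial>std_normal) + (\<integral>x. s * x \<partial>std_normal)"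
      by (intro Bochner_Integration.integral_add integrable_mult_right integrable_std_normal) simp
    also have "(\<integral>x. s * x \<partial>std_normal) = 0"
      by (simp only: integral_mult_right_zero integral_std_normal mult_zero_right)
    also have "(\<integral>x. \<mu> \<partial>std_normal) = \<mu>" by (simp only: lebesgue_integral_const S.prob_space scaleR_one)
    finally have mu: "\<mu> = 0" using m by simp
    have "(\<integral>x. x\<^sup>2 \<partial>distr M borel Y) = (\<integral>x. (\<mu> + s * x)\<^sup>2 \<partial>std_normal)"
      unfolding 2 by (rule integral_distr) measurable
    also have "\<dots> = s\<^sup>2"
      by (simp only: mu add_0 power_mult_distrib integral_mult_right_zero integral_std_normal mult_1_right)
    finally have "(\<integral>x. x\<^sup>2 \<partial>distr M borel Y) = s\<^sup>2" .
    moreover have "(\<integral>x. iexp x \<partial>distr M borel Y) = (\<integral>x. iexp (\<mu> + s * x) \<partial>std_normal)"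
      unfolding 2 by (rule integral_distr) measurable
    then have "(\<integral>x. iexp x \<partial>distr M borel Y) = exp (- (s\<^sup>2) / 2)"
      by (simp only: mu add_0 integral_iexp_std_normal)
    ultimately show ?thesis unfolding sq ie by simp
  qed
qed

lemma inner_eq_sum_nth: "(x :: real ^ 'n) \<bullet> y = (\<Sum>i\<in>UNIV. x $ i * y $ i)"
  by (simp add: inner_vec_def)

locale bridge_gaussian = prob_space M for M :: "'a measure" +
  fixes B :: "real \<Rightarrow> 'a \<Rightarrow> real ^ 2" and Z :: "'a \<Rightarrow> real ^ 2" and \<sigma> :: real
  assumes bridge: "brownian_bridge M B" and gaussZ: "std_gaussian_vector M Z"
    and indep: "process_indep M {0..1} B Z"
begin

lemma measurable_B: "t \<in> {0..1} \<Longrightarrow> B t \<in> borel_measurable M"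
  using bridge by (auto simp: brownian_bridge_def gaussian_process_def)

lemma measurable_Z: "Z \<in> borel_measurable M"
  using gaussZ by (auto simp: std_gaussian_vector_def distributed_def)

text \<open>Joint Gaussianity is stated for sums over a set of distinct times. Times that
  \<open>f\<close> repeats, as happens for adjacent increments, are merged by adding their
  coefficients.\<close>

lemma gaussian_lincomb_B:
  assumes "finite J" "f ` J \<subseteq> {0..1}"
  shows "gaussian_rv M (\<lambda>\<omega>. \<Sum>j\<in>J. c j \<bullet> B (f j) \<omega>)"
proof -
  have "(\<Sum>j\<in>J. c j \<bullet> B (f j) \<omega>) = (\<Sum>t\<in>f ` J. (\<Sum>j\<in>{j\<in>J. f j = t}. c j) \<bullet> B t \<omega>)" for \<omega>
  proof -
    have "(\<Sum>j\<in>J. c j \<bullet> B (f j) \<omega>) = (\<Sum>t\<in>f ` J. \<Sum>j\<in>{j\<in>J. f j = t}. c j \<bullet> B (f j) \<omega>)"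
      by (rule sum.image_gen[OF assms(1)])
    also have "\<dots> = (\<Sum>t\<in>f ` J. \<Sum>j\<in>{j\<in>J. f j = t}. c j \<bullet> B t \<omega>)"
      by (intro sum.cong) auto
    finally show ?thesis by (simp add: inner_sum_left)
  qed
  moreover have "gaussian_rv M (\<lambda>\<omega>. \<Sum>t\<in>f ` J. (\<Sum>j\<in>{j\<in>J. f j = t}. c j) \<bullet> B t \<omega>)"
  proof -
    have "\<forall>T c. finite T \<and> T \<subseteq> {0..1} \<longrightarrow> gaussian_rv M (\<lambda>\<omega>. \<Sum>t\<in>T. c t \<bullet> B t \<omega>)"
      using bridge by (simp add: brownian_bridge_def gaussian_process_def)
    thus ?thesis using assms by (elim allE[of _ "f ` J"] allE[of _ "\<lambda>t. \<Sum>j\<in>{j\<in>J. f j = t}. c j"]) simp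
  qed
  ultimately show ?thesis by (simp only:)
qed

lemma gaussian_B_nth: "t \<in> {0..1} \<Longrightarrow> gaussian_rv M (\<lambda>\<omega>. B t \<omega> $ i)"
  using gaussian_lincomb_B[of "{()}" "\<lambda>_. t" "\<lambda>_. axis i 1"] by (simp add: inner_axis')

lemma integrable_B:
  assumes "t \<in> {0..1}"
  shows "integrable M (B t)"
proof -
  have eq: "B t = (\<lambda>\<omega>. \<Sum>i\<in>UNIV. B t \<omega> $ i *\<^sub>R axis i 1)"
    by (auto simp: fun_eq_iff vec_eq_iff axis_def if_distrib cong: if_cong)
  show ?thesis
    using gaussian_rv_integrable(1)[OF gaussian_B_nth[OF assms]]
    by (subst eq, intro Bochner_Integration.integrable_sum integrable_scaleR_left) auto
qed

lemma integrable_B_mult: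
  assumes "s \<in> {0..1}" "t \<in> {0..1}"
  shows "integrable M (\<lambda>\<omega>. B s \<omega> $ i * B t \<omega> $ j)"
proof (rule Bochner_Integration.integrable_bound)
  show "integrable M (\<lambda>\<omega>. (B s \<omega> $ i)\<^sup>2 + (B t \<omega> $ j)\<^sup>2)"
    using assms by (intro Bochner_Integration.integrable_add gaussian_rv_integrable(2) gaussian_B_nth)
  show "(\<lambda>\<omega>. B s \<omega> $ i * B t \<omega> $ j) \<in> borel_measurable M"
    using assms by (intro borel_measurable_times borel_measurable_vec_nth measurable_B)
  have "\<bar>x * y\<bar> \<le> x\<^sup>2 + y\<^sup>2" for x y :: real
  proof -
    have "0 \<le> (\<bar>x\<bar> - \<bar>y\<bar>)\<^sup>2" by simp
    hence "2 * (\<bar>x\<bar> * \<bar>y\<bar>) \<le> x\<^sup>2 + y\<^sup>2" by (simp add: power2_diff)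
    moreover have "0 \<le> \<bar>x\<bar> * \<bar>y\<bar>" by simp
    ultimately show ?thesis unfolding abs_mult by linarith
  qed
  thus "AE \<omega> in M. norm (B s \<omega> $ i * B t \<omega> $ j) \<le> norm ((B s \<omega> $ i)\<^sup>2 + (B t \<omega> $ j)\<^sup>2)"
    by simp
qed

text \<open>A centered Gaussian variable is known from its variance, here expanded into the
  covariances of the coordinates.\<close>

lemma char_lincomb_B:
  assumes "finite J" "f ` J \<subseteq> {0..1}"
  shows "(\<integral>\<omega>. iexp (\<Sum>j\<in>J. c j \<bullet> B (f j) \<omega>) \<partial>M) =
    exp (- (\<Sum>j\<in>J. \<Sum>k\<in>J. (min (f j) (f k) - f j * f k) * (c j \<bullet> c k)) / 2)"
proof -
  have f: "f j \<in> {0..1}" if "j \<in> J" for j using assms that by auto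
  let ?Y = "\<lambda>\<omega>. \<Sum>j\<in>J. c j \<bullet> B (f j) \<omega>"
  have mean: "(\<integral>\<omega>. ?Y \<omega> \<partial>M) = 0"
  proof -
    have "(\<integral>\<omega>. B t \<omega> \<partial>M) = 0" if "t \<in> {0..1}" for t
      using bridge that by (auto simp: brownian_bridge_def)
    thus ?thesis using f by (simp add: Bochner_Integration.integral_sum integrable_B integrable_inner_right)
  qed
  have sq: "(?Y \<omega>)\<^sup>2 = (\<Sum>j\<in>J. \<Sum>k\<in>J. \<Sum>a\<in>UNIV. \<Sum>b\<in>UNIV. c j $ a * c k $ b * (B (f j) \<omega> $ a * B (f k) \<omega> $ b))" for \<omega>
    by (simp add: power2_eq_square sum_product inner_eq_sum_nth mult_ac)
  have cov: "(\<integral>\<omega>. B (f j) \<omega> $ a * B (f k) \<omega> $ b \<partial>M) = (min (f j) (f k) - f j * f k) * (if a = b then 1 else 0)"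
    if "j \<in> J" "k \<in> J" for j k a b
    using bridge f[OF that(1)] f[OF that(2)] unfolding brownian_bridge_def mat_def by auto
  have "(\<integral>\<omega>. (?Y \<omega>)\<^sup>2 \<partial>M) = (\<Sum>j\<in>J. \<Sum>k\<in>J. \<Sum>a\<in>UNIV. \<Sum>b\<in>UNIV. c j $ a * c k $ b * (\<integral>\<omega>. B (f j) \<omega> $ a * B (f k) \<omega> $ b \<partial>M))"
  proof -
    let ?T = "\<lambda>j k a b \<omega>. c j $ a * c k $ b * (B (f j) \<omega> $ a * B (f k) \<omega> $ b)"
    have int: "integrable M (?T j k a b)" if "j \<in> J" "k \<in> J" for j k a b
      using f[OF that(1)] f[OF that(2)] by (intro integrable_mult_right integrable_B_mult)
    have "(\<integral>\<omega>. (\<Sum>j\<in>J. \<Sum>k\<in>J. \<Sum>a\<in>UNIV. \<Sum>b\<in>UNIV. ?T j k a b \<omega>) \<partial>M) =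
        (\<Sum>j\<in>J. \<integral>\<omega>. (\<Sum>k\<in>J. \<Sum>a\<in>UNIV. \<Sum>b\<in>UNIV. ?T j k a b \<omega>) \<partial>M)"
      by (intro Bochner_Integration.integral_sum Bochner_Integration.integrable_sum int)
    also have "\<dots> = (\<Sum>j\<in>J. \<Sum>k\<in>J. \<integral>\<omega>. (\<Sum>a\<in>UNIV. \<Sum>b\<in>UNIV. ?T j k a b \<omega>) \<partial>M)"
      by (intro sum.cong[OF refl] Bochner_Integration.integral_sum Bochner_Integration.integrable_sum int)
    also have "\<dots> = (\<Sum>j\<in>J. \<Sum>k\<in>J. \<Sum>a\<in>UNIV. \<integral>\<omega>. (\<Sum>b\<in>UNIV. ?T j k a b \<omega>) \<partial>M)"
      by (intro sum.cong[OF refl] Bochner_Integration.integral_sum Bochner_Integration.integrable_sum int)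
    also have "\<dots> = (\<Sum>j\<in>J. \<Sum>k\<in>J. \<Sum>a\<in>UNIV. \<Sum>b\<in>UNIV. \<integral>\<omega>. ?T j k a b \<omega> \<partial>M)"
      by (intro sum.cong[OF refl] Bochner_Integration.integral_sum int)
    finally show ?thesis unfolding sq by simp
  qed
  also have "\<dots> = (\<Sum>j\<in>J. \<Sum>k\<in>J. (min (f j) (f k) - f j * f k) * (c j \<bullet> c k))"
    by (intro sum.cong refl) (simp add: cov inner_eq_sum_nth sum_distrib_left mult_ac if_distrib cong: if_cong)
  finally show ?thesis
    using gaussian_rv_char[OF gaussian_lincomb_B[OF assms] mean] by simp
qed

text \<open>Lebesgue measure on the plane is a product over the basis vectors, so the integral
  factors into one-dimensional characteristic functions.\<close>

lemma char_Z: "(\<integral>\<omega>. iexp (w \<bullet> Z \<omega>) \<partial>M) = exp (- (w \<bullet> w) / 2)"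
proof -
  interpret N: product_sigma_finite "\<lambda>_. lborel :: real measure" ..
  define F where "F i x = complex_of_real (std_normal_density x) * iexp (w $ i * x)" for i x
  have F: "integrable lborel (F i)" "(\<integral>x. F i x \<partial>lborel) = exp (- ((w $ i)\<^sup>2) / 2)" for i
  proof -
    have "integrable lborel std_normal_density" by simp
    thus "integrable lborel (F i)"
      unfolding F_def by (rule Bochner_Integration.integrable_bound) (auto simp: norm_mult)
    have "(\<integral>x. F i x \<partial>lborel) = (\<integral>x. iexp (w $ i * x) \<partial>std_normal)"
      by (subst integral_density) (auto simp: F_def[abs_def] scaleR_conv_of_real)
    thus "(\<integral>x. F i x \<partial>lborel) = exp (- ((w $ i)\<^sup>2) / 2)" by (simp only: integral_iexp_std_normal)
  qed
  have Zd: "distributed M lborel Z (\<lambda>z. ennreal (\<Prod>i\<in>UNIV. std_normal_density (z $ i)))"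
    using gaussZ by (simp add: std_gaussian_vector_def)
  have "distr M lborel Z = density lborel (\<lambda>z. ennreal (\<Prod>i\<in>UNIV. std_normal_density (z $ i)))"
    using Zd by (simp add: distributed_def)
  have nth [measurable]: "(\<lambda>z::real^2. z $ i) \<in> borel_measurable borel" for i
    by (intro borel_measurable_vec_nth) simp
  have "(\<integral>\<omega>. iexp (w \<bullet> Z \<omega>) \<partial>M) = (\<integral>z. iexp (w \<bullet> z) \<partial>distr M lborel Z)"
    using measurable_Z by (subst integral_distr) auto
  also have "\<dots> = (\<integral>z. (\<Prod>i\<in>UNIV. std_normal_density (z $ i)) *\<^sub>R iexp (w \<bullet> z) \<partial>lborel)"
    unfolding \<open>distr M lborel Z = _\<close>
    by (intro integral_density) (auto intro!: AE_I2 prod_nonneg)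
  also have "\<dots> = (\<integral>z. (\<Prod>i\<in>UNIV. F i (z $ i)) \<partial>lborel)"
    by (intro Bochner_Integration.integral_cong)
       (auto simp: F_def prod.distrib exp_sum[symmetric] inner_eq_sum_nth sum_distrib_left scaleR_conv_of_real)
  also have "\<dots> = (\<integral>f. (\<Prod>i\<in>UNIV. F i ((\<Sum>b\<in>Basis. f b *\<^sub>R b) $ i)) \<partial>(\<Pi>\<^sub>M b\<in>(Basis::(real^2) set). lborel))"
    by (subst lborel_eq, subst integral_distr) (auto simp: F_def)
  \<comment> \<open>\<open>THE i. b = axis i 1\<close> recovers the coordinate from a basis
    vector.\<close>
  also have "\<dots> = (\<integral>f. (\<Prod>b\<in>(Basis::(real^2) set). F (THE i. b = axis i 1) (f b)) \<partial>(\<Pi>\<^sub>M b\<in>(Basis::(real^2) set). lborel))"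
  proof (intro Bochner_Integration.integral_cong refl)
    fix f :: "real ^ 2 \<Rightarrow> real"
    have Basis_eq: "(Basis :: (real^2) set) = (\<lambda>i. axis i 1) ` UNIV"
      by (auto simp: Basis_vec_def)
    have inj: "inj (\<lambda>i::2. axis i (1::real))" by (auto simp: inj_def axis_eq_axis)
    have "(\<Sum>b\<in>Basis. f b *\<^sub>R b) $ i = f (axis i 1)" for i :: 2
      unfolding Basis_eq by (subst sum.reindex[OF inj]) (simp add: axis_def if_distrib cong: if_cong)
    thus "(\<Prod>i\<in>UNIV. F i ((\<Sum>b\<in>Basis. f b *\<^sub>R b) $ i)) = (\<Prod>b\<in>(Basis::(real^2) set). F (THE i. b = axis i 1) (f b))"
      unfolding Basis_eq by (subst prod.reindex[OF inj]) (simp add: axis_eq_axis)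
  qed
  also have "\<dots> = (\<Prod>b\<in>(Basis::(real^2) set). \<integral>x. F (THE i. b = axis i 1) x \<partial>lborel)"
    by (rule N.product_integral_prod) (auto simp: F)
  also have "\<dots> = (\<Prod>i\<in>(UNIV::2 set). exp (- ((w $ i)\<^sup>2) / 2))"
  proof -
    have Basis_eq: "(Basis :: (real^2) set) = (\<lambda>i. axis i 1) ` UNIV"
      by (auto simp: Basis_vec_def)
    have inj: "inj (\<lambda>i::2. axis i (1::real))" by (auto simp: inj_def axis_eq_axis)
    show ?thesis unfolding Basis_eq by (subst prod.reindex[OF inj]) (simp add: axis_eq_axis F)
  qed
  also have "\<dots> = exp (- (w \<bullet> w) / 2)"
    by (simp add: exp_sum[symmetric] inner_eq_sum_nth power2_eq_square sum_negf sum_divide_distrib)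
  finally show ?thesis .
qed

end

section \<open>The increments of the process\<close>

context bridge_gaussian
begin

text \<open>Each functional is measurable for one of the two generated sigma-algebras that
  \<open>process_indep\<close> makes independent. For real variables the product formula for
  characteristic functions of sums is then available.\<close>

lemma indep_var_B_Z:
  assumes "finite J" "f ` J \<subseteq> {0..1}"
  shows "indep_var borel (\<lambda>\<omega>. \<Sum>j\<in>J. c j \<bullet> B (f j) \<omega>) borel (\<lambda>\<omega>. w \<bullet> Z \<omega>)"
proof -
  let ?Y = "\<lambda>\<omega>. \<Sum>j\<in>J. c j \<bullet> B (f j) \<omega>" and ?W = "\<lambda>\<omega>. w \<bullet> Z \<omega>"
  let ?FB = "vimage_algebra (space M) (\<lambda>\<omega>. \<lambda>t\<in>{0..1}. B t \<omega>) (Pi\<^sub>M {0..1} (\<lambda>_. borel))"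
  let ?FZ = "vimage_algebra (space M) Z borel"
  have f: "f j \<in> {0..1}" if "j \<in> J" for j using assms that by auto
  have "(\<lambda>\<omega>. \<lambda>t\<in>{0..1}. B t \<omega>) \<in> ?FB \<rightarrow>\<^sub>M Pi\<^sub>M {0..1} (\<lambda>_. borel)"
    by (rule measurable_vimage_algebra1) (auto simp: space_PiM)
  hence comp: "(\<lambda>\<omega>. (\<lambda>t\<in>{0..1}. B t \<omega>) t) \<in> ?FB \<rightarrow>\<^sub>M borel" if "t \<in> {0..1}" for t
    using measurable_component_singleton[OF that] by (rule measurable_compose)
  have BF: "B t \<in> borel_measurable ?FB" if "t \<in> {0..1}" for t
    using comp[OF that] that by (subst (asm) restrict_apply') auto
  have YF: "?Y \<in> borel_measurable ?FB"
    using f by (intro borel_measurable_sum borel_measurable_inner BF) auto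
  have "Z \<in> ?FZ \<rightarrow>\<^sub>M borel" by (rule measurable_vimage_algebra1) auto
  hence WF: "?W \<in> borel_measurable ?FZ" by measurable
  have sub: "sigma_sets (space M) {Y -` A \<inter> space M |A. A \<in> sets borel} \<subseteq> sets F"
    if "Y \<in> borel_measurable F" "space F = space M" for Y :: "'a \<Rightarrow> real" and F
    using sets.sigma_sets_subset[of "{Y -` A \<inter> space M |A. A \<in> sets borel}" F] measurable_sets[OF that(1)] that(2) by auto
  have ind: "indep_set (sets ?FB) (sets ?FZ)" using indep by (simp add: process_indep_def)
  show ?thesis
    unfolding indep_var_eq
  proof (intro conjI)
    show "random_variable borel ?Y"
      using f by (intro borel_measurable_sum borel_measurable_inner measurable_B) auto
    show "random_variable borel ?W" using measurable_Z by measurable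
    have "sigma_sets (space M) {?Y -` A \<inter> space M |A. A \<in> sets borel} \<subseteq> sets ?FB"
      by (rule sub[OF YF]) simp
    moreover have "sigma_sets (space M) {?W -` A \<inter> space M |A. A \<in> sets borel} \<subseteq> sets ?FZ"
      by (rule sub[OF WF]) simp
    ultimately show "indep_set (sigma_sets (space M) {?Y -` A \<inter> space M |A. A \<in> sets borel})
        (sigma_sets (space M) {?W -` A \<inter> space M |A. A \<in> sets borel})"
      using ind unfolding indep_sets2_eq by blast
  qed
qed

text \<open>The independent drift \<open>(\<sigma> * t) *\<^sub>R Z\<close> adds
  \<open>\<sigma>\<^sup>2 * s * t\<close> to the covariance at times \<open>s\<close> and
  \<open>t\<close>. The resulting kernel runs from the bridge at \<open>\<sigma> = 0\<close> to
  Brownian motion at \<open>\<sigma> = 1\<close>.\<close>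

lemma char_lincomb_X:
  assumes "finite J" "f ` J \<subseteq> {0..1}"
  shows "(\<integral>\<omega>. iexp (\<Sum>j\<in>J. c j \<bullet> X_process B Z \<sigma> (f j) \<omega>) \<partial>M) =
    exp (- (\<Sum>j\<in>J. \<Sum>k\<in>J. (min (f j) (f k) - (1 - \<sigma>\<^sup>2) * f j * f k) * (c j \<bullet> c k)) / 2)"
proof -
  let ?Y = "\<lambda>\<omega>. \<Sum>j\<in>J. c j \<bullet> B (f j) \<omega>"
  define w where "w = (\<Sum>j\<in>J. (\<sigma> * f j) *\<^sub>R c j)"
  have X: "(\<Sum>j\<in>J. c j \<bullet> X_process B Z \<sigma> (f j) \<omega>) = ?Y \<omega> + w \<bullet> Z \<omega>" for \<omega>
    by (simp add: X_process_def inner_add_right sum.distrib w_def inner_sum_left)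
  have iv: "indep_var borel ?Y borel (\<lambda>\<omega>. w \<bullet> Z \<omega>)" by (rule indep_var_B_Z[OF assms])
  have [measurable]: "?Y \<in> borel_measurable M" "(\<lambda>\<omega>. w \<bullet> Z \<omega>) \<in> borel_measurable M"
    using indep_var_rv1[OF iv] indep_var_rv2[OF iv] by auto
  have "char (distr M borel (\<lambda>\<omega>. ?Y \<omega> + w \<bullet> Z \<omega>)) 1 = char (distr M borel ?Y) 1 * char (distr M borel (\<lambda>\<omega>. w \<bullet> Z \<omega>)) 1"
    by (rule char_distr_add[OF iv])
  hence "(\<integral>\<omega>. iexp (?Y \<omega> + w \<bullet> Z \<omega>) \<partial>M) = (\<integral>\<omega>. iexp (?Y \<omega>) \<partial>M) * (\<integral>\<omega>. iexp (w \<bullet> Z \<omega>) \<partial>M)"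
    unfolding char_def by (simp add: integral_distr)
  also have "\<dots> = exp (- (\<Sum>j\<in>J. \<Sum>k\<in>J. (min (f j) (f k) - f j * f k) * (c j \<bullet> c k)) / 2 + - (w \<bullet> w) / 2)"
    unfolding char_lincomb_B[OF assms] char_Z by (simp only: exp_add of_real_mult)
  also have "w \<bullet> w = (\<Sum>j\<in>J. \<Sum>k\<in>J. (\<sigma>\<^sup>2 * f j * f k) * (c j \<bullet> c k))"
    unfolding w_def inner_sum_left inner_sum_right
    by (intro sum.cong refl) (simp add: power2_eq_square mult_ac inner_commute)
  also have "- (\<Sum>j\<in>J. \<Sum>k\<in>J. (min (f j) (f k) - f j * f k) * (c j \<bullet> c k)) / 2 +
     - (\<Sum>j\<in>J. \<Sum>k\<in>J. (\<sigma>\<^sup>2 * f j * f k) * (c j \<bullet> c k)) / 2 =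
     - (\<Sum>j\<in>J. \<Sum>k\<in>J. (min (f j) (f k) - (1 - \<sigma>\<^sup>2) * f j * f k) * (c j \<bullet> c k)) / 2"
    by (simp add: sum.distrib[symmetric] algebra_simps add_divide_distrib[symmetric] diff_divide_distrib[symmetric])
  finally show ?thesis unfolding X .
qed

definition incr :: "nat \<Rightarrow> nat \<Rightarrow> 'a \<Rightarrow> real ^ 2" where
  "incr n i \<omega> = X_process B Z \<sigma> (real (Suc i) / real n) \<omega> - X_process B Z \<sigma> (real i / real n) \<omega>"

lemma measurable_X: "t \<in> {0..1} \<Longrightarrow> X_process B Z \<sigma> t \<in> borel_measurable M"
  unfolding X_process_def[abs_def] using measurable_B measurable_Z
  by (intro borel_measurable_add borel_measurable_scaleR) auto

lemma measurable_incr: "i < n \<Longrightarrow> incr n i \<in> borel_measurable M"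
  unfolding incr_def[abs_def] by (intro borel_measurable_diff measurable_X) auto

text \<open>This mixed second difference of the kernel \<open>min\<close> expresses that increments
  of Brownian motion over disjoint intervals are uncorrelated.\<close>

lemma min_second_difference:
  fixes i j :: nat and r :: real
  assumes "0 < r"
  shows "min (real (Suc i) / r) (real (Suc j) / r) - min (real (Suc i) / r) (real j / r)
       - min (real i / r) (real (Suc j) / r) + min (real i / r) (real j / r) = (if i = j then 1 / r else 0)"
proof -
  have m: "min (real a / r) (real b / r) = real (min a b) / r" for a b
    using assms by (simp add: min_def divide_right_mono frac_le divide_le_cancel)
  have "real (min (Suc i) (Suc j)) - real (min (Suc i) j) - real (min i (Suc j)) + real (min i j) = (if i = j then 1 else 0)"
    by (auto simp: min_def)
  hence "(real (min (Suc i) (Suc j)) - real (min (Suc i) j) - real (min i (Suc j)) + real (min i j)) / r = (if i = j then 1 / r else 0)"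
    by simp
  thus ?thesis unfolding m by (simp add: add_divide_distrib diff_divide_distrib)
qed

text \<open>An increment is a signed pair of values, indexed by a Boolean that marks the right
  endpoint, so its covariances are mixed second differences of the kernel. The product term of the
  kernel contributes the same constant for every pair of steps, which makes the quadratic form
  symmetric in the steps.\<close>

lemma char_incr:
  assumes n: "0 < n"
  shows "(\<integral>\<omega>. iexp (\<Sum>i<n. c i \<bullet> incr n i \<omega>) \<partial>M) =
    exp (- ((\<Sum>i<n. c i \<bullet> c i) / n - (1 - \<sigma>\<^sup>2) * (sum c {..<n} \<bullet> sum c {..<n}) / n\<^sup>2) / 2)"
proof -
  let ?J = "{..<n} \<times> (UNIV :: bool set)"
  define f where "f p = real (if snd p then Suc (fst p) else fst p) / real n" for p :: "nat \<times> bool"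
  define d where "d p = (if snd p then c (fst p) else - c (fst p))" for p :: "nat \<times> bool"
  have fJ: "f ` ?J \<subseteq> {0..1}" using n by (auto simp: f_def)
  have "(\<Sum>i<n. c i \<bullet> incr n i \<omega>) = (\<Sum>p\<in>?J. d p \<bullet> X_process B Z \<sigma> (f p) \<omega>)" for \<omega>
    by (simp add: sum.cartesian_product' UNIV_bool f_def d_def incr_def inner_diff_right)
  hence "(\<integral>\<omega>. iexp (\<Sum>i<n. c i \<bullet> incr n i \<omega>) \<partial>M) =
    exp (- (\<Sum>j\<in>?J. \<Sum>k\<in>?J. (min (f j) (f k) - (1 - \<sigma>\<^sup>2) * f j * f k) * (d j \<bullet> d k)) / 2)"
    using char_lincomb_X[OF _ fJ, of d] by simp
  also have "(\<Sum>j\<in>?J. \<Sum>k\<in>?J. (min (f j) (f k) - (1 - \<sigma>\<^sup>2) * f j * f k) * (d j \<bullet> d k)) =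
    (\<Sum>i<n. \<Sum>j<n. ((if i = j then 1 / real n else 0) - (1 - \<sigma>\<^sup>2) / (real n)\<^sup>2) * (c i \<bullet> c j))"
  proof -
    define K where "K i j = min (real i / n) (real j / n) - (1 - \<sigma>\<^sup>2) * (real i / n) * (real j / n)" for i j
    define g where "g p = (if snd p then Suc (fst p) else fst p)" for p :: "nat \<times> bool"
    have "min (f j) (f k) - (1 - \<sigma>\<^sup>2) * f j * f k = K (g j) (g k)" for j k
      by (simp add: f_def K_def g_def)
    hence "(\<Sum>j\<in>?J. \<Sum>k\<in>?J. (min (f j) (f k) - (1 - \<sigma>\<^sup>2) * f j * f k) * (d j \<bullet> d k)) =
      (\<Sum>j\<in>?J. \<Sum>k\<in>?J. K (g j) (g k) * (d j \<bullet> d k))" by simp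
    also have "\<dots> = (\<Sum>i<n. \<Sum>j<n. (K (Suc i) (Suc j) - K (Suc i) j - K i (Suc j) + K i j) * (c i \<bullet> c j))"
      by (simp add: sum.cartesian_product' UNIV_bool g_def d_def sum.distrib[symmetric] algebra_simps)
    also have "\<dots> = (\<Sum>i<n. \<Sum>j<n. ((if i = j then 1 / real n else 0) - (1 - \<sigma>\<^sup>2) / (real n)\<^sup>2) * (c i \<bullet> c j))"
    proof (intro sum.cong refl arg_cong2[of _ _ _ _ "(*)"])
      fix i j
      show "K (Suc i) (Suc j) - K (Suc i) j - K i (Suc j) + K i j =
      (if i = j then 1 / real n else 0) - (1 - \<sigma>\<^sup>2) / (real n)\<^sup>2"
      proof -
      have "(1 - \<sigma>\<^sup>2) * (real (Suc i) / n) * (real (Suc j) / n) - (1 - \<sigma>\<^sup>2) * (real (Suc i) / n) * (real j / n)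
        - (1 - \<sigma>\<^sup>2) * (real i / n) * (real (Suc j) / n) + (1 - \<sigma>\<^sup>2) * (real i / n) * (real j / n) = (1 - \<sigma>\<^sup>2) / (real n)\<^sup>2"
        using n by (simp add: field_simps power2_eq_square)
      thus ?thesis using min_second_difference[of "real n" i j] n unfolding K_def by linarith
      qed
    qed
    finally show ?thesis .
  qed
  also have "\<dots> = (\<Sum>i<n. c i \<bullet> c i) / n - (1 - \<sigma>\<^sup>2) * (sum c {..<n} \<bullet> sum c {..<n}) / n\<^sup>2"
  proof -
    have "(\<Sum>i<n. \<Sum>j<n. ((if i = j then 1 / real n else 0) - (1 - \<sigma>\<^sup>2) / (real n)\<^sup>2) * (c i \<bullet> c j)) =
      (\<Sum>i<n. \<Sum>j<n. (if i = j then (c i \<bullet> c j) / n else 0)) - (\<Sum>i<n. \<Sum>j<n. (1 - \<sigma>\<^sup>2) / (real n)\<^sup>2 * (c i \<bullet> c j))"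
      unfolding sum_subtractf[symmetric] by (intro sum.cong refl) (simp add: left_diff_distrib)
    also have "(\<Sum>i<n. \<Sum>j<n. (if i = j then (c i \<bullet> c j) / n else 0)) = (\<Sum>i<n. c i \<bullet> c i) / n"
      by (simp add: sum_divide_distrib)
    also have "(\<Sum>i<n. \<Sum>j<n. (1 - \<sigma>\<^sup>2) / (real n)\<^sup>2 * (c i \<bullet> c j)) = (1 - \<sigma>\<^sup>2) / (real n)\<^sup>2 * (sum c {..<n} \<bullet> sum c {..<n})"
      unfolding inner_sum_left inner_sum_right sum_distrib_left
      by (intro sum.cong refl) (simp add: inner_commute)
    finally show ?thesis by simp
  qed
  finally show ?thesis .
qed

section \<open>The law of the increments and of block sums\<close>

definition incr_law :: "nat \<Rightarrow> (nat \<Rightarrow> real ^ 2) measure" where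
  "incr_law n = distr M (Pi\<^sub>M {..<n} (\<lambda>_. borel)) (\<lambda>\<omega>. \<lambda>i\<in>{..<n}. incr n i \<omega>)"

lemma measurable_incr_vec: "(\<lambda>\<omega>. \<lambda>i\<in>{..<n}. incr n i \<omega>) \<in> M \<rightarrow>\<^sub>M Pi\<^sub>M {..<n} (\<lambda>_. borel)"
  by (intro measurable_restrict measurable_incr) auto

text \<open>The characteristic function of the increments depends on the coefficients only through
  two symmetric sums, so permuting the coefficients does not change it.\<close>

lemma incr_law_permute:
  assumes "\<pi> permutes {..<n}" "0 < n"
  shows "distr (incr_law n) (incr_law n) (\<lambda>x i. x (\<pi> i)) = incr_law n"
proof -
  let ?P = "Pi\<^sub>M {..<n} (\<lambda>_. borel :: (real ^ 2) measure)"
  have pi: "\<pi> i < n" if "i < n" for i using permutes_in_image[OF assms(1), of i] that by simp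
  have "(\<lambda>x i. x (\<pi> i)) \<in> ?P \<rightarrow>\<^sub>M ?P"
  proof (rule measurable_PiM_single')
    show "(\<lambda>x. x (\<pi> i)) \<in> borel_measurable ?P" if "i \<in> {..<n}" for i
      using pi that by (intro measurable_component_singleton) auto
    show "(\<lambda>x i. x (\<pi> i)) \<in> space ?P \<rightarrow> {..<n} \<rightarrow>\<^sub>E space borel"
      using permutes_not_in[OF assms(1)] by (auto simp: space_PiM PiE_def extensional_def)
  qed
  hence "distr (incr_law n) ?P (\<lambda>x i. x (\<pi> i)) = distr M ?P ((\<lambda>x i. x (\<pi> i)) \<circ> (\<lambda>\<omega>. \<lambda>i\<in>{..<n}. incr n i \<omega>))"
    unfolding incr_law_def by (rule distr_distr) (rule measurable_incr_vec)
  also have "((\<lambda>x i. x (\<pi> i)) \<circ> (\<lambda>\<omega>. \<lambda>i\<in>{..<n}. incr n i \<omega>)) = (\<lambda>\<omega>. \<lambda>i\<in>{..<n}. incr n (\<pi> i) \<omega>)"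
  proof (intro ext)
    fix \<omega> i
    show "((\<lambda>x i. x (\<pi> i)) \<circ> (\<lambda>\<omega>. \<lambda>i\<in>{..<n}. incr n i \<omega>)) \<omega> i = (\<lambda>i\<in>{..<n}. incr n (\<pi> i) \<omega>) i"
      using pi[of i] permutes_not_in[OF assms(1), of i] by (cases "i < n") auto
  qed
  also have "distr M ?P (\<lambda>\<omega>. \<lambda>i\<in>{..<n}. incr n (\<pi> i) \<omega>) = distr M ?P (\<lambda>\<omega>. \<lambda>i\<in>{..<n}. incr n i \<omega>)"
  proof (rule distr_PiM_vec_eqI_char)
    fix c :: "nat \<Rightarrow> real ^ 2"
    \<comment> \<open>The permutation of the increments is shifted to the coefficients by its
      inverse.\<close>
    define c' where "c' i = c (inv \<pi> i)" for i
    have c': "c' (\<pi> i) = c i" for i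
      unfolding c'_def using permutes_inverses(2)[OF assms(1)] by simp
    have re: "(\<Sum>i<n. g (c i) (\<pi> i)) = (\<Sum>i<n. g (c' i) i)" for g :: "real ^ 2 \<Rightarrow> nat \<Rightarrow> 'c :: comm_monoid_add"
    proof -
      have "(\<Sum>i<n. g (c i) (\<pi> i)) = (\<Sum>i<n. (\<lambda>i. g (c' i) i) (\<pi> i))" by (simp add: c')
      also have "\<dots> = (\<Sum>i<n. g (c' i) i)" using sum.permute[OF assms(1), of "\<lambda>i. g (c' i) i"] by (simp add: o_def)
      finally show ?thesis .
    qed
    have "(\<integral>\<omega>. iexp (\<Sum>i<n. c i \<bullet> incr n (\<pi> i) \<omega>) \<partial>M) = (\<integral>\<omega>. iexp (\<Sum>i<n. c' i \<bullet> incr n i \<omega>) \<partial>M)"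
      using re[of "\<lambda>v i. v \<bullet> incr n i \<omega>" for \<omega>] by simp
    also have "\<dots> = (\<integral>\<omega>. iexp (\<Sum>i<n. c i \<bullet> incr n i \<omega>) \<partial>M)"
      unfolding char_incr[OF assms(2)] using re[of "\<lambda>v i. v"] re[of "\<lambda>v i. v \<bullet> v"] by simp
    finally show "(\<integral>\<omega>. iexp (\<Sum>i\<in>{..<n}. c i \<bullet> incr n (\<pi> i) \<omega>) \<partial>M) = (\<integral>\<omega>. iexp (\<Sum>i\<in>{..<n}. c i \<bullet> incr n i \<omega>) \<partial>M)" .
  qed (use pi in \<open>auto intro!: measurable_incr prob_space_axioms\<close>)
  also have "\<dots> = incr_law n" by (simp add: incr_law_def)
  also have "distr (incr_law n) ?P (\<lambda>x i. x (\<pi> i)) = distr (incr_law n) (incr_law n) (\<lambda>x i. x (\<pi> i))"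
    by (intro distr_cong) (auto simp: incr_law_def)
  finally show ?thesis .
qed

definition vec_of_pair :: "real \<times> real \<Rightarrow> real ^ 2" where
  "vec_of_pair p = fst p *\<^sub>R axis 1 1 + snd p *\<^sub>R axis 2 1"

lemma inner_vec_of_pair: "c \<bullet> vec_of_pair p = c $ 1 * fst p + c $ 2 * snd p"
  by (simp add: vec_of_pair_def inner_add_right inner_axis)

lemma cr_vec_of_pair: "cr (vec_of_pair p) (vec_of_pair q) = fst p * snd q - snd p * fst q"
  by (simp add: vec_of_pair_def cr_def axis_def)

lemma measurable_vec_of_pair [measurable]:
  "vec_of_pair \<in> borel_measurable (borel \<Otimes>\<^sub>M borel)"
  unfolding vec_of_pair_def[abs_def] by measurable

text \<open>Cholesky factorization of the covariance matrix of two block sums in one coordinate,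
  \<open>s\<close> and \<open>t\<close> being the fractions of steps in the blocks. The determinant
  is \<open>\<delta>\<^sup>2\<close>, which may vanish when \<open>s + t = 1\<close>;
  \<open>s < 1\<close> still keeps \<open>\<alpha>\<close> positive.\<close>

lemma block_variance_identity:
  fixes s t \<kappa> :: real
  assumes "0 < s" "s < 1" "0 < t" "s + t \<le> 1" "0 \<le> \<kappa>" "\<kappa> \<le> 1"
  defines "\<delta> \<equiv> sqrt (s * t * (1 - \<kappa> * (s + t)))"
  obtains \<alpha> \<beta> \<gamma> where "\<alpha>\<^sup>2 = s - \<kappa> * s\<^sup>2" "\<alpha> * \<beta> = - \<kappa> * s * t" "\<beta>\<^sup>2 + \<gamma>\<^sup>2 = t - \<kappa> * t\<^sup>2" "\<alpha> * \<gamma> = \<delta>"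
proof -
  have "\<kappa> * s \<le> 1 * s" using assms by (intro mult_right_mono) auto
  hence ks: "\<kappa> * s < 1" using assms(2) by linarith
  have "\<kappa> * (s + t) \<le> 1 * 1" using assms by (intro mult_mono) auto
  hence kst: "\<kappa> * (s + t) \<le> 1" by simp
  have v: "s - \<kappa> * s\<^sup>2 = s * (1 - \<kappa> * s)" by (simp add: power2_eq_square algebra_simps)
  hence pos: "0 < s - \<kappa> * s\<^sup>2" using assms ks by simp
  define \<alpha> where "\<alpha> = sqrt (s - \<kappa> * s\<^sup>2)"
  have a: "\<alpha> > 0" "\<alpha>\<^sup>2 = s - \<kappa> * s\<^sup>2" using pos by (auto simp: \<alpha>_def)
  have d: "\<delta>\<^sup>2 = s * t * (1 - \<kappa> * (s + t))" unfolding \<delta>_def using assms(1,3) kst by simp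
  have "(- \<kappa> * s * t / \<alpha>)\<^sup>2 + (\<delta> / \<alpha>)\<^sup>2 = ((\<kappa> * s * t)\<^sup>2 + s * t * (1 - \<kappa> * (s + t))) / (s - \<kappa> * s\<^sup>2)"
    by (simp add: power_divide a(2) d add_divide_distrib)
  also have "(\<kappa> * s * t)\<^sup>2 + s * t * (1 - \<kappa> * (s + t)) = (t - \<kappa> * t\<^sup>2) * (s - \<kappa> * s\<^sup>2)"
    by (simp add: power2_eq_square algebra_simps)
  finally have "(- \<kappa> * s * t / \<alpha>)\<^sup>2 + (\<delta> / \<alpha>)\<^sup>2 = t - \<kappa> * t\<^sup>2" using pos by simp
  thus ?thesis using a by (intro that[of \<alpha> "- \<kappa> * s * t / \<alpha>" "\<delta> / \<alpha>"]) auto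
qed

text \<open>The two block sums are a triangular image of two independent standard Gaussian vectors,
  since both pairs have the same quadratic form in the exponent. The Boolean index presents a pair
  as a family, the format of the uniqueness theorem.\<close>

lemma distr_block_sums:
  assumes IJ: "I \<subseteq> {..<n}" "J \<subseteq> {..<n}" "I \<inter> J = {}" "I \<noteq> {}" "J \<noteq> {}" and \<sigma>: "0 \<le> \<sigma>" "\<sigma> \<le> 1"
    and st: "s = real (card I) / real n" "t = real (card J) / real n"
  shows "\<exists>\<alpha> \<beta> \<gamma>. \<alpha> * \<gamma> = sqrt (s * t * (1 - (1 - \<sigma>\<^sup>2) * (s + t))) \<and>
    distr M (Pi\<^sub>M UNIV (\<lambda>_. borel)) (\<lambda>\<omega>. \<lambda>b\<in>UNIV. if b then \<Sum>i\<in>I. incr n i \<omega> else \<Sum>i\<in>J. incr n i \<omega>) =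
    distr std_normal4 (Pi\<^sub>M UNIV (\<lambda>_. borel)) (\<lambda>z. \<lambda>b\<in>UNIV. if b then \<alpha> *\<^sub>R vec_of_pair (fst z) else \<beta> *\<^sub>R vec_of_pair (fst z) + \<gamma> *\<^sub>R vec_of_pair (snd z))"
proof -
  interpret S: pair_prob_space "std_normal2" "std_normal2"
    by (rule pair_prob_space_std_normal4)
  define \<kappa> where "\<kappa> = 1 - \<sigma>\<^sup>2"
  have \<kappa>: "0 \<le> \<kappa>" "\<kappa> \<le> 1" using \<sigma> by (auto simp: \<kappa>_def power_le_one)
  have fin: "finite I" "finite J" using IJ finite_subset by blast+
  have card: "card I > 0" "card J > 0" using fin IJ by (auto simp: card_gt_0_iff)
  have "card I + card J = card (I \<union> J)" using fin IJ by (simp add: card_Un_disjoint)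
  also have "\<dots> \<le> card {..<n}" using IJ by (intro card_mono) auto
  finally have cn: "card I + card J \<le> n" by simp
  hence n: "0 < n" using card by simp
  have st': "0 < s" "s < 1" "0 < t" "s + t \<le> 1"
    using cn card n by (auto simp: st add_divide_distrib[symmetric])
  obtain \<alpha> \<beta> \<gamma> where abg: "\<alpha>\<^sup>2 = s - \<kappa> * s\<^sup>2" "\<alpha> * \<beta> = - \<kappa> * s * t" "\<beta>\<^sup>2 + \<gamma>\<^sup>2 = t - \<kappa> * t\<^sup>2"
    "\<alpha> * \<gamma> = sqrt (s * t * (1 - \<kappa> * (s + t)))"
    using block_variance_identity[OF st' \<kappa>] by metis
  let ?X = "\<lambda>b \<omega>. if b then \<Sum>i\<in>I. incr n i \<omega> else \<Sum>i\<in>J. incr n i \<omega>"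
  let ?Y = "\<lambda>b z. if b then \<alpha> *\<^sub>R vec_of_pair (fst z) else \<beta> *\<^sub>R vec_of_pair (fst z) + \<gamma> *\<^sub>R vec_of_pair (snd z)"
  have "distr M (Pi\<^sub>M UNIV (\<lambda>_. borel)) (\<lambda>\<omega>. \<lambda>b\<in>UNIV. ?X b \<omega>) = distr std_normal4 (Pi\<^sub>M UNIV (\<lambda>_. borel)) (\<lambda>z. \<lambda>b\<in>UNIV. ?Y b z)"
  proof (rule distr_PiM_vec_eqI_char)
    show "prob_space std_normal4" by (rule S.P.prob_space_axioms)
    show "?X b \<in> borel_measurable M" for b
      using IJ by (cases b) (auto intro!: borel_measurable_sum measurable_incr)
    show "?Y b \<in> borel_measurable std_normal4" for b
      by (cases b) auto
    fix c :: "bool \<Rightarrow> real ^ 2"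
    \<comment> \<open>Coefficients on single steps that reproduce the test vectors
      \<open>c True\<close> and \<open>c False\<close> on the two blocks.\<close>
    define e where "e i = (if i \<in> I then c True else 0) + (if i \<in> J then c False else 0)" for i
    have sumI: "(\<Sum>i<n. if i \<in> A then h i else 0) = sum h A" if "A \<subseteq> {..<n}" for A and h :: "nat \<Rightarrow> 'c :: comm_monoid_add"
      using that by (simp add: sum.If_cases Int_absorb1)
    have "(\<Sum>b\<in>UNIV. c b \<bullet> ?X b \<omega>) = (\<Sum>i<n. e i \<bullet> incr n i \<omega>)" for \<omega>
    proof -
      have "(\<Sum>i<n. e i \<bullet> incr n i \<omega>) = (\<Sum>i<n. if i \<in> I then c True \<bullet> incr n i \<omega> else 0) + (\<Sum>i<n. if i \<in> J then c False \<bullet> incr n i \<omega> else 0)"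
        unfolding sum.distrib[symmetric] by (intro sum.cong refl) (auto simp: e_def inner_add_left)
      thus ?thesis by (simp add: sumI[OF IJ(1)] sumI[OF IJ(2)] UNIV_bool inner_sum_right)
    qed
    hence "(\<integral>\<omega>. iexp (\<Sum>b\<in>UNIV. c b \<bullet> ?X b \<omega>) \<partial>M) =
      exp (- ((\<Sum>i<n. e i \<bullet> e i) / n - \<kappa> * (sum e {..<n} \<bullet> sum e {..<n}) / n\<^sup>2) / 2)"
      using char_incr[OF n, of e] by (simp add: \<kappa>_def)
    also have "(\<Sum>i<n. e i \<bullet> e i) / n - \<kappa> * (sum e {..<n} \<bullet> sum e {..<n}) / n\<^sup>2 =
      (\<alpha> *\<^sub>R c True + \<beta> *\<^sub>R c False) \<bullet> (\<alpha> *\<^sub>R c True + \<beta> *\<^sub>R c False) + (\<gamma> *\<^sub>R c False) \<bullet> (\<gamma> *\<^sub>R c False)"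
    proof -
      define A C D where "A = c True \<bullet> c True" and "C = c False \<bullet> c False" and "D = c True \<bullet> c False"
      have "(\<Sum>i<n. e i \<bullet> e i) = (\<Sum>i<n. if i \<in> I then A else 0) + (\<Sum>i<n. if i \<in> J then C else 0)"
        unfolding sum.distrib[symmetric] using IJ(3) by (intro sum.cong refl) (auto simp: e_def A_def C_def)
      hence 1: "(\<Sum>i<n. e i \<bullet> e i) = card I * A + card J * C" by (simp add: sumI[OF IJ(1)] sumI[OF IJ(2)])
      have "sum e {..<n} = of_nat (card I) *\<^sub>R c True + of_nat (card J) *\<^sub>R c False"
        unfolding e_def sum.distrib by (simp add: sumI[OF IJ(1)] sumI[OF IJ(2)] sum_constant_scaleR del: sum_constant)
      hence 2: "sum e {..<n} \<bullet> sum e {..<n} = (card I)\<^sup>2 * A + 2 * card I * card J * D + (card J)\<^sup>2 * C"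
        by (simp add: inner_add_left inner_add_right A_def C_def D_def inner_commute power2_eq_square algebra_simps)
      have "(\<Sum>i<n. e i \<bullet> e i) / n - \<kappa> * (sum e {..<n} \<bullet> sum e {..<n}) / n\<^sup>2 =
        (s - \<kappa> * s\<^sup>2) * A + 2 * (- \<kappa> * s * t) * D + (t - \<kappa> * t\<^sup>2) * C"
        unfolding 1 2 st using n by (simp add: field_simps power2_eq_square)
      also have "\<dots> = \<alpha>\<^sup>2 * A + 2 * (\<alpha> * \<beta>) * D + (\<beta>\<^sup>2 + \<gamma>\<^sup>2) * C" by (simp only: abg)
      also have "\<dots> = (\<alpha> *\<^sub>R c True + \<beta> *\<^sub>R c False) \<bullet> (\<alpha> *\<^sub>R c True + \<beta> *\<^sub>R c False) + (\<gamma> *\<^sub>R c False) \<bullet> (\<gamma> *\<^sub>R c False)"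
        by (simp add: inner_add_left inner_add_right A_def C_def D_def inner_commute power2_eq_square algebra_simps)
      finally show ?thesis .
    qed
    also have "complex_of_real (exp (- ((\<alpha> *\<^sub>R c True + \<beta> *\<^sub>R c False) \<bullet> (\<alpha> *\<^sub>R c True + \<beta> *\<^sub>R c False) + (\<gamma> *\<^sub>R c False) \<bullet> (\<gamma> *\<^sub>R c False)) / 2)) =
      (\<integral>z. iexp (\<Sum>b\<in>UNIV. c b \<bullet> ?Y b z) \<partial>std_normal4)"
    proof -
      define a b where "a = \<alpha> *\<^sub>R c True + \<beta> *\<^sub>R c False" and "b = \<gamma> *\<^sub>R c False"
      have "(\<Sum>b\<in>UNIV. c b \<bullet> ?Y b z) = a \<bullet> vec_of_pair (fst z) + b \<bullet> vec_of_pair (snd z)" for z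
        by (simp add: UNIV_bool a_def b_def inner_add_left inner_add_right algebra_simps)
      hence "(\<integral>z. iexp (\<Sum>b\<in>UNIV. c b \<bullet> ?Y b z) \<partial>std_normal4) =
        (\<integral>z. iexp (a \<bullet> vec_of_pair (fst z)) * iexp (b \<bullet> vec_of_pair (snd z)) \<partial>std_normal4)"
        by (simp add: exp_add distrib_left)
      also have "\<dots> = (\<integral>z. iexp (a \<bullet> vec_of_pair z) \<partial>std_normal2) * (\<integral>z. iexp (b \<bullet> vec_of_pair z) \<partial>std_normal2)"
        by (rule S.integral_prod_mult) auto
      also have "\<dots> = exp (- (a \<bullet> a + b \<bullet> b) / 2)"
        unfolding inner_vec_of_pair integral_iexp_std_normal_pair
        by (simp add: inner_vec2 power2_eq_square exp_of_real exp_add[symmetric] del: of_real_exp flip: of_real_mult) (simp add: field_simps)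
      finally show ?thesis by (simp add: a_def b_def)
    qed
    finally show "(\<integral>\<omega>. iexp (\<Sum>b\<in>UNIV. c b \<bullet> ?X b \<omega>) \<partial>M) = (\<integral>z. iexp (\<Sum>b\<in>UNIV. c b \<bullet> ?Y b z) \<partial>std_normal4)" .
  qed (auto simp: prob_space_axioms)
  thus ?thesis using abg(4) unfolding \<kappa>_def by blast
qed

text \<open>In the triangular combination the multiple \<open>\<beta>\<close> of the first vector
  drops out of the determinant, which becomes \<open>\<delta>\<close> times that of two standard
  vectors.\<close>

lemma det_block_sums:
  assumes IJ: "I \<subseteq> {..<n}" "J \<subseteq> {..<n}" "I \<inter> J = {}" "I \<noteq> {}" "J \<noteq> {}" and \<sigma>: "0 \<le> \<sigma>" "\<sigma> \<le> 1"
    and st: "s = real (card I) / real n" "t = real (card J) / real n"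
  defines "\<delta> \<equiv> sqrt (s * t * (1 - (1 - \<sigma>\<^sup>2) * (s + t)))"
  shows "(\<integral>\<^sup>+\<omega>. ennreal \<bar>cr (\<Sum>i\<in>I. incr n i \<omega>) (\<Sum>i\<in>J. incr n i \<omega>)\<bar> \<partial>M) = ennreal \<delta>"
    and "\<delta> \<noteq> 0 \<Longrightarrow> AE \<omega> in M. cr (\<Sum>i\<in>I. incr n i \<omega>) (\<Sum>i\<in>J. incr n i \<omega>) \<noteq> 0"
proof -
  let ?PB = "Pi\<^sub>M (UNIV :: bool set) (\<lambda>_. borel :: (real ^ 2) measure)"
  let ?X = "\<lambda>\<omega>. \<lambda>b\<in>UNIV. if b then \<Sum>i\<in>I. incr n i \<omega> else \<Sum>i\<in>J. incr n i \<omega>"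
  obtain \<alpha> \<beta> \<gamma> where abg: "\<alpha> * \<gamma> = \<delta>" and eq: "distr M ?PB ?X =
    distr std_normal4 ?PB (\<lambda>z. \<lambda>b\<in>UNIV. if b then \<alpha> *\<^sub>R vec_of_pair (fst z) else \<beta> *\<^sub>R vec_of_pair (fst z) + \<gamma> *\<^sub>R vec_of_pair (snd z))"
    using distr_block_sums[OF assms(1-9)] unfolding \<delta>_def by blast
  let ?Y = "\<lambda>z. \<lambda>b\<in>UNIV. if b then \<alpha> *\<^sub>R vec_of_pair (fst z) else \<beta> *\<^sub>R vec_of_pair (fst z) + \<gamma> *\<^sub>R vec_of_pair (snd z)"
  have X: "?X \<in> M \<rightarrow>\<^sub>M ?PB"
  proof (rule measurable_restrict)
    show "(\<lambda>\<omega>. if b then \<Sum>i\<in>I. incr n i \<omega> else \<Sum>i\<in>J. incr n i \<omega>) \<in> borel_measurable M" for b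
      using IJ by (cases b) (auto intro!: borel_measurable_sum measurable_incr)
  qed
  have Y: "?Y \<in> std_normal4 \<rightarrow>\<^sub>M ?PB"
  proof (rule measurable_restrict)
    show "(\<lambda>z. if b then \<alpha> *\<^sub>R vec_of_pair (fst z) else \<beta> *\<^sub>R vec_of_pair (fst z) + \<gamma> *\<^sub>R vec_of_pair (snd z)) \<in> borel_measurable std_normal4" for b
      by (cases b) auto
  qed
  have cr: "cr (\<alpha> *\<^sub>R vec_of_pair (fst z)) (\<beta> *\<^sub>R vec_of_pair (fst z) + \<gamma> *\<^sub>R vec_of_pair (snd z)) =
    \<delta> * (fst (fst z) * snd (snd z) - snd (fst z) * fst (snd z))" for z
    by (simp add: cr_scaleR_left cr_scaleR_right cr_add_right cr_vec_of_pair abg[symmetric] algebra_simps)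
  have [measurable]: "(\<lambda>x. x b) \<in> borel_measurable ?PB" for b
    by (rule measurable_component_singleton) simp
  have "(\<integral>\<^sup>+\<omega>. ennreal \<bar>cr (\<Sum>i\<in>I. incr n i \<omega>) (\<Sum>i\<in>J. incr n i \<omega>)\<bar> \<partial>M) =
    (\<integral>\<^sup>+x. ennreal \<bar>cr (x True) (x False)\<bar> \<partial>distr M ?PB ?X)"
    by (subst nn_integral_distr[OF X]) auto
  also have "\<dots> = (\<integral>\<^sup>+z. ennreal \<delta> * ennreal \<bar>fst (fst z) * snd (snd z) - snd (fst z) * fst (snd z)\<bar> \<partial>std_normal4)"
  proof -
    have "\<delta> \<ge> 0"
    proof -
      have "0 \<le> s * t" by (simp add: st)
      moreover have "0 \<le> 1 - (1 - \<sigma>\<^sup>2) * (s + t)"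
      proof -
        have "finite I" "finite J" using IJ finite_subset by blast+
        hence "card I + card J = card (I \<union> J)" using IJ by (simp add: card_Un_disjoint)
        also have "\<dots> \<le> card {..<n}" using IJ by (intro card_mono) auto
        finally have "card I + card J \<le> n" by simp
        hence "s + t \<le> 1" unfolding st add_divide_distrib[symmetric] by (auto simp: divide_le_eq_1)
        moreover have "0 \<le> 1 - \<sigma>\<^sup>2" "1 - \<sigma>\<^sup>2 \<le> 1" using \<sigma> by (auto simp: power_le_one)
        moreover have "0 \<le> s + t" by (simp add: st)
        ultimately have "(1 - \<sigma>\<^sup>2) * (s + t) \<le> 1 * 1" by (intro mult_mono) auto
        thus ?thesis by simp
      qed
      ultimately show ?thesis unfolding \<delta>_def by simp
    qed
    thus ?thesis unfolding eq
      by (subst nn_integral_distr[OF Y]) (auto simp: cr abs_mult ennreal_mult)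
  qed
  also have "\<dots> = ennreal \<delta>"
    by (subst nn_integral_cmult) (auto simp: nn_integral_abs_det_std_normal)
  finally show "(\<integral>\<^sup>+\<omega>. ennreal \<bar>cr (\<Sum>i\<in>I. incr n i \<omega>) (\<Sum>i\<in>J. incr n i \<omega>)\<bar> \<partial>M) = ennreal \<delta>" .
  assume "\<delta> \<noteq> 0"
  have "AE z in std_normal4. cr (?Y z True) (?Y z False) \<noteq> 0"
    using AE_det_std_normal_neq_0 by eventually_elim (use \<open>\<delta> \<noteq> 0\<close> in \<open>simp add: cr\<close>)
  hence "AE x in distr std_normal4 ?PB ?Y. cr (x True) (x False) \<noteq> 0"
    by (subst AE_distr_iff[OF Y]) auto
  hence "AE \<omega> in M. cr (?X \<omega> True) (?X \<omega> False) \<noteq> 0"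
    unfolding eq[symmetric] by (subst (asm) AE_distr_iff[OF X]) auto
  thus "AE \<omega> in M. cr (\<Sum>i\<in>I. incr n i \<omega>) (\<Sum>i\<in>J. incr n i \<omega>) \<noteq> 0" by simp
qed

end

section \<open>A limit of sums\<close>

lemma Cesaro_mean_tendsto_0:
  fixes x :: "nat \<Rightarrow> real"
  assumes "x \<longlonglongrightarrow> 0"
  shows "(\<lambda>n. (\<Sum>k=1..n. x k) / n) \<longlonglongrightarrow> 0"
proof (rule LIMSEQ_I)
  fix e :: real assume "e > 0"
  then obtain N where N: "\<And>k. k \<ge> N \<Longrightarrow> \<bar>x k\<bar> < e / 2"
    using LIMSEQ_D[OF assms, of "e / 2"] by auto
  define C where "C = (\<Sum>k=1..N. \<bar>x k\<bar>)"
  have "C \<ge> 0" by (auto simp: C_def intro: sum_nonneg)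
  obtain N' :: nat where N': "2 * C / e < N'" using reals_Archimedean2 by blast
  show "\<exists>no. \<forall>n\<ge>no. norm ((\<Sum>k=1..n. x k) / n - 0) < e"
  proof (intro exI[of _ "max 1 (max N N')"] allI impI)
    fix n assume n: "n \<ge> max 1 (max N N')"
    have "\<bar>\<Sum>k=1..n. x k\<bar> \<le> (\<Sum>k=1..n. \<bar>x k\<bar>)" by (rule sum_abs)
    also have "\<dots> = C + (\<Sum>k=Suc N..n. \<bar>x k\<bar>)"
      unfolding C_def using n sum.ub_add_nat[of 1 N "\<lambda>k. \<bar>x k\<bar>" "n - N"] by simp
    also have "(\<Sum>k=Suc N..n. \<bar>x k\<bar>) \<le> (\<Sum>k=Suc N..n. e / 2)"
      using N by (intro sum_mono less_imp_le) auto
    also have "\<dots> \<le> n * (e / 2)" using \<open>e > 0\<close> by (simp add: mult_right_mono)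
    finally have 1: "\<bar>\<Sum>k=1..n. x k\<bar> \<le> C + n * (e / 2)" by simp
    have "2 * C / e < n" using N' n by (auto intro: less_le_trans)
    hence "C < n * (e / 2)" using \<open>e > 0\<close> by (simp add: field_simps)
    hence "\<bar>\<Sum>k=1..n. x k\<bar> < n * e" using 1 by simp
    thus "norm ((\<Sum>k=1..n. x k) / n - 0) < e"
      using n by (simp add: field_simps)
  qed
qed

text \<open>By the mean value theorem the increment of \<open>F\<close> over a cell is
  \<open>h * f z\<close> for an inner point \<open>z\<close>. Each bound avoids one end of the
  interval, since \<open>f\<close> may be singular there: with \<open>1 / 0 = 0\<close>,
  monotonicity would fail at a pole.\<close>

lemma sum_antimono_bounds:
  fixes F f :: "real \<Rightarrow> real" and a b :: nat and h :: real
  assumes h: "0 < h" and "a \<le> b"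
    and cont: "continuous_on {a * h..b * h} F"
    and der: "\<And>x. a * h < x \<Longrightarrow> x < b * h \<Longrightarrow> (F has_real_derivative f x) (at x)"
  shows "(\<And>x y. a * h < x \<Longrightarrow> x \<le> y \<Longrightarrow> y \<le> b * h \<Longrightarrow> f y \<le> f x) \<Longrightarrow>
      (\<Sum>k=Suc a..b. f (k * h)) * h \<le> F (b * h) - F (a * h)"
    and "(\<And>x y. a * h \<le> x \<Longrightarrow> x \<le> y \<Longrightarrow> y < b * h \<Longrightarrow> f y \<le> f x) \<Longrightarrow>
      F (b * h) - F (a * h) \<le> (\<Sum>k=a..<b. f (k * h)) * h"
proof -
  have step: "\<exists>z. k * h < z \<and> z < Suc k * h \<and> F (Suc k * h) - F (k * h) = h * f z" if k: "a \<le> k" "k < b" for k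
  proof -
    have "a * h \<le> k * h" "Suc k * h \<le> b * h" using h k by (simp_all only: mult_right_mono of_nat_le_iff Suc_le_eq less_imp_le)
    hence "continuous_on {k * h..Suc k * h} F"
      by (intro continuous_on_subset[OF cont]) auto
    moreover have "k * h < Suc k * h" using h by simp
    moreover have derk: "(F has_real_derivative f x) (at x)" if "k * h < x" "x < Suc k * h" for x
      using that \<open>a * h \<le> k * h\<close> \<open>Suc k * h \<le> b * h\<close> by (intro der) linarith+
    ultimately obtain l z where z: "k * h < z" "z < Suc k * h" "(F has_real_derivative l) (at z)"
        "F (Suc k * h) - F (k * h) = (Suc k * h - k * h) * l"
      using MVT[of "k * h" "Suc k * h" F] by (metis real_differentiable_def)
    have "l = f z" using z(3) derk[OF z(1,2)] by (rule DERIV_unique)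
    thus ?thesis using z by (intro exI[of _ z]) (simp add: algebra_simps)
  qed
  have tele: "F (b * h) - F (a * h) = (\<Sum>k=a..<b. F (Suc k * h) - F (k * h))"
    using \<open>a \<le> b\<close> sum_Suc_diff'[of a b "\<lambda>k. F (k * h)"] by simp
  show "F (b * h) - F (a * h) \<le> (\<Sum>k=a..<b. f (k * h)) * h"
    if anti: "\<And>x y. a * h \<le> x \<Longrightarrow> x \<le> y \<Longrightarrow> y < b * h \<Longrightarrow> f y \<le> f x"
    unfolding tele sum_distrib_right
  proof (rule sum_mono)
    fix k assume "k \<in> {a..<b}"
    hence k: "a \<le> k" "k < b" by auto
    obtain z where z: "k * h < z" "z < Suc k * h" "F (Suc k * h) - F (k * h) = h * f z" using step[OF k] by blast
    have "a * h \<le> k * h" "Suc k * h \<le> b * h" using h k by (simp_all only: mult_right_mono of_nat_le_iff Suc_le_eq less_imp_le)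
    hence "f z \<le> f (k * h)" using z by (intro anti) auto
    thus "F (Suc k * h) - F (k * h) \<le> f (k * h) * h" using z h by simp
  qed
  show "(\<Sum>k=Suc a..b. f (k * h)) * h \<le> F (b * h) - F (a * h)"
    if anti: "\<And>x y. a * h < x \<Longrightarrow> x \<le> y \<Longrightarrow> y \<le> b * h \<Longrightarrow> f y \<le> f x"
  proof -
    have "(\<Sum>k=Suc a..b. f (k * h)) * h = (\<Sum>k=a..<b. f (Suc k * h) * h)"
      unfolding sum_distrib_right
      by (rule sum.reindex_bij_witness[of _ Suc "\<lambda>k. k - 1"]) auto
    also have "\<dots> \<le> (\<Sum>k=a..<b. F (Suc k * h) - F (k * h))"
    proof (rule sum_mono)
      fix k assume "k \<in> {a..<b}"
      hence k: "a \<le> k" "k < b" by auto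
      obtain z where z: "k * h < z" "z < Suc k * h" "F (Suc k * h) - F (k * h) = h * f z" using step[OF k] by blast
      have "a * h \<le> k * h" "Suc k * h \<le> b * h" using h k by (simp_all only: mult_right_mono of_nat_le_iff Suc_le_eq less_imp_le)
      hence "f (Suc k * h) \<le> f z" using z by (intro anti) auto
      thus "f (Suc k * h) * h \<le> F (Suc k * h) - F (k * h)" using z h by simp
    qed
    finally show ?thesis unfolding tele .
  qed
qed

text \<open>With \<open>x = q / N\<close> this is a Riemann sum for the integral of
  \<open>1 / sqrt (x * (1 - x))\<close> over \<open>[0, 1]\<close>, which is
  \<open>pi\<close>.\<close>

definition arcsine_sum :: "nat \<Rightarrow> real" where
  "arcsine_sum N = (\<Sum>q=1..<N. 1 / sqrt (real q * real (N - q)))"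

text \<open>The integrand has antiderivative \<open>F\<close> and decreases only up to
  \<open>1 / 2\<close>. The sum is therefore cut at \<open>N div 2\<close> and its upper part
  reflected by \<open>N - q\<close>. The lower bound starts at \<open>1 / N\<close>, away from the
  pole at 0.\<close>

lemma arcsine_sum_bounds:
  assumes N: "2 \<le> N"
  defines "F \<equiv> \<lambda>x::real. arcsin (2 * x - 1)"
  shows "arcsine_sum N \<le> pi" and "2 * (F (real (N div 2) / N) - F (1 / N)) \<le> arcsine_sum N"
proof -
  define f where "f x = 1 / sqrt (x * (1 - x))" for x :: real
  define h where "h = 1 / real N"
  define m where "m = N div 2"
  have h: "0 < h" "h * N = 1" using N by (auto simp: h_def)
  have m: "1 \<le> m" "2 * m \<le> N" "N \<le> 2 * m + 1" using N by (auto simp: m_def)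
  have mh: "real m * h \<le> 1 / 2" using m N by (simp add: h_def field_simps)
  have cont: "continuous_on {a..b} F" if "0 \<le> a" "b \<le> 1 / 2" for a b
    unfolding F_def using that by (intro continuous_intros) auto
  have der: "(F has_real_derivative f x) (at x)" if "0 < x" "x < 1 / 2" for x
  proof -
    have "(F has_real_derivative inverse (sqrt (1 - (2 * x - 1)\<^sup>2)) * 2) (at x)"
      unfolding F_def using that by (auto intro!: derivative_eq_intros)
    also have "1 - (2 * x - 1)\<^sup>2 = 4 * (x * (1 - x))" by (simp add: power2_eq_square algebra_simps)
    also have "inverse (sqrt (4 * (x * (1 - x)))) * 2 = f x"
      using real_sqrt_mult[of 4 "x * (1 - x)"] by (simp only: real_sqrt_four) (simp add: f_def inverse_eq_divide)
    finally show ?thesis .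
  qed
  have anti: "f y \<le> f x" if "0 < x" "x \<le> y" "y \<le> 1 / 2" for x y
  proof -
    have "0 \<le> (y - x) * (1 - x - y)" using that by (intro mult_nonneg_nonneg) auto
    hence "x * (1 - x) \<le> y * (1 - y)" by (simp add: algebra_simps)
    moreover have "0 < x * (1 - x)" using that by (intro mult_pos_pos) auto
    ultimately show ?thesis unfolding f_def by (intro divide_left_mono mult_pos_pos) auto
  qed
  have summand: "1 / sqrt (real q * real (N - q)) = f (q * h) * h" if "q \<in> {1..<N}" for q
  proof -
    have "real q * real (N - q) = (real q * h) * (1 - real q * h) * (real N)\<^sup>2"
      using that N by (simp add: h_def of_nat_diff field_simps power2_eq_square)
    hence "sqrt (real q * real (N - q)) = sqrt ((real q * h) * (1 - real q * h)) * N"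
      by (simp only: real_sqrt_mult[of "(real q * h) * (1 - real q * h)" "(real N)\<^sup>2"] real_sqrt_abs abs_of_nat)
    thus ?thesis by (simp add: f_def h_def)
  qed
  define P where "P j = (\<Sum>q=1..j. f (q * h)) * h" for j :: nat
  have half: "(\<Sum>q=1..j. 1 / sqrt (real q * real (N - q))) = P j" if "j < N" for j
    unfolding P_def sum_distrib_right using that by (intro sum.cong refl summand) auto
  have "arcsine_sum N = (\<Sum>q=1..m. 1 / sqrt (real q * real (N - q))) + (\<Sum>q=Suc m..<N. 1 / sqrt (real q * real (N - q)))"
  proof -
    have "{1..<N} = {1..m} \<union> {Suc m..<N}" using m N by auto
    hence "arcsine_sum N = (\<Sum>q\<in>{1..m} \<union> {Suc m..<N}. 1 / sqrt (real q * real (N - q)))"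
      by (simp only: arcsine_sum_def)
    also have "\<dots> = (\<Sum>q=1..m. 1 / sqrt (real q * real (N - q))) + (\<Sum>q=Suc m..<N. 1 / sqrt (real q * real (N - q)))"
      by (rule sum.union_disjoint) auto
    finally show ?thesis .
  qed
  also have "(\<Sum>q=Suc m..<N. 1 / sqrt (real q * real (N - q))) = (\<Sum>q=1..N-1-m. 1 / sqrt (real q * real (N - q)))"
    using m N by (intro sum.reindex_bij_witness[of _ "\<lambda>q. N - q" "\<lambda>q. N - q"]) (auto simp: mult.commute)
  \<comment> \<open>The reflected part has \<open>N - 1 - m\<close> terms, which is \<open>m\<close>
    or \<open>m - 1\<close> according to the parity of \<open>N\<close>.\<close>
  finally have split: "arcsine_sum N = P m + P (N - 1 - m)"
    using half[of m] half[of "N - 1 - m"] m N by simp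
  have Pmono: "P i \<le> P j" if "i \<le> j" "j < N" for i j
  proof -
    have "f (q * h) \<ge> 0" if "q \<in> {1..j}" for q
      unfolding f_def using that \<open>j < N\<close> N by (auto simp: h_def)
    thus ?thesis unfolding P_def using h that by (intro mult_right_mono sum_mono2) auto
  qed
  have "P m \<le> F (m * h) - F (0 * h)"
    unfolding P_def using sum_antimono_bounds(1)[of h 0 m F f] h mh cont der anti by simp
  also have "F (m * h) \<le> F (1 / 2)"
    unfolding F_def using mh h by (intro arcsin_le_arcsin) auto
  also have "F (1 / 2) - F (0 * h) = pi / 2" by (simp add: F_def arcsin_minus_1)
  finally have "P m \<le> pi / 2" by simp
  moreover have "P (N - 1 - m) \<le> P m" using m N by (intro Pmono) auto
  ultimately show "arcsine_sum N \<le> pi" unfolding split by simp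
  have "F (m * h) - F (1 * h) \<le> (\<Sum>k=1..<m. f (k * h)) * h"
  proof -
    have "h \<le> m * h" using m h by simp
    thus ?thesis
      using sum_antimono_bounds(2)[of h 1 m F f] h m mh cont[of h "m * h"] der anti by simp
  qed
  also have "\<dots> = P (m - 1)" unfolding P_def using m by (intro arg_cong2[of _ _ _ _ "(*)"] sum.cong) auto
  finally have "F (m * h) - F h \<le> P (m - 1)" by simp
  moreover have "P (m - 1) \<le> P m" "P (m - 1) \<le> P (N - 1 - m)" using m N by (intro Pmono; simp)+
  ultimately show "2 * (F (real (N div 2) / N) - F (1 / N)) \<le> arcsine_sum N"
    unfolding split by (simp add: m_def h_def)
qed

lemma arcsine_sum_tendsto: "arcsine_sum \<longlonglongrightarrow> pi"
proof (rule tendsto_sandwich)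
  define F where "F x = arcsin (2 * x - 1)" for x :: real
  have contF: "continuous_on {0..1} F" unfolding F_def by (intro continuous_intros) auto
  have l2: "(\<lambda>N. F (1 / real N)) \<longlonglongrightarrow> F 0"
  proof (rule continuous_on_tendsto_compose[OF contF])
    show "(\<lambda>N. 1 / real N) \<longlonglongrightarrow> 0" by (rule lim_1_over_n)
  qed (auto intro!: always_eventually simp: divide_le_eq_1)
  have l1: "(\<lambda>N. F (real (N div 2) / real N)) \<longlonglongrightarrow> F (1 / 2)"
  proof (rule continuous_on_tendsto_compose[OF contF])
    show "(\<lambda>N. real (N div 2) / real N) \<longlonglongrightarrow> 1 / 2"
    proof (rule tendsto_sandwich)
      have "(\<lambda>N. 1 / 2 - 1 / 2 * (1 / real N)) \<longlonglongrightarrow> 1 / 2 - 1 / 2 * 0"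
        by (intro tendsto_intros lim_1_over_n)
      thus "(\<lambda>N. 1 / 2 - 1 / 2 * (1 / real N)) \<longlonglongrightarrow> 1 / 2" by simp
      show "\<forall>\<^sub>F N in sequentially. 1 / 2 - 1 / 2 * (1 / real N) \<le> real (N div 2) / real N"
        using eventually_gt_at_top[of 0]
      proof eventually_elim
        case (elim N)
        have "real N \<le> 2 * real (N div 2) + 1" by linarith
        hence "(real N - 1) / 2 \<le> real (N div 2)" by simp
        hence "(real N - 1) / 2 / real N \<le> real (N div 2) / real N" by (rule divide_right_mono) simp
        moreover have "(real N - 1) / 2 / real N = 1 / 2 - 1 / 2 * (1 / real N)" using elim by (simp add: field_simps)
        ultimately show ?case by simp
      qed
      show "\<forall>\<^sub>F N in sequentially. real (N div 2) / real N \<le> 1 / 2"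
        using eventually_gt_at_top[of 0]
      proof eventually_elim
        case (elim N)
        have "real (N div 2) \<le> real N / 2" by linarith
        hence "real (N div 2) / real N \<le> real N / 2 / real N" by (rule divide_right_mono) simp
        thus ?case using elim by simp
      qed
    qed auto
  qed (auto intro!: always_eventually simp: divide_le_eq_1)
  have "(\<lambda>N. 2 * (F (real (N div 2) / N) - F (1 / N))) \<longlonglongrightarrow> 2 * (F (1 / 2) - F 0)"
    by (intro tendsto_intros l1 l2)
  thus "(\<lambda>N. 2 * (F (real (N div 2) / N) - F (1 / N))) \<longlonglongrightarrow> pi"
    by (simp add: F_def arcsin_minus_1)
  show "\<forall>\<^sub>F N in sequentially. 2 * (F (real (N div 2) / N) - F (1 / N)) \<le> arcsine_sum N"
    using eventually_ge_at_top[of 2] by eventually_elim (unfold F_def, rule arcsine_sum_bounds(2))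
  show "\<forall>\<^sub>F N in sequentially. arcsine_sum N \<le> pi"
    using eventually_ge_at_top[of 2] by eventually_elim (rule arcsine_sum_bounds(1))
qed auto

text \<open>The limit is the integral of \<open>sqrt (1 - \<kappa> * x)\<close> over
  \<open>[0, 1]\<close>, that is \<open>2 / 3 * ((1 - \<sigma> ^ 3) / (1 - \<sigma> ^ 2))\<close>;
  cancelling \<open>1 - \<sigma>\<close> gives the stated quotient. Since the antiderivative divides
  by \<open>\<kappa>\<close>, the case \<open>\<sigma> = 1\<close> is separate.\<close>

lemma Riemann_sum_sqrt:
  assumes "0 \<le> \<sigma>" "\<sigma> \<le> 1"
  shows "(\<lambda>n. (\<Sum>N=1..n. sqrt (1 - (1 - \<sigma>\<^sup>2) * (real N / real n))) / n)
    \<longlonglongrightarrow> 2 / 3 * ((\<sigma>\<^sup>2 + \<sigma> + 1) / (\<sigma> + 1))"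
proof (cases "\<sigma> = 1")
  case True
  have "(\<lambda>n. (\<Sum>N=1..n. sqrt (1 - (1 - \<sigma>\<^sup>2) * (real N / real n))) / n) \<longlonglongrightarrow> 1"
  proof (rule tendsto_eventually, use eventually_gt_at_top[of 0] in eventually_elim)
    fix n :: nat assume "0 < n"
    thus "(\<Sum>N=1..n. sqrt (1 - (1 - \<sigma>\<^sup>2) * (real N / real n))) / n = 1" using True by simp
  qed
  thus ?thesis using True by simp
next
  case False
  define \<kappa> where "\<kappa> = 1 - \<sigma>\<^sup>2"
  have "\<sigma>\<^sup>2 < 1" using assms False by (simp add: power_less_one_iff abs_square_less_1)
  hence k: "0 < \<kappa>" "\<kappa> \<le> 1" by (auto simp: \<kappa>_def)
  define f where "f x = sqrt (1 - \<kappa> * x)" for x :: real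
  define F where "F x = - (2 / (3 * \<kappa>)) * (sqrt (1 - \<kappa> * x) * (1 - \<kappa> * x))" for x :: real
  have anti: "f y \<le> f x" if "x \<le> y" for x y using that k by (simp add: f_def)
  have cont: "continuous_on A F" for A unfolding F_def by (intro continuous_intros)
  \<comment> \<open>The product rule needs \<open>1 - \<kappa> * x\<close> to be positive, which
    fails at \<open>x = 1\<close> if \<open>\<kappa> = 1\<close>.\<close>
  have der: "(F has_real_derivative f x) (at x)" if "x < 1" for x
  proof -
    have "\<kappa> * x < 1"
    proof (cases "x \<le> 0")
      case True thus ?thesis using k mult_nonneg_nonpos[of \<kappa> x] by simp
    next
      case False thus ?thesis using k that mult_strict_mono'[of \<kappa> 1 x 1] by (cases "\<kappa> = 1") auto
    qed
    hence w: "0 < 1 - \<kappa> * x" by simp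
    have "(F has_real_derivative - (2 / (3 * \<kappa>)) * (inverse (sqrt (1 - \<kappa> * x)) / 2 * (- \<kappa>) * (1 - \<kappa> * x) + sqrt (1 - \<kappa> * x) * (- \<kappa>))) (at x)"
      unfolding F_def using w k by (auto intro!: derivative_eq_intros simp: field_simps)
    also have "inverse (sqrt (1 - \<kappa> * x)) / 2 * (- \<kappa>) * (1 - \<kappa> * x) = - (\<kappa> / 2) * sqrt (1 - \<kappa> * x)"
      using w real_div_sqrt[of "1 - \<kappa> * x"] by (simp add: field_simps)
    also have "- (2 / (3 * \<kappa>)) * (- (\<kappa> / 2) * sqrt (1 - \<kappa> * x) + sqrt (1 - \<kappa> * x) * (- \<kappa>)) = f x"
      using k by (simp add: f_def field_simps)
    finally show ?thesis .
  qed
  have val: "F 1 - F 0 = 2 / 3 * ((\<sigma>\<^sup>2 + \<sigma> + 1) / (\<sigma> + 1))"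
  proof -
    have "F 1 - F 0 = 2 / 3 * ((1 - \<sigma> ^ 3) / \<kappa>)"
    proof -
      have "F 1 = - (2 / (3 * \<kappa>)) * \<sigma> ^ 3" "F 0 = - (2 / (3 * \<kappa>))"
        using assms(1) by (simp_all add: F_def \<kappa>_def power3_eq_cube power2_eq_square)
      thus ?thesis by (simp add: right_diff_distrib diff_divide_distrib)
    qed
    also have "1 - \<sigma> ^ 3 = (1 - \<sigma>) * (\<sigma>\<^sup>2 + \<sigma> + 1)"
      by (simp add: power3_eq_cube power2_eq_square algebra_simps)
    also have "\<kappa> = (1 - \<sigma>) * (\<sigma> + 1)" by (simp add: \<kappa>_def power2_eq_square algebra_simps)
    finally show ?thesis using False by simp
  qed
  define R where "R n = (\<Sum>N=1..n. f (real N * (1 / real n))) * (1 / real n)" for n :: nat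
  have R: "(\<Sum>N=1..n. sqrt (1 - (1 - \<sigma>\<^sup>2) * (real N / real n))) / n = R n" for n
    by (simp add: R_def f_def \<kappa>_def)
  \<comment> \<open>\<open>R n\<close> uses right endpoints. Passing to left endpoints adds at most
    \<open>f 0 / n\<close>, and \<open>f 0 = 1\<close>.\<close>
  have up: "R n \<le> F 1 - F 0" and low: "F 1 - F 0 - 1 / n \<le> R n" if "0 < n" for n :: nat
  proof -
    have "(\<Sum>k=Suc 0..n. f (k * (1 / real n))) * (1 / real n) \<le> F (n * (1 / real n)) - F ((0::nat) * (1 / real n))"
      using that cont der anti
      by (intro sum_antimono_bounds(1)[where F = F and f = f and h = "1 / real n" and a = 0 and b = n]) auto
    thus "R n \<le> F 1 - F 0" using that by (simp add: R_def)
    have "(\<Sum>k=0..<n. f (k * (1 / real n))) = f 0 + (\<Sum>k=1..<n. f (k * (1 / real n)))"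
      using that by (simp add: sum.atLeast_Suc_lessThan)
    also have "\<dots> \<le> 1 + (\<Sum>k=1..n. f (k * (1 / real n)))"
    proof (rule add_mono)
      show "(\<Sum>k=1..<n. f (k * (1 / real n))) \<le> (\<Sum>k=1..n. f (k * (1 / real n)))"
      proof (rule sum_mono2)
        fix b assume "b \<in> {1..n} - {1..<n}"
        hence "b = n" by auto
        thus "0 \<le> f (b * (1 / real n))" using k that by (simp add: f_def)
      qed auto
    qed (simp add: f_def)
    finally have sums: "(\<Sum>k=0..<n. f (k * (1 / real n))) \<le> 1 + (\<Sum>k=1..n. f (k * (1 / real n)))" .
    have "F (n * (1 / real n)) - F ((0::nat) * (1 / real n)) \<le> (\<Sum>k=0..<n. f (k * (1 / real n))) * (1 / real n)"
      using that cont der anti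
      by (intro sum_antimono_bounds(2)[where F = F and f = f and h = "1 / real n" and a = 0 and b = n]) auto
    also have "\<dots> \<le> (1 + (\<Sum>k=1..n. f (k * (1 / real n)))) * (1 / real n)"
      by (rule mult_right_mono[OF sums]) simp
    finally have "F 1 - F 0 \<le> (1 + (\<Sum>k=1..n. f (k * (1 / real n)))) * (1 / real n)"
      using that by simp
    thus "F 1 - F 0 - 1 / n \<le> R n" by (simp add: R_def algebra_simps add_divide_distrib)
  qed
  have "R \<longlonglongrightarrow> F 1 - F 0"
  proof (rule tendsto_sandwich)
    have "(\<lambda>n. F 1 - F 0 - 1 / real n) \<longlonglongrightarrow> F 1 - F 0 - 0"
      by (intro tendsto_intros lim_1_over_n)
    thus "(\<lambda>n. F 1 - F 0 - 1 / real n) \<longlonglongrightarrow> F 1 - F 0" by simp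
    show "\<forall>\<^sub>F n in sequentially. F 1 - F 0 - 1 / real n \<le> R n"
      using eventually_gt_at_top[of 0] by eventually_elim (rule low)
    show "\<forall>\<^sub>F n in sequentially. R n \<le> F 1 - F 0"
      using eventually_gt_at_top[of 0] by eventually_elim (rule up)
  qed auto
  thus ?thesis unfolding R val .
qed

section \<open>Convergence of the double sum\<close>

definition sample_area :: "real \<Rightarrow> nat \<Rightarrow> real" where
  "sample_area \<sigma> n = (\<Sum>k=1..<n. \<Sum>q=1..n-k. 1 / (2 * real k * real q) *
      sqrt (real q / real n * (real k / real n) * (1 - (1 - \<sigma>\<^sup>2) * (real q / real n + real k / real n))))"

text \<open>With \<open>N = k + q\<close> the summand becomes \<open>\<phi> n N / (2 * n)\<close>
  times a term of \<open>arcsine_sum N\<close>. Replacing \<open>arcsine_sum N\<close> by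
  \<open>pi\<close> costs a Cesaro mean of a null sequence, as \<open>\<phi>\<close> is bounded by
  1, and a Riemann sum remains.\<close>

lemma sample_area_tendsto:
  assumes \<sigma>: "0 \<le> \<sigma>" "\<sigma> \<le> 1"
  shows "sample_area \<sigma> \<longlonglongrightarrow> pi / 3 * ((\<sigma>\<^sup>2 + \<sigma> + 1) / (\<sigma> + 1))"
proof -
  define \<phi> where "\<phi> n N = sqrt (1 - (1 - \<sigma>\<^sup>2) * (real N / real n))" for n N :: nat
  have \<phi>01: "0 \<le> \<phi> n N" "\<phi> n N \<le> 1" if "N \<le> n" for n N
  proof -
    have "0 \<le> (1 - \<sigma>\<^sup>2)" "1 - \<sigma>\<^sup>2 \<le> 1" using \<sigma> by (auto simp: power_le_one)
    moreover have "0 \<le> real N / real n" "real N / real n \<le> 1" using that by (auto simp: divide_le_eq_1)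
    ultimately have "0 \<le> (1 - \<sigma>\<^sup>2) * (real N / real n)" "(1 - \<sigma>\<^sup>2) * (real N / real n) \<le> 1 * 1"
      by (intro mult_nonneg_nonneg mult_mono; simp)+
    thus "0 \<le> \<phi> n N" "\<phi> n N \<le> 1" by (auto simp: \<phi>_def)
  qed
  have A: "sample_area \<sigma> n = (\<Sum>N=1..n. \<phi> n N * arcsine_sum N) / n / 2" for n
  proof -
    have t: "1 / (2 * real k * real q) * sqrt (real q / real n * (real k / real n) * (1 - (1 - \<sigma>\<^sup>2) * (real q / real n + real k / real n)))
      = \<phi> n (k + q) * (1 / sqrt (real q * real k)) / n / 2" if "0 < k" "0 < q" for k q
    proof -
      have "sqrt (real q / real n * (real k / real n) * (1 - (1 - \<sigma>\<^sup>2) * (real q / real n + real k / real n))) =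
        sqrt (real q * real k) / n * \<phi> n (k + q)"
        by (simp add: \<phi>_def real_sqrt_mult real_sqrt_divide add_divide_distrib add.commute)
      moreover have "sqrt (real q * real k) / (real k * real q) = 1 / sqrt (real q * real k)"
        using that real_div_sqrt[of "real q * real k"] by (simp add: field_simps)
      moreover have "1 / (2 * real k * real q) * (sqrt (real q * real k) / n * \<phi> n (k + q)) =
        \<phi> n (k + q) * (sqrt (real q * real k) / (real k * real q)) / n / 2"
        by (simp add: mult_ac)
      ultimately show ?thesis by simp
    qed
    have "sample_area \<sigma> n = (\<Sum>k=1..<n. \<Sum>q=1..n-k. \<phi> n (k + q) * (1 / sqrt (real q * real k)) / n / 2)"
      unfolding sample_area_def by (intro sum.cong refl t) auto
    also have "\<dots> = (\<Sum>(k, q)\<in>(SIGMA k:{1..<n}. {1..n-k}). \<phi> n (k + q) * (1 / sqrt (real q * real k)) / n / 2)"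
      by (rule sum.Sigma) auto
    also have "\<dots> = (\<Sum>(N, q)\<in>(SIGMA N:{1..n}. {1..<N}). \<phi> n N * (1 / sqrt (real q * real (N - q))) / n / 2)"
      by (rule sum.reindex_bij_witness[of _ "\<lambda>(N, q). (N - q, q)" "\<lambda>(k, q). (k + q, q)"]) auto
    also have "\<dots> = (\<Sum>N=1..n. \<Sum>q=1..<N. \<phi> n N * (1 / sqrt (real q * real (N - q))) / n / 2)"
      by (rule sum.Sigma[symmetric]) auto
    also have "\<dots> = (\<Sum>N=1..n. \<phi> n N * arcsine_sum N) / n / 2"
      by (simp only: arcsine_sum_def sum_distrib_left sum_divide_distrib)
    finally show ?thesis .
  qed
  have "(\<lambda>n. (\<Sum>N=1..n. \<phi> n N * (arcsine_sum N - pi)) / n) \<longlonglongrightarrow> 0"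
  proof (rule Lim_null_comparison)
    show "(\<lambda>n. (\<Sum>N=1..n. \<bar>arcsine_sum N - pi\<bar>) / real n) \<longlonglongrightarrow> 0"
      using arcsine_sum_tendsto by (intro Cesaro_mean_tendsto_0 tendsto_rabs_zero) (simp add: LIM_zero_iff)
    show "\<forall>\<^sub>F n in sequentially. norm ((\<Sum>N=1..n. \<phi> n N * (arcsine_sum N - pi)) / n) \<le> (\<Sum>N=1..n. \<bar>arcsine_sum N - pi\<bar>) / real n"
    proof (rule always_eventually, rule allI)
      fix n :: nat
      have "\<bar>\<Sum>N=1..n. \<phi> n N * (arcsine_sum N - pi)\<bar> \<le> (\<Sum>N=1..n. \<bar>\<phi> n N * (arcsine_sum N - pi)\<bar>)"
        by (rule sum_abs)
      also have "\<dots> \<le> (\<Sum>N=1..n. \<bar>arcsine_sum N - pi\<bar>)"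
      proof (rule sum_mono)
        fix N assume "N \<in> {1..n}"
        hence "\<bar>\<phi> n N\<bar> * \<bar>arcsine_sum N - pi\<bar> \<le> 1 * \<bar>arcsine_sum N - pi\<bar>"
          using \<phi>01[of N n] by (intro mult_right_mono) auto
        thus "\<bar>\<phi> n N * (arcsine_sum N - pi)\<bar> \<le> \<bar>arcsine_sum N - pi\<bar>" by (simp add: abs_mult)
      qed
      finally show "norm ((\<Sum>N=1..n. \<phi> n N * (arcsine_sum N - pi)) / n) \<le> (\<Sum>N=1..n. \<bar>arcsine_sum N - pi\<bar>) / real n"
        by (simp add: abs_divide divide_right_mono)
    qed
  qed
  moreover have "(\<lambda>n. (\<Sum>N=1..n. \<phi> n N) / n) \<longlonglongrightarrow> 2 / 3 * ((\<sigma>\<^sup>2 + \<sigma> + 1) / (\<sigma> + 1))"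
    unfolding \<phi>_def by (rule Riemann_sum_sqrt[OF \<sigma>])
  ultimately have "(\<lambda>n. ((\<Sum>N=1..n. \<phi> n N * (arcsine_sum N - pi)) / n + pi * ((\<Sum>N=1..n. \<phi> n N) / n)) / 2)
    \<longlonglongrightarrow> (0 + pi * (2 / 3 * ((\<sigma>\<^sup>2 + \<sigma> + 1) / (\<sigma> + 1)))) / 2"
    by (intro tendsto_intros) simp_all
  also have "(\<lambda>n. ((\<Sum>N=1..n. \<phi> n N * (arcsine_sum N - pi)) / n + pi * ((\<Sum>N=1..n. \<phi> n N) / n)) / 2) = sample_area \<sigma>"
  proof
    fix n :: nat
    have "(\<Sum>N=1..n. \<phi> n N * arcsine_sum N) = (\<Sum>N=1..n. \<phi> n N * (arcsine_sum N - pi)) + pi * (\<Sum>N=1..n. \<phi> n N)"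
      by (simp add: sum_distrib_left sum.distrib[symmetric] algebra_simps)
    thus "((\<Sum>N=1..n. \<phi> n N * (arcsine_sum N - pi)) / n + pi * ((\<Sum>N=1..n. \<phi> n N) / n)) / 2 = sample_area \<sigma> n"
      unfolding A by (simp add: add_divide_distrib)
  qed
  moreover have "(0 + pi * (2 / 3 * x)) / 2 = pi / 3 * x" for x :: real
    by simp
  ultimately show ?thesis by (simp only:)
qed

section \<open>Passage to the limit\<close>

text \<open>A point is in the hull iff no direction separates it from the vertices, and separating
  directions form an open set, so a countable dense set of directions decides membership. The hulls
  are thus sections of a set that is measurable in the product, and the measure of sections depends
  measurably on \<open>\<omega>\<close>.\<close>

lemma measurable_measure_convex_hull:
  fixes Y :: "'i \<Rightarrow> 'a \<Rightarrow> 'b :: euclidean_space"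
  assumes "finite A" "A \<noteq> {}" and Y: "\<And>i. i \<in> A \<Longrightarrow> Y i \<in> borel_measurable M"
  shows "(\<lambda>\<omega>. measure lebesgue (convex hull ((\<lambda>i. Y i \<omega>) ` A))) \<in> borel_measurable M"
proof -
  obtain D :: "'b set" where D: "countable D" "\<And>X. open X \<Longrightarrow> X \<noteq> {} \<Longrightarrow> \<exists>d\<in>D. d \<in> X"
    using countable_dense_setE by blast
  let ?K = "\<lambda>\<omega>. convex hull ((\<lambda>i. Y i \<omega>) ` A)"
  have comp: "compact (?K \<omega>)" for \<omega>
    using assms(1) by (intro finite_imp_compact_convex_hull) auto
  have mem: "p \<in> ?K \<omega> \<longleftrightarrow> (\<forall>u\<in>D. \<exists>i\<in>A. u \<bullet> p \<le> u \<bullet> Y i \<omega>)" for p \<omega>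
  proof
    assume p: "p \<in> ?K \<omega>"
    show "\<forall>u\<in>D. \<exists>i\<in>A. u \<bullet> p \<le> u \<bullet> Y i \<omega>"
    proof (rule ballI, rule ccontr)
      fix u assume "\<not> (\<exists>i\<in>A. u \<bullet> p \<le> u \<bullet> Y i \<omega>)"
      hence "(\<lambda>i. Y i \<omega>) ` A \<subseteq> {x. u \<bullet> x < u \<bullet> p}" by (auto simp: not_le)
      hence "?K \<omega> \<subseteq> {x. u \<bullet> x < u \<bullet> p}"
        by (rule hull_minimal) (rule convex_halfspace_lt)
      thus False using p by auto
    qed
  next
    assume r: "\<forall>u\<in>D. \<exists>i\<in>A. u \<bullet> p \<le> u \<bullet> Y i \<omega>"
    show "p \<in> ?K \<omega>"
    proof (rule ccontr)
      assume "p \<notin> ?K \<omega>"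
      then obtain a b where ab: "a \<bullet> p < b" "\<forall>x\<in>?K \<omega>. b < a \<bullet> x"
        using separating_hyperplane_closed_point[of "?K \<omega>" p] compact_imp_closed[OF comp] by auto
      \<comment> \<open>The directions that separate \<open>p\<close> from all vertices; openness
        relies on the finiteness of \<open>A\<close>.\<close>
      define X where "X = (\<Inter>i\<in>A. {u. u \<bullet> Y i \<omega> < u \<bullet> p})"
      have "open X" unfolding X_def using assms(1)
        by (intro open_INT) (auto intro!: open_Collect_less continuous_intros)
      moreover have "- a \<in> X" using ab hull_inc[of _ "(\<lambda>i. Y i \<omega>) ` A" convex] by (force simp: X_def)
      ultimately obtain u where "u \<in> D" "u \<in> X" using D(2)[of X] by blast
      thus False using r by (fastforce simp: X_def)
    qed
  qed
  define G where "G = {z \<in> space (M \<Otimes>\<^sub>M lborel). \<forall>u\<in>D. \<exists>i\<in>A. u \<bullet> snd z \<le> u \<bullet> Y i (fst z)}"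
  have "D \<noteq> {}" using D(2)[of UNIV] by auto
  hence D_eq: "range (from_nat_into D) = D" using D(1) by (rule range_from_nat_into)
  have "Measurable.pred (M \<Otimes>\<^sub>M lborel) (\<lambda>z. \<forall>k. \<exists>i\<in>A. from_nat_into D k \<bullet> snd z \<le> from_nat_into D k \<bullet> Y i (fst z))"
  proof (intro pred_intros_countable pred_intros_finite[OF assms(1)])
    fix k i assume "i \<in> A"
    note [measurable] = Y[OF this]
    show "Measurable.pred (M \<Otimes>\<^sub>M lborel) (\<lambda>z. from_nat_into D k \<bullet> snd z \<le> from_nat_into D k \<bullet> Y i (fst z))"
      by measurable
  qed
  moreover have "(\<forall>u\<in>D. Q u) \<longleftrightarrow> (\<forall>k. Q (from_nat_into D k))" for Q
    by (subst D_eq[symmetric]) simp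
  ultimately have "Measurable.pred (M \<Otimes>\<^sub>M lborel) (\<lambda>z. \<forall>u\<in>D. \<exists>i\<in>A. u \<bullet> snd z \<le> u \<bullet> Y i (fst z))"
    by simp
  hence "G \<in> sets (M \<Otimes>\<^sub>M lborel)" unfolding G_def by (simp add: pred_def)
  hence "(\<lambda>\<omega>. emeasure lborel (Pair \<omega> -` G)) \<in> borel_measurable M"
    by (rule lborel.measurable_emeasure_Pair)
  hence "(\<lambda>\<omega>. enn2real (emeasure lborel (Pair \<omega> -` G))) \<in> borel_measurable M" by measurable
  moreover have "enn2real (emeasure lborel (Pair \<omega> -` G)) = measure lebesgue (?K \<omega>)" if "\<omega> \<in> space M" for \<omega>
  proof -
    have "Pair \<omega> -` G = ?K \<omega>" using that by (auto simp: G_def mem space_pair_measure)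
    moreover have "measure lebesgue (?K \<omega>) = measure lborel (?K \<omega>)"
      using comp by (intro measure_completion) (simp add: borel_compact)
    ultimately show ?thesis by (simp add: measure_def)
  qed
  ultimately show ?thesis by (subst measurable_cong[of M _ "\<lambda>\<omega>. enn2real (emeasure lborel (Pair \<omega> -` G))"]) auto
qed

text \<open>The hulls of the dyadic samples increase to a convex set that is dense in the hull of the path, and the boundary of a convex set is a null set.\<close>

lemma measure_dyadic_hull_tendsto:
  fixes f :: "real \<Rightarrow> 'a :: euclidean_space"
  assumes cont: "continuous_on {0..1} f"
  defines "K m \<equiv> convex hull ((\<lambda>l. f (real l / real (2 ^ m))) ` {..2 ^ m})"
  shows "incseq (\<lambda>m. measure lebesgue (K m))"
    and "(\<lambda>m. measure lebesgue (K m)) \<longlonglongrightarrow> measure lebesgue (convex hull (f ` {0..1}))"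
proof -
  let ?K = "convex hull (f ` {0..1})"
  have in01: "real l / real (2 ^ m) \<in> {0..1}" if "l \<le> 2 ^ m" for l m
    using that by (auto simp: divide_le_eq_1)
  have "compact ?K" using cont by (intro compact_convex_hull compact_continuous_image) auto
  have K_sub: "K m \<subseteq> ?K" for m unfolding K_def using in01 by (intro hull_mono) auto
  have Km: "K m \<in> lmeasurable" for m
    unfolding K_def by (intro lmeasurable_compact finite_imp_compact_convex_hull) auto
  have inc: "incseq K"
  proof (rule incseq_SucI)
    fix m
    show "K m \<subseteq> K (Suc m)" unfolding K_def
    proof (rule hull_mono, rule image_subsetI)
      fix l :: nat assume "l \<in> {..2 ^ m}"
      \<comment> \<open>A dyadic point stays a grid point after refinement.\<close>
      moreover have "f (real l / real (2 ^ m)) = f (real (2 * l) / real (2 ^ Suc m))" by simp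
      ultimately show "f (real l / real (2 ^ m)) \<in> (\<lambda>l. f (real l / real (2 ^ Suc m))) ` {..2 ^ Suc m}"
        by (intro image_eqI[where x = "2 * l"]) auto
    qed
  qed
  show "incseq (\<lambda>m. measure lebesgue (K m))"
  proof (rule incseq_SucI)
    fix m show "measure lebesgue (K m) \<le> measure lebesgue (K (Suc m))"
      by (rule measure_mono_fmeasurable[OF incseq_SucD[OF inc] fmeasurableD[OF Km] Km])
  qed
  define U where "U = (\<Union>m. K m)"
  have "U \<subseteq> ?K" using K_sub by (auto simp: U_def)
  have "convex U"
  proof (rule convexI)
    fix x y u v assume "x \<in> U" "y \<in> U" and uv: "(0::real) \<le> u" "0 \<le> v" "u + v = 1"
    then obtain i j where "x \<in> K i" "y \<in> K j" by (auto simp: U_def)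
    hence "x \<in> K (max i j)" "y \<in> K (max i j)" using incseqD[OF inc, of i "max i j"] incseqD[OF inc, of j "max i j"] by auto
    moreover have "convex (K (max i j))" by (simp add: K_def)
    ultimately have "u *\<^sub>R x + v *\<^sub>R y \<in> K (max i j)" using uv by (auto dest: convexD)
    thus "u *\<^sub>R x + v *\<^sub>R y \<in> U" by (auto simp: U_def)
  qed
  have dense: "f t \<in> closure U" if t: "t \<in> {0..1}" for t
    unfolding closure_approachable
  proof (intro allI impI)
    fix e :: real assume "e > 0"
    then obtain d where d: "d > 0" "\<And>s. s \<in> {0..1} \<Longrightarrow> dist s t < d \<Longrightarrow> dist (f s) (f t) < e"
      using cont t unfolding continuous_on_iff by blast
    obtain m where m: "(1 / 2) ^ m < d" using real_arch_pow_inv[OF d(1), of "1/2"] by auto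
    define l where "l = nat \<lfloor>t * 2 ^ m\<rfloor>"
    have l1: "real l \<le> t * 2 ^ m" "t * 2 ^ m < real l + 1" using t by (auto simp: l_def)
    have "t * 2 ^ m \<le> 1 * 2 ^ m" using t by (intro mult_right_mono) auto
    hence "real l \<le> 2 ^ m" using l1(1) by linarith
    hence "real l \<le> real (2 ^ m)" by simp
    hence l2: "l \<le> 2 ^ m" by (simp only: of_nat_le_iff)
    have "dist (real l / real (2 ^ m)) t = \<bar>real l - t * 2 ^ m\<bar> / 2 ^ m"
    proof -
      have "real l / real (2 ^ m) - t = (real l - t * 2 ^ m) / 2 ^ m" by (simp add: diff_divide_distrib)
      thus ?thesis by (simp add: dist_real_def)
    qed
    also have "\<dots> \<le> 1 / 2 ^ m" using l1 by (intro divide_right_mono) auto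
    also have "\<dots> < d" using m by (simp add: power_divide)
    finally have "dist (f (real l / real (2 ^ m))) (f t) < e" using in01[OF l2] by (intro d) auto
    moreover have "f (real l / real (2 ^ m)) \<in> U" unfolding U_def K_def using l2
      by (intro UN_I[of m] hull_inc) auto
    ultimately show "\<exists>y\<in>U. dist y (f t) < e" by blast
  qed
  have "?K \<subseteq> closure U"
    using dense \<open>convex U\<close> by (intro hull_minimal convex_closure) auto
  have "measure lebesgue U = measure lebesgue ?K"
  proof (rule measure_negligible_symdiff)
    show "?K \<in> lmeasurable" using \<open>compact ?K\<close> by (rule lmeasurable_compact)
    \<comment> \<open>A point of the hull outside \<open>U\<close> lies in the closure of
      \<open>U\<close> but not in its interior.\<close>
    have "?K - U \<subseteq> frontier U" using \<open>?K \<subseteq> closure U\<close> interior_subset by (auto simp: frontier_def)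
    thus "negligible (?K - U \<union> (U - ?K))"
      using \<open>U \<subseteq> ?K\<close> negligible_convex_frontier[OF \<open>convex U\<close>] negligible_subset by (metis Diff_eq_empty_iff sup_bot.right_neutral)
  qed
  moreover have "(\<lambda>m. measure lebesgue (K m)) \<longlonglongrightarrow> measure lebesgue (\<Union>m. K m)"
  proof (rule Lim_measure_incseq[OF _ inc])
    show "range K \<subseteq> sets lebesgue" using Km by (auto dest: fmeasurableD)
    have "emeasure lebesgue U \<le> emeasure lebesgue ?K"
      using \<open>U \<subseteq> ?K\<close> \<open>compact ?K\<close> by (intro emeasure_mono) (auto intro: lmeasurable_compact fmeasurableD)
    also have "\<dots> < \<infinity>" using lmeasurable_compact[OF \<open>compact ?K\<close>] by (auto simp: fmeasurable_def)
    finally show "emeasure lebesgue (\<Union>m. K m) \<noteq> \<infinity>" by (simp add: U_def)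
  qed
  ultimately show "(\<lambda>m. measure lebesgue (K m)) \<longlonglongrightarrow> measure lebesgue ?K" by (simp add: U_def)
qed

context bridge_gaussian
begin

text \<open>Two disjoint blocks that omit a step have \<open>s + t < 1\<close>, so their covariance
  determinant is positive even for \<open>\<sigma> = 0\<close>, and their sums are almost surely not
  parallel. There are only finitely many pairs of blocks.\<close>

lemma exchangeable_walk_incr_law:
  assumes n: "0 < n" and \<sigma>: "0 \<le> \<sigma>" "\<sigma> \<le> 1"
  shows "exchangeable_walk n (incr_law n)"
proof
  show "sets (incr_law n) = sets (Pi\<^sub>M {..<n} (\<lambda>_. borel))" by (simp add: incr_law_def)
  show "distr (incr_law n) (incr_law n) (\<lambda>x i. x (\<pi> i)) = incr_law n" if "\<pi> permutes {..<n}" for \<pi>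
    using incr_law_permute[OF that n] .
  have "AE x in incr_law n. I \<inter> J = {} \<longrightarrow> I \<noteq> {} \<longrightarrow> J \<noteq> {} \<longrightarrow> I \<union> J \<noteq> {..<n} \<longrightarrow> cr (sum x I) (sum x J) \<noteq> 0"
    if IJ: "I \<subseteq> {..<n}" "J \<subseteq> {..<n}" for I J
  proof (cases "I \<inter> J = {} \<and> I \<noteq> {} \<and> J \<noteq> {} \<and> I \<union> J \<noteq> {..<n}")
    case True
    define s where "s = real (card I) / real n"
    define t where "t = real (card J) / real n"
    have fin: "finite I" "finite J" using IJ finite_subset by blast+
    hence "card I + card J = card (I \<union> J)" using True by (simp add: card_Un_disjoint)
    also have "\<dots> < card {..<n}" using IJ True by (intro psubset_card_mono) auto
    finally have c: "real (card I) + real (card J) < real n" by simp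
    have "0 < card I" "0 < card J" using fin True by (auto simp: card_gt_0_iff)
    hence st: "0 < s" "0 < t" using n by (auto simp: s_def t_def)
    have "(1 - \<sigma>\<^sup>2) * (s + t) \<le> 1 * (s + t)"
      using \<sigma> st by (intro mult_right_mono) auto
    also have "\<dots> < 1" using c n by (simp add: s_def t_def add_divide_distrib[symmetric])
    finally have "(1 - \<sigma>\<^sup>2) * (s + t) < 1" .
    hence "sqrt (s * t * (1 - (1 - \<sigma>\<^sup>2) * (s + t))) \<noteq> 0" using st by simp
    hence AE: "AE \<omega> in M. cr (\<Sum>i\<in>I. incr n i \<omega>) (\<Sum>i\<in>J. incr n i \<omega>) \<noteq> 0"
      using True by (intro det_block_sums(2)[OF IJ _ _ _ \<sigma> s_def t_def]) auto
    let ?P = "Pi\<^sub>M {..<n} (\<lambda>_. borel :: (real ^ 2) measure)"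
    have [measurable]: "(\<lambda>x. sum x A) \<in> borel_measurable ?P" if "A \<subseteq> {..<n}" for A
      using that by (intro borel_measurable_sum measurable_component_singleton) auto
    have m: "{x \<in> space ?P. cr (sum x I) (sum x J) \<noteq> 0} \<in> sets ?P"
      using IJ by measurable
    have "sum (\<lambda>i\<in>{..<n}. incr n i \<omega>) A = (\<Sum>i\<in>A. incr n i \<omega>)" if "A \<subseteq> {..<n}" for A \<omega>
      using that by (intro sum.cong) auto
    hence "AE x in incr_law n. cr (sum x I) (sum x J) \<noteq> 0"
      unfolding incr_law_def using AE IJ by (subst AE_distr_iff[OF measurable_incr_vec m]) simp
    thus ?thesis by eventually_elim simp
  qed auto
  hence "AE x in incr_law n. \<forall>I\<in>Pow {..<n}. \<forall>J\<in>Pow {..<n}.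
      I \<inter> J = {} \<longrightarrow> I \<noteq> {} \<longrightarrow> J \<noteq> {} \<longrightarrow> I \<union> J \<noteq> {..<n} \<longrightarrow> cr (sum x I) (sum x J) \<noteq> 0"
    by (intro AE_finite_allI) auto
  thus "AE x in incr_law n. generic n x"
    by eventually_elim (auto simp: generic_def)
qed

lemma nn_integral_area_sample_hull:
  assumes n: "3 \<le> n" and \<sigma>: "0 \<le> \<sigma>" "\<sigma> \<le> 1"
  shows "(\<integral>\<^sup>+\<omega>. ennreal (measure lebesgue (convex hull ((\<lambda>l. X_process B Z \<sigma> (real l / real n) \<omega>) ` {..n}))) \<partial>M) =
    ennreal (sample_area \<sigma> n)"
proof -
  let ?P = "Pi\<^sub>M {..<n} (\<lambda>_. borel :: (real ^ 2) measure)"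
  let ?V = "\<lambda>\<omega>. \<lambda>i\<in>{..<n}. incr n i \<omega>"
  interpret W: exchangeable_walk n "incr_law n" using n \<sigma> by (intro exchangeable_walk_incr_law) auto
  have sum_V: "sum (?V \<omega>) A = (\<Sum>i\<in>A. incr n i \<omega>)" if "A \<subseteq> {..<n}" for A \<omega>
    using that by (intro sum.cong) auto
  have ms: "(\<lambda>x. sum x A) \<in> borel_measurable ?P" if "A \<subseteq> {..<n}" for A
    using that by (intro borel_measurable_sum measurable_component_singleton) auto
  \<comment> \<open>The path starts at \<open>B 0\<close>, which is 0 only almost surely; the walk
    of increments is therefore treated as a translate of the sample, and translation preserves
    area.\<close>
  have tele: "sum (?V \<omega>) {..<l} = X_process B Z \<sigma> (real l / real n) \<omega> - X_process B Z \<sigma> 0 \<omega>" if "l \<le> n" for l \<omega>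
  proof -
    have "sum (?V \<omega>) {..<l} = (\<Sum>i<l. incr n i \<omega>)" using that by (intro sum_V) auto
    also have "\<dots> = X_process B Z \<sigma> (real l / real n) \<omega> - X_process B Z \<sigma> (real 0 / real n) \<omega>"
      unfolding incr_def by (rule sum_lessThan_telescope)
    finally show ?thesis by simp
  qed
  have "measure lebesgue (convex hull ((\<lambda>l. X_process B Z \<sigma> (real l / real n) \<omega>) ` {..n})) =
    measure lebesgue (convex hull ((\<lambda>l. sum (?V \<omega>) {..<l}) ` {..n}))" for \<omega>
  proof -
    have "(\<lambda>l. X_process B Z \<sigma> (real l / real n) \<omega>) ` {..n} =
      (+) (X_process B Z \<sigma> 0 \<omega>) ` ((\<lambda>l. sum (?V \<omega>) {..<l}) ` {..n})"
      unfolding image_image by (intro image_cong refl) (simp only: atMost_iff tele, simp)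
    thus ?thesis by (simp only: convex_hull_translation measure_translation)
  qed
  hence "(\<integral>\<^sup>+\<omega>. ennreal (measure lebesgue (convex hull ((\<lambda>l. X_process B Z \<sigma> (real l / real n) \<omega>) ` {..n}))) \<partial>M) =
    (\<integral>\<^sup>+\<omega>. ennreal (measure lebesgue (convex hull ((\<lambda>l. sum (?V \<omega>) {..<l}) ` {..n}))) \<partial>M)" by simp
  also have "\<dots> = (\<integral>\<^sup>+x. ennreal (measure lebesgue (convex hull ((\<lambda>l. sum x {..<l}) ` {..n}))) \<partial>incr_law n)"
  proof -
    have "(\<lambda>x. ennreal (measure lebesgue (convex hull ((\<lambda>l. sum x {..<l}) ` {..n})))) \<in> borel_measurable ?P"
      by (intro measurable_compose[OF measurable_measure_convex_hull measurable_ennreal] ms) auto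
    thus ?thesis unfolding incr_law_def
      by (intro nn_integral_distr[OF measurable_incr_vec, symmetric]) simp
  qed
  also have "\<dots> = (\<Sum>k=1..<n. \<Sum>q=1..n-k. ennreal (1 / (2 * real k * real q)) *
       (\<integral>\<^sup>+x. ennreal \<bar>cr (sum x {..<q}) (sum x {n-k..<n})\<bar> \<partial>incr_law n))"
    by (rule W.nn_integral_area_convex_hull[OF n])
  also have "\<dots> = (\<Sum>k=1..<n. \<Sum>q=1..n-k. ennreal (1 / (2 * real k * real q) *
      sqrt (real q / real n * (real k / real n) * (1 - (1 - \<sigma>\<^sup>2) * (real q / real n + real k / real n)))))"
  proof (intro sum.cong[OF refl])
    fix k q assume kq: "k \<in> {1..<n}" "q \<in> {1..n-k}"
    have sub: "{..<q} \<subseteq> {..<n}" "{n-k..<n} \<subseteq> {..<n}" using kq by auto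
    have "(\<integral>\<^sup>+x. ennreal \<bar>cr (sum x {..<q}) (sum x {n-k..<n})\<bar> \<partial>incr_law n) =
      (\<integral>\<^sup>+\<omega>. ennreal \<bar>cr (sum (?V \<omega>) {..<q}) (sum (?V \<omega>) {n-k..<n})\<bar> \<partial>M)"
    proof -
      note [measurable] = ms[OF sub(1)] ms[OF sub(2)]
      have "(\<lambda>x. ennreal \<bar>cr (sum x {..<q}) (sum x {n-k..<n})\<bar>) \<in> borel_measurable ?P" by measurable
      thus ?thesis unfolding incr_law_def by (intro nn_integral_distr[OF measurable_incr_vec]) simp
    qed
    also have "\<dots> = (\<integral>\<^sup>+\<omega>. ennreal \<bar>cr (\<Sum>i\<in>{..<q}. incr n i \<omega>) (\<Sum>i\<in>{n-k..<n}. incr n i \<omega>)\<bar> \<partial>M)"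
      by (simp only: sum_V[OF sub(1)] sum_V[OF sub(2)])
    also have "\<dots> = ennreal (sqrt (real q / real n * (real k / real n) * (1 - (1 - \<sigma>\<^sup>2) * (real q / real n + real k / real n))))"
      using kq by (intro det_block_sums(1)[OF sub _ _ _ \<sigma>]) (auto simp: lessThan_empty_iff)
    finally show "ennreal (1 / (2 * real k * real q)) * (\<integral>\<^sup>+x. ennreal \<bar>cr (sum x {..<q}) (sum x {n-k..<n})\<bar> \<partial>incr_law n) =
      ennreal (1 / (2 * real k * real q) *
      sqrt (real q / real n * (real k / real n) * (1 - (1 - \<sigma>\<^sup>2) * (real q / real n + real k / real n))))"
      by (subst ennreal_mult') simp_all
  qed
  also have "\<dots> = ennreal (sample_area \<sigma> n)"
  proof -
    have nonneg: "0 \<le> 1 / (2 * real k * real q) * sqrt (real q / real n * (real k / real n) * (1 - (1 - \<sigma>\<^sup>2) * (real q / real n + real k / real n)))"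
      if "k \<in> {1..<n}" "q \<in> {1..n-k}" for k q
    proof -
      have "q + k \<le> n" using that by auto
      hence "real q + real k \<le> real n" by linarith
      hence "real q / real n + real k / real n \<le> 1"
        using n by (simp add: add_divide_distrib[symmetric] divide_le_eq_1)
      hence "(1 - \<sigma>\<^sup>2) * (real q / real n + real k / real n) \<le> 1 * 1"
        using \<sigma> by (intro mult_mono) (auto simp: power_le_one)
      thus ?thesis by simp
    qed
    show ?thesis unfolding sample_area_def
    proof (subst sum_ennreal[symmetric])
      show "0 \<le> (\<Sum>q=1..n-k. 1 / (2 * real k * real q) *
          sqrt (real q / real n * (real k / real n) * (1 - (1 - \<sigma>\<^sup>2) * (real q / real n + real k / real n))))"
        if "k \<in> {1..<n}" for k using that by (intro sum_nonneg nonneg)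
    qed (intro sum.cong[OF refl] sum_ennreal nonneg)
  qed
  finally show ?thesis .
qed

theorem expected_area_hull:
  assumes \<sigma>: "0 \<le> \<sigma>" "\<sigma> \<le> 1"
  shows "integrable M (\<lambda>\<omega>. area (K_hull B Z \<sigma> \<omega>))"
    and "(\<integral>\<omega>. area (K_hull B Z \<sigma> \<omega>) \<partial>M) = pi / 3 * ((\<sigma>\<^sup>2 + \<sigma> + 1) / (\<sigma> + 1))"
proof -
  define v where "v = pi / 3 * ((\<sigma>\<^sup>2 + \<sigma> + 1) / (\<sigma> + 1))"
  define A where "A m \<omega> = measure lebesgue (convex hull ((\<lambda>l. X_process B Z \<sigma> (real l / real (2 ^ m)) \<omega>) ` {..2 ^ m}))" for m :: nat and \<omega>
  let ?area = "\<lambda>\<omega>. area (K_hull B Z \<sigma> \<omega>)"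
  have cont: "continuous_on {0..1} (\<lambda>t. X_process B Z \<sigma> t \<omega>)" if "\<omega> \<in> space M" for \<omega>
    unfolding X_process_def using bridge that
    by (intro continuous_intros) (auto simp: brownian_bridge_def)
  have inc: "incseq (\<lambda>m. A m \<omega>)" and lim: "(\<lambda>m. A m \<omega>) \<longlonglongrightarrow> ?area \<omega>" if "\<omega> \<in> space M" for \<omega>
    using measure_dyadic_hull_tendsto[OF cont[OF that]] unfolding A_def area_def K_hull_def by auto
  have mA [measurable]: "A m \<in> borel_measurable M" for m
    unfolding A_def[abs_def]
    by (intro measurable_measure_convex_hull measurable_X) (auto simp: divide_le_eq_1)
  have [measurable]: "?area \<in> borel_measurable M"
    by (rule borel_measurable_LIMSEQ_real[OF lim mA])
  \<comment> \<open>The index \<open>m + 2\<close> gives at least three steps, as the sample formula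
    demands. The \<open>max 0\<close> meets the sign condition on the value without a separate proof
    that \<open>sample_area\<close> is nonnegative; it disappears in the limit.\<close>
  have "has_bochner_integral M (A (m + 2)) (max 0 (sample_area \<sigma> (2 ^ (m + 2))))" for m
  proof (rule has_bochner_integral_nn_integral)
    have "1 \<le> (2::nat) ^ m" "(2::nat) ^ (m + 2) = 4 * 2 ^ m" by simp_all
    hence "3 \<le> (2::nat) ^ (m + 2)" by linarith
    from nn_integral_area_sample_hull[OF this \<sigma>]
    have "(\<integral>\<^sup>+\<omega>. ennreal (A (m + 2) \<omega>) \<partial>M) = ennreal (sample_area \<sigma> (2 ^ (m + 2)))"
      unfolding A_def .
    thus "(\<integral>\<^sup>+\<omega>. ennreal (A (m + 2) \<omega>) \<partial>M) = ennreal (max 0 (sample_area \<sigma> (2 ^ (m + 2))))"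
      by (simp add: max_def ennreal_neg)
  qed (auto simp: A_def)
  hence int: "integrable M (A (m + 2))" "(\<integral>\<omega>. A (m + 2) \<omega> \<partial>M) = max 0 (sample_area \<sigma> (2 ^ (m + 2)))" for m
    by (auto simp: has_bochner_integral_iff)
  have "sample_area \<sigma> \<longlonglongrightarrow> v" unfolding v_def by (rule sample_area_tendsto[OF \<sigma>])
  moreover have "filterlim (\<lambda>m::nat. (2::nat) ^ (m + 2)) sequentially sequentially"
  proof (rule filterlim_subseq)
    show "strict_mono (\<lambda>m::nat. (2::nat) ^ (m + 2))" by (rule strict_monoI) simp
  qed
  ultimately have "(\<lambda>m. sample_area \<sigma> (2 ^ (m + 2))) \<longlonglongrightarrow> v" by (rule filterlim_compose)
  hence "(\<lambda>m. max 0 (sample_area \<sigma> (2 ^ (m + 2)))) \<longlonglongrightarrow> max 0 v" by (intro tendsto_max tendsto_const)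
  moreover have "0 \<le> v" using \<sigma> by (simp add: v_def)
  ultimately have lim_int: "(\<lambda>m. \<integral>\<omega>. A (m + 2) \<omega> \<partial>M) \<longlonglongrightarrow> v" by (simp only: int(2) max_absorb2)
  have mono: "AE \<omega> in M. mono (\<lambda>m. A (m + 2) \<omega>)"
  proof (rule AE_I2)
    fix \<omega> assume "\<omega> \<in> space M"
    thus "mono (\<lambda>m. A (m + 2) \<omega>)" using inc[of \<omega>] by (auto simp: mono_def)
  qed
  have limAE: "AE \<omega> in M. (\<lambda>m. A (m + 2) \<omega>) \<longlonglongrightarrow> ?area \<omega>"
    by (rule AE_I2) (rule LIMSEQ_ignore_initial_segment[OF lim])
  show "integrable M ?area"
    by (rule integrable_monotone_convergence[OF int(1) mono limAE lim_int]) measurable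
  show "(\<integral>\<omega>. ?area \<omega> \<partial>M) = pi / 3 * ((\<sigma>\<^sup>2 + \<sigma> + 1) / (\<sigma> + 1))"
    unfolding v_def[symmetric]
    by (rule integral_monotone_convergence[OF int(1) mono limAE lim_int]) measurable
qed

end

theorem corollary4p7:
  fixes M :: "'a measure" and B :: "real \<Rightarrow> 'a \<Rightarrow> real ^ 2" and Z :: "'a \<Rightarrow> real ^ 2"
    and \<sigma> :: real
  assumes "prob_space M"
    and "brownian_bridge M B"
    and "std_gaussian_vector M Z"
    and "process_indep M {0..1} B Z"
    and "0 \<le> \<sigma>" and "\<sigma> \<le> 1"
  shows "integrable M (\<lambda>\<omega>. area (K_hull B Z \<sigma> \<omega>))
    \<and> (\<integral>\<omega>. area (K_hull B Z \<sigma> \<omega>) \<partial>M) = pi / 3 * ((\<sigma>\<^sup>2 + \<sigma> + 1) / (\<sigma> + 1))"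
proof -
  interpret prob_space M by fact
  interpret bridge_gaussian M B Z \<sigma>
    using assms by unfold_locales
  show ?thesis using expected_area_hull[OF assms(5,6)] by blast
qed

end
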